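(* Let $\Xi$ be a determinantal point process on $\mathbb{R}^d$ with kernel $K$. If $\|K\|_\infty:=\sup_{x,y\in\mathbb{R}^d}|K(x,y)|<\infty$ and there exist constants $C_1,C_2,C_3,C_4>0$ such that $|K(x,y)|\le C_1e^{-C_2e^{C_3\|x-y\|}}$ for all $x,y\in\mathbb{R}^d$ with $\|x-y\|\ge C_4$, then $\Xi$ is an EDD point process.
   Context: A point process $\Xi$ on $\mathbb{R}^d$ is determinantal with kernel $K$ if it is simple and its joint intensities are $\rho_n(x_1,\dots,x_n)=\det[K(x_i,x_j)]_{1\le i,j\le n}$ for all $n\in\mathbb{N}$, $x_1,\dots,x_n\in\mathbb{R}^d$. EDD. For a point process $\Xi$ on $\mathbb{R}^d$ and $A_1,A_2\in\mathscr B(\mathbb{R}^d)$, with $\Xi_A$ the restriction of $\Xi$ to $A$, the $\beta$-mixing coefficient is $\beta_{A_1,A_2}=\frac12\int\int|\mathbb{P}(\Xi_{A_1}\in d\zeta_1,\Xi_{A_2}\in d\zeta_2)-\mathbb{P}(\Xi_{A_1}\in d\zeta_1)\mathbb{P}(\Xi_{A_2}\in d\zeta_2)|$ (integration over configurations on $A_1$ and $A_2$). $\mathrm{diam}(A)=\sup\{\|x-y\|:x,y\in A\}$, $d(A,B)=\inf\{\|x-y\|:x\in A,y\in B\}$, $\sup\emptyset=0$, $\inf\emptyset=\infty$. $\Xi$ has exponentially decay dependence (EDD) if there are constants $\theta_0\ge0$, $\theta_1,\dots,\theta_4>0$ such that $\beta_{A,B}\le\theta_1(\mathrm{diam}(A)^{\theta_0}\vee1)(\mathrm{diam}(B)^{\theta_0}\vee1)e^{-\theta_2d(A,B)}$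 for all Borel $A,B$ with $d(A,B)\ge\theta_3\ln(\mathrm{diam}(A)\vee\mathrm{diam}(B)\vee\theta_4)$. *)

theory Defs
  imports "HOL-Probability.Probability" "Jordan_Normal_Form.Determinant"
begin

text \<open>
  A configuration on \<open>A\<close> is a counting measure on (the Borel sets of) \<open>A\<close>: it takes finite
  natural-number values on bounded sets. On unbounded sets the value may be infinite.
\<close>

definition configurations :: "'a::euclidean_space set \<Rightarrow> 'a measure set" where
  "configurations A = {\<xi>. sets \<xi> = sets (restrict_space borel A) \<and>
     (\<forall>B \<in> sets (restrict_space borel A). bounded B \<longrightarrow> emeasure \<xi> B \<in> range of_nat)}"

text \<open>The \<open>\<sigma>\<close>-algebra is generated by the counts \<open>\<xi> \<mapsto> \<xi> B\<close>, \<open>B\<close> Borel.\<close>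

definition config_space :: "'a::euclidean_space set \<Rightarrow> 'a measure measure" where
  "config_space A =
     (SUP B \<in> sets (restrict_space borel A).
        vimage_algebra (configurations A) (\<lambda>\<xi>. emeasure \<xi> B) borel)"

definition point_process :: "'w measure \<Rightarrow> ('w \<Rightarrow> 'a::euclidean_space measure) \<Rightarrow> bool" where
  "point_process M \<Xi> \<longleftrightarrow> prob_space M \<and> \<Xi> \<in> M \<rightarrow>\<^sub>M config_space UNIV"

definition simple_point_process :: "'w measure \<Rightarrow> ('w \<Rightarrow> 'a::euclidean_space measure) \<Rightarrow> bool" where
  "simple_point_process M \<Xi> \<longleftrightarrow>
     point_process M \<Xi> \<and> (AE \<omega> in M. \<forall>x. emeasure (\<Xi> \<omega>) {x} \<le> 1)"

text \<open>
  Joint intensities are taken with respect to Lebesgue measure, in the sense of Hough, Krishnapur,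
  Peres and Virag: \<open>E [\<Prod>i<n. \<Xi> (D i)] = \<integral>\<^bsub>D 0 \<times> \<dots> \<times> D (n - 1)\<^esub> \<rho>\<close> for pairwise disjoint Borel sets
  \<open>D i\<close>, and \<open>\<rho>\<close> vanishes at points with two equal coordinates. A point \<open>(x 0, \<dots>, x (n - 1))\<close> of
  the \<open>n\<close>-fold product is an extensional function on \<open>{..<n}\<close>.
\<close>

definition joint_intensity ::
  "'w measure \<Rightarrow> ('w \<Rightarrow> 'a::euclidean_space measure) \<Rightarrow> nat \<Rightarrow> ((nat \<Rightarrow> 'a) \<Rightarrow> real) \<Rightarrow> bool" where
  "joint_intensity M \<Xi> n \<rho> \<longleftrightarrow>
     \<rho> \<in> borel_measurable (\<Pi>\<^sub>M i\<in>{..<n}. lborel) \<and>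
     (\<forall>x \<in> {..<n} \<rightarrow>\<^sub>E UNIV. 0 \<le> \<rho> x) \<and>
     (\<forall>x \<in> {..<n} \<rightarrow>\<^sub>E UNIV. \<not> inj_on x {..<n} \<longrightarrow> \<rho> x = 0) \<and>
     (\<forall>D. (\<forall>i<n. D i \<in> sets borel) \<and> disjoint_family_on D {..<n} \<longrightarrow>
        (\<integral>\<^sup>+ \<omega>. (\<Prod>i<n. emeasure (\<Xi> \<omega>) (D i)) \<partial>M) =
        (\<integral>\<^sup>+ x \<in> Pi\<^sub>E {..<n} D. ennreal (\<rho> x) \<partial>(\<Pi>\<^sub>M i\<in>{..<n}. lborel)))"

definition determinantal ::
  "'w measure \<Rightarrow> ('w \<Rightarrow> 'a::euclidean_space measure) \<Rightarrow> ('a \<Rightarrow> 'a \<Rightarrow> complex) \<Rightarrow> bool" where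
  "determinantal M \<Xi> K \<longleftrightarrow> simple_point_process M \<Xi> \<and>
     (\<exists>\<rho>. \<forall>n. joint_intensity M \<Xi> n (\<rho> n) \<and>
        (\<forall>x \<in> {..<n} \<rightarrow>\<^sub>E UNIV.
           complex_of_real (\<rho> n x) = Determinant.det (Matrix.mat n n (\<lambda>(i, j). K (x i) (x j)))))"

text \<open>
  The total mass \<open>\<integral>|d\<mu> - d\<nu>|\<close> of the variation of \<open>\<mu> - \<nu>\<close>, for finite measures \<open>\<mu>\<close>, \<open>\<nu>\<close> on the
  same \<open>\<sigma>\<close>-algebra.
\<close>

definition variation_diff :: "'b measure \<Rightarrow> 'b measure \<Rightarrow> real" where
  "variation_diff \<mu> \<nu> =
     (SUP P \<in> {P. finite P \<and> P \<subseteq> sets \<mu> \<and> partition_on (space \<mu>) P}.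
        \<Sum>E\<in>P. \<bar>measure \<mu> E - measure \<nu> E\<bar>)"

definition beta_mixing ::
  "'w measure \<Rightarrow> ('w \<Rightarrow> 'a::euclidean_space measure) \<Rightarrow> 'a set \<Rightarrow> 'a set \<Rightarrow> real" where
  "beta_mixing M \<Xi> A B =
     1 / 2 * variation_diff
       (distr M (config_space A \<Otimes>\<^sub>M config_space B)
          (\<lambda>\<omega>. (restrict_space (\<Xi> \<omega>) A, restrict_space (\<Xi> \<omega>) B)))
       (distr M (config_space A) (\<lambda>\<omega>. restrict_space (\<Xi> \<omega>) A) \<Otimes>\<^sub>M
        distr M (config_space B) (\<lambda>\<omega>. restrict_space (\<Xi> \<omega>) B))"

text \<open>
  Diameters and distances are extended reals, so that unbounded and empty sets are covered
  (\<^const>\<open>diameter\<close> and \<^const>\<open>setdist\<close> are real-valued and differ there).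
\<close>

definition ediam :: "'a::euclidean_space set \<Rightarrow> ereal" where
  "ediam A = (if A = {} then 0 else SUP (x, y) \<in> A \<times> A. ereal (norm (x - y)))"

definition edist :: "'a::euclidean_space set \<Rightarrow> 'a set \<Rightarrow> ereal" where
  "edist A B = (INF (x, y) \<in> A \<times> B. ereal (norm (x - y)))"

text \<open>
  Extensions to infinite arguments. The logarithm is only used at positive and the power only at
  nonnegative arguments with nonnegative exponent.
\<close>

definition ereal_ln :: "ereal \<Rightarrow> ereal" where
  "ereal_ln x = (case x of ereal r \<Rightarrow> ereal (ln r) | PInfty \<Rightarrow> \<infinity> | MInfty \<Rightarrow> -\<infinity>)"

definition ereal_exp :: "ereal \<Rightarrow> ereal" where
  "ereal_exp x = (case x of ereal r \<Rightarrow> ereal (exp r) | PInfty \<Rightarrow> \<infinity> | MInfty \<Rightarrow> 0)"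

definition ereal_powr :: "ereal \<Rightarrow> real \<Rightarrow> ereal" where
  "ereal_powr x p = (if p = 0 then 1 else if x = \<infinity> then \<infinity> else ereal (real_of_ereal x powr p))"

text \<open>
  If \<open>A\<close> or \<open>B\<close> is unbounded, the separation condition forces \<open>edist A B = \<infinity>\<close>, i.e. one of the sets
  is empty. Then the bound is \<open>0\<close>, using \<open>\<infinity> * 0 = 0\<close> in \<^typ>\<open>ereal\<close>, and so is the mixing coefficient.
\<close>

definition EDD :: "'w measure \<Rightarrow> ('w \<Rightarrow> 'a::euclidean_space measure) \<Rightarrow> bool" where
  "EDD M \<Xi> \<longleftrightarrow> point_process M \<Xi> \<and>
     (\<exists>\<theta>0 \<theta>1 \<theta>2 \<theta>3 \<theta>4 :: real. \<theta>0 \<ge> 0 \<and> \<theta>1 > 0 \<and> \<theta>2 > 0 \<and> \<theta>3 > 0 \<and> \<theta>4 > 0 \<and>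
       (\<forall>A \<in> sets borel. \<forall>B \<in> sets borel.
          edist A B \<ge> ereal \<theta>3 * ereal_ln (max (max (ediam A) (ediam B)) (ereal \<theta>4)) \<longrightarrow>
          ereal (beta_mixing M \<Xi> A B) \<le>
            ereal \<theta>1 * max (ereal_powr (ediam A) \<theta>0) 1 * max (ereal_powr (ediam B) \<theta>0) 1 *
            ereal_exp (- (ereal \<theta>2 * edist A B))))"

end

theory Submission
  imports Defs
begin

text \<open>
  Fix disjoint bounded Borel sets \<open>A\<close> and \<open>B\<close> at distance \<open>s\<close>, put \<open>W = A \<union> B\<close>, and let \<open>\<epsilon>\<close> be a
  bound for \<open>|K(x, y)|\<close> with \<open>x\<close> in \<open>A\<close> and \<open>y\<close> in \<open>B\<close>. The mixing coefficient compares two random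
  finite subsets of \<open>W\<close>: the points \<open>Z\<close> of the process in \<open>W\<close>, and the union of \<open>Z \<inter> A\<close> with an
  independent copy of \<open>Z \<inter> B\<close>. The product moments of both over disjoint sets \<open>D 1, \<dots>, D n\<close>, each
  contained in \<open>A\<close> or in \<open>B\<close>, are integrals of determinants. Those of the second set are obtained from those of the first by deleting
  the off-diagonal block whose rows belong to points of \<open>A\<close> and whose columns belong to points of
  \<open>B\<close>, and all entries of that block are at most \<open>\<epsilon>\<close> in modulus. Changing the rows one at a time
  and applying Hadamard's inequality, the two moments differ by at most
  \<open>\<epsilon> n (b \<surd>n)^n \<Prod>|D i|\<close>, where \<open>b \<ge> 1\<close> bounds \<open>|K|\<close> (\<open>det_block_difference\<close>, \<open>moment_split\<close>).

  Moments control laws as follows. Partition \<open>W\<close> into finitely many cells. If every cell contains at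
  most one point, then the indicator of an event that depends only on the occupied cells is a
  polynomial \<open>\<Sum>T a T \<Prod>c\<in>T N c\<close> in the counts \<open>N c\<close> with \<open>|a T| \<le> 2^|T|\<close> (inclusion-exclusion,
  \<open>indicator_polynomial\<close>). So the probabilities of such an event differ by at most
  \<open>\<Sum>T 2^|T| \<delta> |T| \<Prod>c\<in>T |c|\<close>, where \<open>\<delta> n \<Prod>|D i|\<close> bounds the difference of moments, and the sum is at
  most \<open>\<Sum>n (2v)^n \<delta> n / n!\<close> with \<open>v = |W|\<close>, for every partition. Refining the partition until it
  separates points removes the restriction on the cells; the limit is justified by
  \<open>E 3^|Z| < \<infinity>\<close>, which again follows from the moments (\<open>prob_difference_le_moment_differences\<close>).
  The events that depend on finitely many counts form an algebra that generates the
  \<open>\<sigma>\<close>-algebra of configurations, so the bound carries over to all events and to the total variation.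

  Finally, \<open>\<Sum>n (4v)^n (b \<surd>n)^n / n!\<close> grows like \<open>exp (c v^2)\<close>. This is where Hadamard's inequality
  matters: the bound \<open>n! b^n\<close> from the Leibniz formula would give a series that diverges for large \<open>v\<close>. If the diameters
  are at most \<open>exp (s / \<theta>3)\<close>, then \<open>v^2\<close> is at most a constant times \<open>exp (2 d s / \<theta>3)\<close>, \<open>d\<close> being the
  dimension, and \<open>\<theta>3 = 4 d / C3\<close> makes this \<open>exp (C3 s / 2)\<close>. The doubly exponential factor
  \<open>\<epsilon> \<le> C1 exp (- C2 exp (C3 s))\<close> outweighs \<open>exp (c exp (C3 s / 2))\<close>, and the product is at most a
  constant times \<open>exp (- s)\<close>. Hence the polynomial factors in the diameters can be dropped, that is, \<open>\<theta>0 = 0\<close>.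
\<close>

section \<open>Hadamard's inequality and determinants with a small block\<close>

abbreviation fun_det :: "nat \<Rightarrow> (nat \<Rightarrow> nat \<Rightarrow> complex) \<Rightarrow> complex" where
  "fun_det n a \<equiv> Determinant.det (Matrix.mat n n (\<lambda>(i, j). a i j))"

abbreviation row_norm :: "nat \<Rightarrow> (nat \<Rightarrow> complex) \<Rightarrow> real" where
  "row_norm n r \<equiv> L2_set (\<lambda>j. cmod (r j)) {..<n}"

lemma fun_det_linear_in_row:
  assumes "k < n"
  obtains c where "\<And>r. fun_det n (a(k := r)) = (\<Sum>j<n. r j * c j)"
proof
  fix r
  let ?A = "\<lambda>r. Matrix.mat n n (\<lambda>(i, j). (a(k := r)) i j)"
  have "mat_delete (?A r) k j = mat_delete (?A (a k)) k j" if "j < n" for j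
    by (rule eq_matI) (auto simp: mat_delete_def)
  then have cof: "cofactor (?A r) k j = cofactor (?A (a k)) k j" if "j < n" for j
    using that by (simp add: cofactor_def)
  have "fun_det n (a(k := r)) = (\<Sum>j<n. ?A r $$ (k, j) * cofactor (?A r) k j)"
    using assms by (intro laplace_expansion_row) auto
  also have "\<dots> = (\<Sum>j<n. r j * cofactor (?A (a k)) k j)"
    using assms cof by (intro sum.cong) auto
  finally show "fun_det n (a(k := r)) = (\<Sum>j<n. r j * cofactor (?A (a k)) k j)" .
qed

lemma fun_det_equal_rows:
  assumes "k < n" "i < n" "i \<noteq> k"
  shows "fun_det n (a(k := a i)) = 0"
  using assms by (intro det_identical_rows[of _ n i k]) auto

text \<open>
  The determinant is the pairing of row \<open>k\<close> with its vector \<open>c\<close> of cofactors, so among rows of given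
  norm it is largest in modulus at a multiple of the conjugate of \<open>c\<close>. That row is orthogonal to all
  other rows, because pairing another row with \<open>c\<close> gives a determinant with two equal rows. If
  \<open>c = 0\<close>, the scaling factor below is \<open>0\<close> and the new row is \<open>0\<close>.
\<close>

lemma orthogonalise_row:
  assumes k: "k < n"
  obtains r where "cmod (fun_det n a) \<le> cmod (fun_det n (a(k := r)))"
    "row_norm n r \<le> row_norm n (a k)"
    "\<And>i. i < n \<Longrightarrow> i \<noteq> k \<Longrightarrow> (\<Sum>j<n. a i j * cnj (r j)) = 0"
proof -
  obtain c where c: "\<And>r. fun_det n (a(k := r)) = (\<Sum>j<n. r j * c j)"
    using fun_det_linear_in_row[OF k, of a] by metis
  \<comment> \<open>Scales the conjugate of \<open>c\<close> to the norm of row \<open>k\<close>.\<close>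
  define t where "t = row_norm n (a k) / row_norm n c"
  have t0: "t \<ge> 0" by (simp add: t_def L2_set_nonneg)
  let ?r = "\<lambda>j. of_real t * cnj (c j)"
  have sq: "(\<Sum>j<n. (cmod (c j))\<^sup>2) = (row_norm n c)\<^sup>2"
    by (simp add: L2_set_def sum_nonneg)
  have "fun_det n (a(k := ?r)) = (\<Sum>j<n. of_real (t * (cmod (c j))\<^sup>2))"
    unfolding c by (intro sum.cong) (auto simp: complex_norm_square simp del: of_real_power)
  also have "\<dots> = of_real (t * (row_norm n c)\<^sup>2)"
    by (simp only: of_real_sum[symmetric] sum_distrib_left[symmetric] sq)
  also have "t * (row_norm n c)\<^sup>2 = row_norm n (a k) * row_norm n c"
    by (simp add: t_def power2_eq_square)
  finally have det_r: "fun_det n (a(k := ?r)) = of_real (row_norm n (a k) * row_norm n c)" .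
  have "cmod (fun_det n a) = cmod (\<Sum>j<n. a k j * c j)"
    using c[of "a k"] by simp
  also have "\<dots> \<le> (\<Sum>j<n. \<bar>cmod (a k j)\<bar> * \<bar>cmod (c j)\<bar>)"
    by (rule order_trans[OF norm_sum]) (simp add: norm_mult)
  also have "\<dots> \<le> row_norm n (a k) * row_norm n c"
    by (rule L2_set_mult_ineq)
  also have "\<dots> = cmod (fun_det n (a(k := ?r)))"
    unfolding det_r by (simp add: norm_mult L2_set_nonneg)
  finally have 1: "cmod (fun_det n a) \<le> cmod (fun_det n (a(k := ?r)))" .
  have "row_norm n ?r = t * row_norm n c"
    using t0 by (simp add: norm_mult L2_set_right_distrib)
  also have "\<dots> \<le> row_norm n (a k)"
    by (simp add: t_def L2_set_nonneg)
  finally have 2: "row_norm n ?r \<le> row_norm n (a k)" .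
  have 3: "(\<Sum>j<n. a i j * cnj (?r j)) = 0" if "i < n" "i \<noteq> k" for i
  proof -
    have "(\<Sum>j<n. a i j * cnj (?r j)) = of_real t * (\<Sum>j<n. a i j * c j)"
      by (simp add: sum_distrib_left algebra_simps)
    then show ?thesis using fun_det_equal_rows[OF k that, of a] c[of "a i"] by simp
  qed
  show thesis using that[OF 1 2 3] by blast
qed

text \<open>
  For orthogonal rows, the product of the matrix and its conjugate transpose is diagonal.
\<close>

lemma hadamard_orthogonal:
  assumes orth: "\<And>i k. i < n \<Longrightarrow> k < n \<Longrightarrow> i \<noteq> k \<Longrightarrow> (\<Sum>j<n. b i j * cnj (b k j)) = 0"
  shows "cmod (fun_det n b) = (\<Prod>i<n. row_norm n (b i))"
proof -
  let ?B = "Matrix.mat n n (\<lambda>(i, j). b i j)"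
  let ?C = "Matrix.mat n n (\<lambda>(i, j). cnj (b i j))"
  interpret cnj: comm_ring_hom cnj by standard auto
  have C: "?C = map_mat cnj ?B" by (rule eq_matI) auto
  have "?B * transpose_mat ?C = Matrix.mat n n (\<lambda>(i, j). if i = j then of_real ((row_norm n (b i))\<^sup>2) else 0)"
  proof (rule eq_matI, goal_cases)
    case (1 i j)
    have *: "(\<Sum>l<n. b i l * cnj (b i l)) = of_real ((row_norm n (b i))\<^sup>2)"
      by (simp add: L2_set_def sum_nonneg complex_norm_square[symmetric] real_sqrt_pow2)
    have "(?B * transpose_mat ?C) $$ (i, j) = (\<Sum>l<n. b i l * cnj (b j l))"
      using 1 by (simp add: scalar_prod_def atLeast0LessThan)
    then show ?case using 1 orth[of i j] * by auto
  qed auto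
  then have "Determinant.det (?B * transpose_mat ?C) = (\<Prod>i<n. of_real ((row_norm n (b i))\<^sup>2))"
    by (subst det_upper_triangular[where n = n])
       (auto simp: diag_mat_def prod.list_conv_set_nth atLeast0LessThan)
  also have "Determinant.det (?B * transpose_mat ?C) = fun_det n b * cnj (fun_det n b)"
    by (subst det_mult[where n = n]) (auto simp: det_transpose[where n = n] C cnj.hom_det)
  finally have "complex_of_real ((cmod (fun_det n b))\<^sup>2) = of_real ((\<Prod>i<n. row_norm n (b i))\<^sup>2)"
    by (simp add: complex_norm_square[symmetric] prod_power_distrib)
  then have "(cmod (fun_det n b))\<^sup>2 = (\<Prod>i<n. row_norm n (b i))\<^sup>2"
    using of_real_eq_iff by blast
  then show ?thesis
    by (simp add: power2_eq_iff_nonneg prod_nonneg L2_set_nonneg)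
qed

text \<open>
  Replace the rows one after the other as in \<open>orthogonalise_row\<close>. A row that has become orthogonal to
  all others stays so, since each replacement is itself orthogonal to all other rows. After \<open>n\<close> steps
  the rows are pairwise orthogonal, and the modulus of the determinant has not decreased.
\<close>

theorem hadamard_inequality:
  "cmod (fun_det n a) \<le> (\<Prod>i<n. row_norm n (a i))"
proof -
  have "\<exists>b. cmod (fun_det n a) \<le> cmod (fun_det n b) \<and> (\<forall>i<n. row_norm n (b i) \<le> row_norm n (a i)) \<and>
      (\<forall>k<m. \<forall>i<n. i \<noteq> k \<longrightarrow> (\<Sum>j<n. b i j * cnj (b k j)) = 0)" if "m \<le> n" for m
    using that
  proof (induction m)
    case 0
    then show ?case by auto
  next
    case (Suc m)
    then obtain b where b: "cmod (fun_det n a) \<le> cmod (fun_det n b)"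
      "\<And>i. i < n \<Longrightarrow> row_norm n (b i) \<le> row_norm n (a i)"
      "\<And>i k. k < m \<Longrightarrow> i < n \<Longrightarrow> i \<noteq> k \<Longrightarrow> (\<Sum>j<n. b i j * cnj (b k j)) = 0"
      by auto
    obtain r where r: "cmod (fun_det n b) \<le> cmod (fun_det n (b(m := r)))"
      "row_norm n r \<le> row_norm n (b m)"
      "\<And>i. i < n \<Longrightarrow> i \<noteq> m \<Longrightarrow> (\<Sum>j<n. b i j * cnj (r j)) = 0"
      using orthogonalise_row[of m n b] Suc.prems by auto
    have r': "(\<Sum>j<n. r j * cnj (b i j)) = 0" if "i < n" "i \<noteq> m" for i
    proof -
      have "(\<Sum>j<n. r j * cnj (b i j)) = cnj (\<Sum>j<n. b i j * cnj (r j))"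
        by (simp add: mult.commute)
      then show ?thesis using r(3)[OF that] by simp
    qed
    show ?case
    proof (intro exI[of _ "b(m := r)"] conjI allI impI)
      show "cmod (fun_det n a) \<le> cmod (fun_det n (b(m := r)))" using b(1) r(1) by simp
    next
      fix i assume "i < n"
      then show "row_norm n ((b(m := r)) i) \<le> row_norm n (a i)"
        using b(2)[of i] r(2) by auto
    next
      fix k i assume "k < Suc m" "i < n" "i \<noteq> k"
      then show "(\<Sum>j<n. (b(m := r)) i j * cnj ((b(m := r)) k j)) = 0"
        using b(3)[of k i] r(3)[of i] r'[of k] Suc.prems by (cases "k = m"; cases "i = m") auto
    qed
  qed
  from this[OF le_refl] obtain b where b: "cmod (fun_det n a) \<le> cmod (fun_det n b)"
    and b_norm: "\<forall>i<n. row_norm n (b i) \<le> row_norm n (a i)"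
    and b_orth: "\<forall>k<n. \<forall>i<n. i \<noteq> k \<longrightarrow> (\<Sum>j<n. b i j * cnj (b k j)) = 0"
    by (elim exE conjE)
  have "cmod (fun_det n b) = (\<Prod>i<n. row_norm n (b i))"
    using b_orth by (intro hadamard_orthogonal) simp
  also have "\<dots> \<le> (\<Prod>i<n. row_norm n (a i))"
    using b_norm by (intro prod_mono) (auto simp: L2_set_nonneg)
  finally show ?thesis using b by simp
qed

lemma row_norm_le:
  assumes "\<And>j. j < n \<Longrightarrow> cmod (r j) \<le> b" "0 \<le> b"
  shows "row_norm n r \<le> b * sqrt n"
proof -
  have "row_norm n r \<le> L2_set (\<lambda>_. b) {..<n}"
    using assms by (intro L2_set_mono) auto
  also have "\<dots> = b * sqrt n"
    using assms by (simp add: L2_set_def real_sqrt_mult)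
  finally show ?thesis .
qed

corollary hadamard_bounded_entries:
  assumes "\<And>i j. i < n \<Longrightarrow> j < n \<Longrightarrow> cmod (a i j) \<le> b" "0 \<le> b"
  shows "cmod (fun_det n a) \<le> (b * sqrt n) ^ n"
proof -
  have "(\<Prod>i<n. row_norm n (a i)) \<le> (\<Prod>i<n. b * sqrt n)"
    using assms by (intro prod_mono) (auto simp: L2_set_nonneg intro!: row_norm_le)
  then show ?thesis using hadamard_inequality[of n a] by simp
qed

lemma fun_det_block_lower:
  assumes "\<And>i j. i < p \<Longrightarrow> p \<le> j \<Longrightarrow> j < p + q \<Longrightarrow> b i j = 0"
  shows "fun_det (p + q) b = fun_det p b * fun_det q (\<lambda>i j. b (p + i) (p + j))"
proof -
  have "Matrix.mat (p + q) (p + q) (\<lambda>(i, j). b i j) =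
    four_block_mat (Matrix.mat p p (\<lambda>(i, j). b i j)) (0\<^sub>m p q)
      (Matrix.mat q p (\<lambda>(i, j). b (p + i) j)) (Matrix.mat q q (\<lambda>(i, j). b (p + i) (p + j)))"
    using assms by (intro eq_matI) auto
  then show ?thesis
    by (simp add: det_four_block_mat_upper_right_zero[where n = p and m = q])
qed

text \<open>
  Set the upper right block to zero row by row. Each step changes the determinant by a determinant
  with one row of norm at most \<open>\<epsilon> \<surd>n\<close>, to which Hadamard's inequality applies, and after the
  last step the determinant factorises.
\<close>

proposition det_block_difference:
  assumes bd: "\<And>i j. i < p + q \<Longrightarrow> j < p + q \<Longrightarrow> cmod (a i j) \<le> b" and b: "1 \<le> b"
    and eps: "\<And>i j. i < p \<Longrightarrow> p \<le> j \<Longrightarrow> j < p + q \<Longrightarrow> cmod (a i j) \<le> \<epsilon>" and "0 \<le> \<epsilon>"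
  shows "cmod (fun_det (p + q) a - fun_det p a * fun_det q (\<lambda>i j. a (p + i) (p + j)))
    \<le> \<epsilon> * real (p + q) * (b * sqrt (real (p + q))) ^ (p + q)"
proof -
  define n where "n = p + q"
  define z where "z k = (\<lambda>i j. if i < k \<and> p \<le> j then 0 else a i j)" for k :: nat
  have step: "cmod (fun_det n (z k) - fun_det n (z (Suc k))) \<le> \<epsilon> * (b * sqrt n) ^ n" if "k < p" for k
  proof -
    have kn: "k < n" using that by (simp add: n_def)
    obtain c where c: "\<And>r. fun_det n ((z k)(k := r)) = (\<Sum>j<n. r j * c j)"
      using fun_det_linear_in_row[OF kn, of "z k"] by metis
    have "z (Suc k) = (z k)(k := z (Suc k) k)" by (auto simp: z_def fun_eq_iff)
    then have "fun_det n (z k) - fun_det n (z (Suc k)) = (\<Sum>j<n. (z k k j - z (Suc k) k j) * c j)"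
      using c[of "z k k"] c[of "z (Suc k) k"] by (simp add: sum_subtractf left_diff_distrib)
    also have "\<dots> = fun_det n ((z k)(k := (\<lambda>j. z k k j - z (Suc k) k j)))"
      by (simp only: c)
    finally have eq: "fun_det n (z k) - fun_det n (z (Suc k)) = fun_det n ((z k)(k := (\<lambda>j. z k k j - z (Suc k) k j)))" (is "_ = fun_det n ?d") .
    have "cmod (fun_det n ?d) \<le> (\<Prod>i<n. row_norm n (?d i))" by (rule hadamard_inequality)
    also have "\<dots> \<le> (\<Prod>i<n. if i = k then \<epsilon> * sqrt n else b * sqrt n)"
    proof (intro prod_mono conjI)
      fix i assume i: "i \<in> {..<n}"
      show "row_norm n (?d i) \<le> (if i = k then \<epsilon> * sqrt n else b * sqrt n)"
      proof (cases "i = k")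
        case True
        have "row_norm n (?d k) \<le> \<epsilon> * sqrt n"
          using eps[of k] that \<open>0 \<le> \<epsilon>\<close> by (intro row_norm_le) (auto simp: z_def n_def)
        then show ?thesis using True by simp
      next
        case False
        have "row_norm n (?d i) \<le> b * sqrt n"
          using bd[of i] i b False by (intro row_norm_le) (auto simp: z_def n_def)
        then show ?thesis using False by simp
      qed
    qed (rule L2_set_nonneg)
    also have "\<dots> = (\<epsilon> * sqrt n) * (\<Prod>i\<in>{..<n} - {k}. if i = k then \<epsilon> * sqrt n else b * sqrt n)"
      using kn by (subst prod.remove[of _ k]) simp_all
    also have "(\<Prod>i\<in>{..<n} - {k}. if i = k then \<epsilon> * sqrt n else b * sqrt n) = (\<Prod>i\<in>{..<n} - {k}. b * sqrt n)"
      by (rule prod.cong) simp_all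
    also have "\<dots> = (b * sqrt n) ^ (n - 1)"
      using kn by simp
    also have "(\<epsilon> * sqrt n) * (b * sqrt n) ^ (n - 1) \<le> (\<epsilon> * (b * sqrt n)) * (b * sqrt n) ^ (n - 1)"
      using b \<open>0 \<le> \<epsilon>\<close> mult_right_mono[of 1 b "sqrt n"] by (intro mult_right_mono mult_left_mono) auto
    also have "\<dots> = \<epsilon> * (b * sqrt n) ^ n"
      using kn by (cases n) auto
    finally show ?thesis using eq by simp
  qed
  have "cmod (fun_det n (z 0) - fun_det n (z m)) \<le> m * (\<epsilon> * (b * sqrt n) ^ n)" if "m \<le> p" for m
    using that
  proof (induction m)
    case (Suc m)
    have "cmod (fun_det n (z 0) - fun_det n (z (Suc m))) \<le>
        cmod (fun_det n (z 0) - fun_det n (z m)) + cmod (fun_det n (z m) - fun_det n (z (Suc m)))"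
      using norm_triangle_ineq[of "fun_det n (z 0) - fun_det n (z m)" "fun_det n (z m) - fun_det n (z (Suc m))"]
      by simp
    also have "\<dots> \<le> m * (\<epsilon> * (b * sqrt n) ^ n) + \<epsilon> * (b * sqrt n) ^ n"
      using Suc step[of m] by simp
    finally show ?case by (simp add: algebra_simps)
  qed simp
  from this[of p] have "cmod (fun_det n (z 0) - fun_det n (z p)) \<le> p * (\<epsilon> * (b * sqrt n) ^ n)" by simp
  also have "\<dots> \<le> n * (\<epsilon> * (b * sqrt n) ^ n)"
    using \<open>0 \<le> \<epsilon>\<close> b by (intro mult_right_mono) (auto simp: n_def)
  finally have main: "cmod (fun_det n (z 0) - fun_det n (z p)) \<le> \<epsilon> * n * (b * sqrt n) ^ n"
    by (simp add: algebra_simps)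
  have z0: "z 0 = a" by (simp add: z_def)
  have "fun_det n (z p) = fun_det p (z p) * fun_det q (\<lambda>i j. z p (p + i) (p + j))"
    unfolding n_def by (rule fun_det_block_lower) (auto simp: z_def)
  also have "Matrix.mat p p (\<lambda>(i, j). z p i j) = Matrix.mat p p (\<lambda>(i, j). a i j)"
    by (rule eq_matI) (auto simp: z_def)
  also have "(\<lambda>i j. z p (p + i) (p + j)) = (\<lambda>i j. a (p + i) (p + j))"
    by (auto simp: z_def)
  finally have eq: "fun_det n (z p) = fun_det p a * fun_det q (\<lambda>i j. a (p + i) (p + j))" .
  show ?thesis using main unfolding eq z0 unfolding n_def .
qed


section \<open>Sums over subsets and the Hadamard series\<close>

lemma power_Suc_add_ge:
  fixes s x :: real
  assumes "0 \<le> s" "0 \<le> x"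
  shows "s ^ Suc n + real (Suc n) * x * s ^ n \<le> (s + x) ^ Suc n"
proof (induction n)
  case (Suc n)
  have "s ^ Suc (Suc n) + real (Suc (Suc n)) * x * s ^ Suc n \<le>
      s * (s ^ Suc n + real (Suc n) * x * s ^ n) + x * s ^ Suc n"
    by (simp add: algebra_simps)
  also have "\<dots> \<le> s * (s + x) ^ Suc n + x * (s + x) ^ Suc n"
    using Suc assms by (intro add_mono mult_left_mono power_mono) auto
  finally show ?case by (simp add: algebra_simps)
qed simp

text \<open>
  For \<open>f\<close> the indicator of \<open>{n}\<close> this is the bound \<open>s^n / n!\<close> for the \<open>n\<close>-th elementary symmetric
  polynomial in terms of the sum \<open>s\<close>. Stating it for all \<open>f\<close> makes the induction direct: subsets
  containing the new element contribute the same sum for the shifted \<open>f\<close>.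
\<close>

lemma sum_subsets_prod_le_power_sum:
  fixes x :: "'i \<Rightarrow> real" and f :: "nat \<Rightarrow> real"
  assumes "finite I" "\<And>i. i \<in> I \<Longrightarrow> 0 \<le> x i" "\<And>n. 0 \<le> f n"
  shows "(\<Sum>T\<in>Pow I. f (card T) * prod x T) \<le> (\<Sum>n\<le>card I. f n * sum x I ^ n / fact n)"
  using assms
proof (induction I arbitrary: f)
  case empty
  then show ?case by simp
next
  case (insert a I)
  let ?s = "sum x I" and ?N = "card I"
  have s: "0 \<le> ?s" and a: "0 \<le> x a" using insert by (auto intro: sum_nonneg)
  have inj: "inj_on (insert a) (Pow I)"
    using insert.hyps by (intro inj_onI) (metis Pow_iff insert_ident subsetD)
  have disj: "Pow I \<inter> insert a ` Pow I = {}" using insert by auto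
  have "(\<Sum>T\<in>Pow (insert a I). f (card T) * prod x T)
      = (\<Sum>T\<in>Pow I. f (card T) * prod x T) + (\<Sum>T\<in>Pow I. f (card (insert a T)) * prod x (insert a T))"
    unfolding Pow_insert using insert disj inj by (simp add: sum.union_disjoint sum.reindex o_def)
  also have "(\<Sum>T\<in>Pow I. f (card (insert a T)) * prod x (insert a T)) = x a * (\<Sum>T\<in>Pow I. f (Suc (card T)) * prod x T)"
    unfolding sum_distrib_left
  proof (intro sum.cong refl)
    fix T assume "T \<in> Pow I"
    then have "finite T" "a \<notin> T" using insert by (auto intro: finite_subset)
    then show "f (card (insert a T)) * prod x (insert a T) = x a * (f (Suc (card T)) * prod x T)" by simp
  qed
  also have "(\<Sum>T\<in>Pow I. f (card T) * prod x T) \<le> (\<Sum>n\<le>?N. f n * ?s ^ n / fact n)"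
    using insert by (intro insert.IH) auto
  also have "(\<Sum>T\<in>Pow I. f (Suc (card T)) * prod x T) \<le> (\<Sum>n\<le>?N. f (Suc n) * ?s ^ n / fact n)"
    using insert by (intro insert.IH[of "\<lambda>n. f (Suc n)"]) auto
  also have "(\<Sum>n\<le>?N. f n * ?s ^ n / fact n) + x a * (\<Sum>n\<le>?N. f (Suc n) * ?s ^ n / fact n)
     \<le> (\<Sum>n\<le>Suc ?N. f n * ?s ^ n / fact n) + x a * (\<Sum>n\<le>?N. f (Suc n) * ?s ^ n / fact n)"
    using insert s by simp
  also have "\<dots> = f 0 + (\<Sum>n\<le>?N. f (Suc n) * ?s ^ Suc n / fact (Suc n) + x a * (f (Suc n) * ?s ^ n / fact n))"
    by (simp only: sum.atMost_Suc_shift sum.distrib sum_distrib_left) simp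
  also have "\<dots> \<le> f 0 + (\<Sum>n\<le>?N. f (Suc n) * (?s + x a) ^ Suc n / fact (Suc n))"
  proof (intro add_left_mono sum_mono)
    fix n
    have "f (Suc n) * ?s ^ Suc n / fact (Suc n) + x a * (f (Suc n) * ?s ^ n / fact n)
      = f (Suc n) * (?s ^ Suc n + real (Suc n) * x a * ?s ^ n) / fact (Suc n)"
      by (simp add: field_simps del: power_Suc of_nat_Suc)
    also have "\<dots> \<le> f (Suc n) * (?s + x a) ^ Suc n / fact (Suc n)"
      using power_Suc_add_ge[OF s a] insert.prems by (intro divide_right_mono mult_left_mono) auto
    finally show "f (Suc n) * ?s ^ Suc n / fact (Suc n) + x a * (f (Suc n) * ?s ^ n / fact n) \<le>
      f (Suc n) * (?s + x a) ^ Suc n / fact (Suc n)" .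
  qed
  also have "\<dots> = (\<Sum>n\<le>card (insert a I). f n * sum x (insert a I) ^ n / fact n)"
    using insert.hyps by (simp add: sum.atMost_Suc_shift add.commute del: sum.atMost_Suc power_Suc fact_Suc)
  finally show ?case using a by (simp add: mult_left_mono)
qed

lemma power_le_exp_fact: "real n ^ n \<le> exp 1 ^ n * fact n"
proof -
  have "real n ^ n / fact n \<le> (\<Sum>k. real n ^ k / fact k)"
    using summable_exp[of "real n"]
    by (intro sum_le_suminf[where I = "{n}", simplified]) (auto simp: field_simps)
  also have "\<dots> = exp (real n)" by (simp add: exp_def field_simps)
  also have "\<dots> = exp 1 ^ n" by (simp add: exp_of_nat_mult[symmetric])
  finally show ?thesis by (simp add: field_simps)
qed

text \<open>
  Since \<open>n^n \<le> e^n n!\<close>, the term is at most \<open>y^n / \<surd>(n!)\<close> with \<open>y = 4 v b \<surd>e\<close>. Write it as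
  \<open>((2y)^n / \<surd>(n!)) (1/2)^n\<close> and apply the inequality of arithmetic and geometric means.
\<close>

lemma hadamard_series_term:
  fixes v b :: real
  assumes "0 \<le> v" "0 \<le> b"
  shows "(4 * v) ^ n / fact n * (b * sqrt n) ^ n
    \<le> ((64 * exp 1 * (v * b)\<^sup>2) ^ n / fact n + (1 / 4) ^ n) / 2"
proof -
  define y where "y = 4 * v * b * sqrt (exp 1)"
  have am: "p * q \<le> (p\<^sup>2 + q\<^sup>2) / 2" for p q :: real
    using sum_squares_bound[of p q] by (simp add: field_simps)
  have "sqrt n ^ n = sqrt (real n ^ n)" by (simp add: real_sqrt_power)
  also have "\<dots> \<le> sqrt (exp 1 ^ n * fact n)" using power_le_exp_fact by simp
  also have "\<dots> = sqrt (exp 1) ^ n * sqrt (fact n)" by (simp add: real_sqrt_mult real_sqrt_power)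
  finally have "sqrt n ^ n \<le> sqrt (exp 1) ^ n * sqrt (fact n)" .
  then have "(4 * v) ^ n / fact n * (b * sqrt n) ^ n \<le> (4 * v) ^ n / fact n * (b ^ n * (sqrt (exp 1) ^ n * sqrt (fact n)))"
    using assms unfolding power_mult_distrib[of b] by (intro mult_left_mono) auto
  also have "\<dots> = y ^ n * (sqrt (fact n) / fact n)"
    by (simp add: y_def power_mult_distrib)
  also have "sqrt (fact n) / (fact n :: real) = 1 / sqrt (fact n)"
    by (simp add: real_div_sqrt field_simps)
  also have "y ^ n * (1 / sqrt (fact n)) = ((2 * y) ^ n / sqrt (fact n)) * (1 / 2) ^ n"
    by (simp add: power_mult_distrib power_one_over)
  also have "\<dots> \<le> (((2 * y) ^ n / sqrt (fact n))\<^sup>2 + ((1 / 2) ^ n)\<^sup>2) / 2"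
    by (rule am)
  also have "((2 * y) ^ n / sqrt (fact n))\<^sup>2 = ((2 * y)\<^sup>2) ^ n / fact n"
    by (simp only: power_divide power_mult[symmetric] mult.commute[of n 2] real_sqrt_pow2 fact_ge_zero)
  also have "(2 * y)\<^sup>2 = 64 * exp 1 * (v * b)\<^sup>2"
    by (simp add: y_def power_mult_distrib)
  also have "((1 / 2 :: real) ^ n)\<^sup>2 = (1 / 4) ^ n"
    by (simp add: power2_eq_square power_mult_distrib[symmetric])
  finally show ?thesis .
qed

lemma hadamard_series:
  fixes v b :: real
  assumes "0 \<le> v" "0 \<le> b"
  shows "summable (\<lambda>n. (4 * v) ^ n / fact n * (b * sqrt n) ^ n)"
    and "(\<Sum>n. (4 * v) ^ n / fact n * (b * sqrt n) ^ n) \<le> exp (64 * exp 1 * (v * b)\<^sup>2) + 1"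
proof -
  let ?z = "64 * exp 1 * (v * b)\<^sup>2"
  have e: "(\<lambda>n. ?z ^ n / fact n) sums exp ?z"
    using exp_converges[of ?z] by (simp add: field_simps)
  have g: "(\<lambda>n. (1 / 4 :: real) ^ n) sums (4 / 3)"
    using geometric_sums[of "1 / 4 :: real"] by simp
  have s: "(\<lambda>n. (?z ^ n / fact n + (1 / 4) ^ n) / 2) sums ((exp ?z + 4 / 3) / 2)"
    by (intro sums_divide sums_add e g)
  show sm: "summable (\<lambda>n. (4 * v) ^ n / fact n * (b * sqrt n) ^ n)"
    using hadamard_series_term[OF assms] assms
    by (intro summable_comparison_test'[OF sums_summable[OF s], of 0]) auto
  have "(\<Sum>n. (4 * v) ^ n / fact n * (b * sqrt n) ^ n) \<le> (exp ?z + 4 / 3) / 2"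
    using suminf_le[OF hadamard_series_term[OF assms] sm sums_summable[OF s]] sums_unique[OF s] by simp
  also have "\<dots> \<le> exp ?z + 1"
    using exp_ge_zero[of ?z] by (simp add: field_simps)
  finally show "(\<Sum>n. (4 * v) ^ n / fact n * (b * sqrt n) ^ n) \<le> exp ?z + 1" .
qed


section \<open>Total variation and generating algebras\<close>

text \<open>
  The sets that can be approximated in both measures at once form a \<open>\<sigma>\<close>-algebra. For a countable union,
  cut off a tail of small measure and approximate each remaining set with error \<open>e / (2 (n + 1))\<close>.
\<close>

lemma approximate_by_algebra:
  assumes alg: "Sigma_Algebra.algebra \<Omega> \<A>" and "finite_measure \<mu>" "finite_measure \<nu>"
    and sets_mu: "sets \<mu> = sigma_sets \<Omega> \<A>" and sets_nu: "sets \<nu> = sigma_sets \<Omega> \<A>"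
    and E: "E \<in> sigma_sets \<Omega> \<A>" and "0 < e"
  shows "\<exists>F\<in>\<A>. measure \<mu> (sym_diff E F) \<le> e \<and> measure \<nu> (sym_diff E F) \<le> e"
  using E \<open>0 < e\<close>
proof (induction arbitrary: e rule: sigma_sets.induct)
  case (Basic a)
  then show ?case by (auto intro!: bexI[of _ a])
next
  case Empty
  interpret Sigma_Algebra.algebra \<Omega> \<A> by fact
  show ?case using Empty by (intro bexI[of _ "{}"]) auto
next
  case (Compl a)
  interpret Sigma_Algebra.algebra \<Omega> \<A> by fact
  obtain F where F: "F \<in> \<A>" "measure \<mu> (sym_diff a F) \<le> e" "measure \<nu> (sym_diff a F) \<le> e"
    using Compl by blast
  have "a \<subseteq> \<Omega>" "F \<subseteq> \<Omega>"
    using Compl.hyps sigma_sets_into_sp[OF space_closed] F sets_into_space by auto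
  then have "sym_diff (\<Omega> - a) (\<Omega> - F) = sym_diff a F" by auto
  then show ?case using F by (intro bexI[of _ "\<Omega> - F"]) auto
next
  case (Union a)
  interpret Sigma_Algebra.algebra \<Omega> \<A> by fact
  interpret mu: finite_measure \<mu> by fact
  interpret nu: finite_measure \<nu> by fact
  let ?U = "\<Union>i. a i" and ?V = "\<lambda>n. \<Union>i<n. a i"
  have a: "a i \<in> sets \<mu>" "a i \<in> sets \<nu>" for i using Union.hyps sets_mu sets_nu by auto
  have V: "(\<Union>n. ?V n) = ?U" by auto
  have tail: "\<exists>n0. \<forall>n\<ge>n0. measure L (?U - ?V n) < e / 2"
    if "finite_measure L" and aL: "\<And>i. a i \<in> sets L" for L :: "'a measure"
  proof -
    interpret finite_measure L by fact
    have "(\<lambda>n. measure L (?V n)) \<longlonglongrightarrow> measure L (\<Union>n. ?V n)"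
      using aL by (intro finite_Lim_measure_incseq incseq_SucI UN_mono) auto
    then have "(\<lambda>n. measure L ?U - measure L (?V n)) \<longlonglongrightarrow> measure L ?U - measure L ?U"
      unfolding V by (intro tendsto_intros)
    then have "\<forall>\<^sub>F n in sequentially. measure L ?U - measure L (?V n) < e / 2"
      using \<open>0 < e\<close> by (intro order_tendstoD(2)) auto
    moreover have "measure L (?U - ?V n) = measure L ?U - measure L (?V n)" for n
      using aL by (intro finite_measure_Diff) auto
    ultimately show ?thesis by (simp add: eventually_sequentially)
  qed
  obtain n1 where "\<And>n. n \<ge> n1 \<Longrightarrow> measure \<mu> (?U - ?V n) < e / 2"
    using tail[OF \<open>finite_measure \<mu>\<close>] a by blast
  moreover obtain n2 where "\<And>n. n \<ge> n2 \<Longrightarrow> measure \<nu> (?U - ?V n) < e / 2"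
    using tail[OF \<open>finite_measure \<nu>\<close>] a by blast
  moreover define n where "n = max n1 n2"
  ultimately have n: "measure \<mu> (?U - ?V n) < e / 2" "measure \<nu> (?U - ?V n) < e / 2"
    by auto
  define d where "d = e / (2 * (real n + 1))"
  have "0 < d" using \<open>0 < e\<close> by (simp add: d_def)
  have "\<exists>F\<in>\<A>. measure \<mu> (sym_diff (a i) F) \<le> d \<and> measure \<nu> (sym_diff (a i) F) \<le> d" for i
    using Union.IH[OF \<open>0 < d\<close>] .
  then obtain F where F: "\<And>i. F i \<in> \<A>" "\<And>i. measure \<mu> (sym_diff (a i) (F i)) \<le> d"
    "\<And>i. measure \<nu> (sym_diff (a i) (F i)) \<le> d" by metis
  have nd: "real n * d \<le> e / 2" using \<open>0 < e\<close> by (simp add: d_def field_simps)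
  have est: "measure L (sym_diff ?U (\<Union>i<n. F i)) \<le> e"
    if "finite_measure L" "sets L = sigma_sets \<Omega> \<A>" "measure L (?U - ?V n) < e / 2"
      "\<And>i. measure L (sym_diff (a i) (F i)) \<le> d" for L
  proof -
    interpret finite_measure L by fact
    have m: "a i \<in> sets L" "F i \<in> sets L" for i using Union.hyps F that(2) by auto
    have "measure L (sym_diff ?U (\<Union>i<n. F i)) \<le> measure L ((?U - ?V n) \<union> (\<Union>i<n. sym_diff (a i) (F i)))"
      using m by (intro finite_measure_mono) auto
    also have "\<dots> \<le> measure L (?U - ?V n) + measure L (\<Union>i<n. sym_diff (a i) (F i))"
      using m by (intro measure_Un_le) auto
    also have "measure L (\<Union>i<n. sym_diff (a i) (F i)) \<le> (\<Sum>i<n. measure L (sym_diff (a i) (F i)))"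
      using m by (intro measure_UNION_le) auto
    also have "\<dots> \<le> real n * d"
      using sum_bounded_above[of "{..<n}" "\<lambda>i. measure L (sym_diff (a i) (F i))" d] that(4) by simp
    finally show ?thesis using nd that(3) by linarith
  qed
  show ?case
  proof (intro bexI[of _ "\<Union>i<n. F i"] conjI)
    show "measure \<mu> (sym_diff ?U (\<Union>i<n. F i)) \<le> e"
      using n F by (intro est \<open>finite_measure \<mu>\<close> sets_mu) auto
    show "measure \<nu> (sym_diff ?U (\<Union>i<n. F i)) \<le> e"
      using n F by (intro est \<open>finite_measure \<nu>\<close> sets_nu) auto
    show "(\<Union>i<n. F i) \<in> \<A>" using F by (intro finite_UN) auto
  qed
qed

lemma measure_difference_le_from_algebra:
  assumes alg: "Sigma_Algebra.algebra \<Omega> \<A>" and mu: "finite_measure \<mu>" and nu: "finite_measure \<nu>"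
    and sets_mu: "sets \<mu> = sigma_sets \<Omega> \<A>" and sets_nu: "sets \<nu> = sigma_sets \<Omega> \<A>"
    and d: "\<And>F. F \<in> \<A> \<Longrightarrow> \<bar>measure \<mu> F - measure \<nu> F\<bar> \<le> d"
    and E: "E \<in> sets \<mu>"
  shows "\<bar>measure \<mu> E - measure \<nu> E\<bar> \<le> d"
proof (rule field_le_epsilon)
  fix e :: real assume "0 < e"
  then obtain F where F: "F \<in> \<A>" "measure \<mu> (sym_diff E F) \<le> e / 2" "measure \<nu> (sym_diff E F) \<le> e / 2"
    using approximate_by_algebra[OF alg mu nu sets_mu sets_nu, of E "e / 2"] E sets_mu by auto
  have close: "\<bar>measure L E - measure L F\<bar> \<le> measure L (sym_diff E F)"
    if "finite_measure L" "sets L = sigma_sets \<Omega> \<A>" for L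
  proof -
    interpret finite_measure L by fact
    have m: "E \<in> sets L" "F \<in> sets L" using E F sets_mu that(2) by auto
    have "measure L E \<le> measure L (F \<union> sym_diff E F)" "measure L F \<le> measure L (E \<union> sym_diff E F)"
      using m by (auto intro!: finite_measure_mono)
    moreover have "measure L (F \<union> sym_diff E F) \<le> measure L F + measure L (sym_diff E F)"
      "measure L (E \<union> sym_diff E F) \<le> measure L E + measure L (sym_diff E F)"
      using m by (auto intro!: measure_Un_le)
    ultimately show ?thesis by linarith
  qed
  show "\<bar>measure \<mu> E - measure \<nu> E\<bar> \<le> d + e"
    using close[OF mu sets_mu] close[OF nu sets_nu] d[OF F(1)] F by linarith
qed

text \<open>
  Over the blocks of a partition on which \<open>\<mu> - \<nu>\<close> is nonnegative, the sum telescopes into the value of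
  \<open>\<mu> - \<nu>\<close> on their union, and similarly for the remaining blocks.
\<close>

lemma variation_diff_le:
  assumes "finite_measure \<mu>" "finite_measure \<nu>" "sets \<nu> = sets \<mu>"
    and d: "\<And>E. E \<in> sets \<mu> \<Longrightarrow> \<bar>measure \<mu> E - measure \<nu> E\<bar> \<le> d"
  shows "variation_diff \<mu> \<nu> \<le> 2 * d"
  unfolding variation_diff_def
proof (rule cSUP_least)
  interpret mu: finite_measure \<mu> by fact
  interpret nu: finite_measure \<nu> by fact
  show "{P. finite P \<and> P \<subseteq> sets \<mu> \<and> partition_on (space \<mu>) P} \<noteq> {}"
  proof (cases "space \<mu> = {}")
    case True
    then show ?thesis by (auto intro!: exI[of _ "{}"] simp: partition_on_empty)
  next
    case False
    then show ?thesis by (auto intro!: exI[of _ "{space \<mu>}"] partition_on_space)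
  qed
next
  interpret mu: finite_measure \<mu> by fact
  interpret nu: finite_measure \<nu> by fact
  fix P assume "P \<in> {P. finite P \<and> P \<subseteq> sets \<mu> \<and> partition_on (space \<mu>) P}"
  then have P: "finite P" "P \<subseteq> sets \<mu>" "disjoint P" by (auto simp: partition_on_def)
  define Q where "Q = {E\<in>P. measure \<nu> E \<le> measure \<mu> E}"
  have part: "\<bar>\<Sum>E\<in>R. measure \<mu> E - measure \<nu> E\<bar> \<le> d" if R: "R \<subseteq> P" for R
  proof -
    have fin: "finite R" using R P finite_subset by auto
    have dis: "disjoint_family_on (\<lambda>E. E) R" using R P by (auto simp: disjoint_family_on_def dest: disjointD)
    have "(\<Sum>E\<in>R. measure \<mu> E) = measure \<mu> (\<Union>E\<in>R. E)"
      using fin dis R P by (intro mu.finite_measure_finite_Union[symmetric]) auto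
    moreover have "(\<Sum>E\<in>R. measure \<nu> E) = measure \<nu> (\<Union>E\<in>R. E)"
      using fin dis R P assms(3) by (intro nu.finite_measure_finite_Union[symmetric]) auto
    moreover have "(\<Union>E\<in>R. E) \<in> sets \<mu>" using fin R P by (intro sets.finite_UN) auto
    ultimately show ?thesis using d by (simp add: sum_subtractf)
  qed
  have "(\<Sum>E\<in>P. \<bar>measure \<mu> E - measure \<nu> E\<bar>) =
      (\<Sum>E\<in>Q. \<bar>measure \<mu> E - measure \<nu> E\<bar>) + (\<Sum>E\<in>P - Q. \<bar>measure \<mu> E - measure \<nu> E\<bar>)"
    using P by (intro sum.subset_diff[THEN trans, OF _ _ add.commute]) (auto simp: Q_def)
  also have "(\<Sum>E\<in>Q. \<bar>measure \<mu> E - measure \<nu> E\<bar>) = (\<Sum>E\<in>Q. measure \<mu> E - measure \<nu> E)"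
    by (intro sum.cong) (auto simp: Q_def)
  also have "(\<Sum>E\<in>P - Q. \<bar>measure \<mu> E - measure \<nu> E\<bar>) = - (\<Sum>E\<in>P - Q. measure \<mu> E - measure \<nu> E)"
    unfolding sum_negf[symmetric] by (intro sum.cong) (auto simp: Q_def)
  finally show "(\<Sum>E\<in>P. \<bar>measure \<mu> E - measure \<nu> E\<bar>) \<le> 2 * d"
    using part[of Q] part[of "P - Q"] by (auto simp: Q_def)
qed


section \<open>Simple counting measures\<close>

lemma countable_separating_sets:
  obtains G :: "nat \<Rightarrow> 'a::{second_countable_topology, t1_space} set"
  where "\<And>n. G n \<in> sets borel" "\<And>x y. x \<noteq> y \<Longrightarrow> \<exists>n. x \<in> G n \<and> y \<notin> G n"
proof -
  obtain B :: "'a set set" where B: "countable B" "topological_basis B"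
    using ex_countable_basis by auto
  have ne: "insert {} B \<noteq> {}" "countable (insert {} B)" using B by auto
  show thesis
  proof
    fix n
    have "from_nat_into (insert {} B) n \<in> insert {} B" by (rule from_nat_into) simp
    then show "from_nat_into (insert {} B) n \<in> sets borel"
      using topological_basis_open[OF B(2)] by auto
  next
    fix x y :: 'a assume "x \<noteq> y"
    then obtain U where "open U" "x \<in> U" "y \<notin> U" using t1_space by blast
    then obtain b where "b \<in> B" "x \<in> b" "b \<subseteq> U" using topological_basisE[OF B(2)] by metis
    moreover obtain n where "from_nat_into (insert {} B) n = b"
      using from_nat_into_surj[OF ne(2)] \<open>b \<in> B\<close> by auto
    ultimately show "\<exists>n. x \<in> from_nat_into (insert {} B) n \<and> y \<notin> from_nat_into (insert {} B) n"
      using \<open>y \<notin> U\<close> by blast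
  qed
qed

text \<open>
  Bisect \<open>D\<close> successively by the members of a countable separating family, always keeping a half of
  measure at least \<open>1\<close>; one exists as the values are integers. By continuity from above the
  intersection has measure at least \<open>1\<close>, and it has at most one point.
\<close>

lemma integer_valued_measure_has_atom:
  fixes \<xi> :: "'a::{second_countable_topology, t1_space} measure"
  assumes sets_xi: "sets \<xi> = sets borel"
    and D: "D \<in> sets borel" "1 \<le> emeasure \<xi> D"
    and int: "\<And>D'. D' \<in> sets borel \<Longrightarrow> D' \<subseteq> D \<Longrightarrow> emeasure \<xi> D' \<in> range of_nat"
  shows "\<exists>x\<in>D. 1 \<le> emeasure \<xi> {x}"
proof -
  obtain G :: "nat \<Rightarrow> 'a set" where G: "\<And>n. G n \<in> sets borel" "\<And>x y. x \<noteq> y \<Longrightarrow> \<exists>n. x \<in> G n \<and> y \<notin> G n"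
    using countable_separating_sets by metis
  have lt1: "emeasure \<xi> D' = 0" if "D' \<in> sets borel" "D' \<subseteq> D" "\<not> 1 \<le> emeasure \<xi> D'" for D'
  proof -
    have "emeasure \<xi> D' \<in> range of_nat" using that by (intro int)
    then obtain k :: nat where k: "emeasure \<xi> D' = of_nat k" by auto
    with that(3) have "k = 0" by (cases k) (auto simp: not_le)
    then show ?thesis using k by simp
  qed
  define A where "A = rec_nat D (\<lambda>n B. if 1 \<le> emeasure \<xi> (B \<inter> G n) then B \<inter> G n else B - G n)"
  have A0: "A 0 = D" and AS: "A (Suc n) = (if 1 \<le> emeasure \<xi> (A n \<inter> G n) then A n \<inter> G n else A n - G n)" for n
    by (simp_all add: A_def)
  have A: "A n \<in> sets borel \<and> A n \<subseteq> D \<and> 1 \<le> emeasure \<xi> (A n)" for n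
  proof (induction n)
    case (Suc n)
    have "emeasure \<xi> (A n) = emeasure \<xi> (A n \<inter> G n) + emeasure \<xi> (A n - G n)"
      using Suc G(1)[of n] sets_xi by (subst plus_emeasure) (auto simp: Int_Diff_Un)
    moreover have "A n \<inter> G n \<in> sets borel" "A n \<inter> G n \<subseteq> D" using Suc G(1)[of n] by auto
    ultimately show ?case using Suc G(1)[of n] lt1[of "A n \<inter> G n"] by (cases "1 \<le> emeasure \<xi> (A n \<inter> G n)") (auto simp: AS)
  qed (use D A0 in auto)
  have "decseq A" by (rule decseq_SucI) (auto simp: AS)
  moreover have "emeasure \<xi> (A n) \<noteq> \<infinity>" for n
    using int[of "A n"] A[of n] by auto
  ultimately have "emeasure \<xi> (\<Inter>n. A n) = (INF n. emeasure \<xi> (A n))"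
    using A sets_xi by (intro INF_emeasure_decseq[symmetric]) auto
  then have ge: "1 \<le> emeasure \<xi> (\<Inter>n. A n)" using A by (auto intro: INF_greatest)
  then have "(\<Inter>n. A n) \<noteq> {}" by (metis emeasure_empty not_one_le_zero)
  then obtain x where x: "\<And>n. x \<in> A n" by auto
  have "y = x" if y: "\<And>n. y \<in> A n" for y
  proof (rule ccontr)
    assume "y \<noteq> x"
    then obtain n where "y \<in> G n" "x \<notin> G n" using G(2) by blast
    then show False using x[of "Suc n"] y[of "Suc n"] by (auto simp: AS split: if_splits)
  qed
  then have "(\<Inter>n. A n) = {x}" using x by auto
  then show ?thesis using ge x[of 0] A0 by (intro bexI[of _ x]) auto
qed

text \<open>
  Off the atoms in \<open>W\<close> the measure vanishes, since otherwise it would have a further atom there.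
\<close>

lemma simple_integer_valued_measure_eq_card:
  fixes \<xi> :: "'a::{second_countable_topology, t1_space} measure"
  assumes sets_xi: "sets \<xi> = sets borel" and W: "W \<in> sets borel"
    and int: "\<And>D. D \<in> sets borel \<Longrightarrow> D \<subseteq> W \<Longrightarrow> emeasure \<xi> D \<in> range of_nat"
    and simple: "\<And>x. emeasure \<xi> {x} \<le> 1"
  defines "X \<equiv> {x\<in>W. emeasure \<xi> {x} = 1}"
  shows "finite X"
    and "\<And>D. D \<in> sets borel \<Longrightarrow> D \<subseteq> W \<Longrightarrow> emeasure \<xi> D = of_nat (card (X \<inter> D))"
proof -
  have card: "emeasure \<xi> F = of_nat (card F)" if "finite F" "F \<subseteq> X" for F
  proof -
    have "emeasure \<xi> F = (\<Sum>x\<in>F. emeasure \<xi> {x})"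
      using that sets_xi by (intro emeasure_eq_sum_singleton) auto
    also have "\<dots> = (\<Sum>x\<in>F. 1)" using that by (intro sum.cong) (auto simp: X_def)
    finally show ?thesis by simp
  qed
  obtain k :: nat where k: "emeasure \<xi> W = of_nat k" using int[OF W] by auto
  show fin: "finite X"
  proof (rule ccontr)
    assume "infinite X"
    then obtain F where F: "finite F" "card F = Suc k" "F \<subseteq> X"
      using infinite_arbitrarily_large[of X "Suc k"] by auto
    have "emeasure \<xi> F \<le> emeasure \<xi> W"
      using F W sets_xi by (intro emeasure_mono) (auto simp: X_def)
    then show False using F card[OF F(1,3)] k by (simp add: of_nat_le_iff del: of_nat_Suc)
  qed
  fix D assume D: "D \<in> sets borel" "D \<subseteq> W"
  have XD: "X \<inter> D \<in> sets borel" using fin by (intro borel_closed finite_imp_closed) simp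
  have "emeasure \<xi> (D - X \<inter> D) = 0"
  proof -
    obtain m :: nat where m: "emeasure \<xi> (D - X \<inter> D) = of_nat m"
      using int[of "D - X \<inter> D"] D XD by auto
    have "m = 0"
    proof (rule ccontr)
      assume "m \<noteq> 0"
      then have "1 \<le> m" by simp
      then have "1 \<le> emeasure \<xi> (D - X \<inter> D)"
        using m of_nat_mono[of 1 m, where 'a = ennreal] by simp
      then obtain x where x: "x \<in> D - X \<inter> D" "1 \<le> emeasure \<xi> {x}"
        using integer_valued_measure_has_atom[OF sets_xi, of "D - X \<inter> D"] int D XD by blast
      then show False using D simple[of x] by (auto simp: X_def intro: antisym)
    qed
    then show ?thesis using m by simp
  qed
  moreover have "emeasure \<xi> D = emeasure \<xi> (X \<inter> D) + emeasure \<xi> (D - X \<inter> D)"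
    using D XD sets_xi by (subst plus_emeasure) (auto simp: Un_Diff_cancel Un_absorb1)
  ultimately show "emeasure \<xi> D = of_nat (card (X \<inter> D))"
    using card[of "X \<inter> D"] fin by simp
qed


section \<open>Cells and indicator polynomials\<close>

text \<open>
  For counts in \<open>{0, 1}\<close> the pattern of occupied cells is \<open>S\<close> exactly if
  \<open>\<Prod>c\<in>S. N c\<close> times \<open>\<Prod>c\<notin>S. 1 - N c\<close> is \<open>1\<close>. Expand this product and sum over \<open>S\<close>; the
  monomial of \<open>T\<close> gets a coefficient \<open>1\<close> or \<open>-1\<close> from each \<open>S \<subseteq> T\<close> in the event, and none
  from other \<open>S\<close>.
\<close>

lemma indicator_polynomial:
  assumes fin: "finite \<C>"
  shows "\<exists>a. (\<forall>T. T \<subseteq> \<C> \<longrightarrow> \<bar>a T\<bar> \<le> (2 :: real) ^ card T) \<and>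
    (\<forall>N :: 'i \<Rightarrow> nat. (\<forall>c\<in>\<C>. N c \<le> 1) \<longrightarrow>
       (\<Sum>T\<in>Pow \<C>. a T * (\<Prod>c\<in>T. real (N c))) = of_bool ({c\<in>\<C>. N c = 1} \<in> \<S>))"
proof -
  define \<S>' where "\<S>' = \<S> \<inter> Pow \<C>"
  have fin': "finite \<S>'" using fin by (auto simp: \<S>'_def)
  \<comment> \<open>The factor \<open>\<sigma> S c * N c + \<alpha> S c\<close> is \<open>N c\<close> for \<open>c \<in> S\<close> and \<open>1 - N c\<close> otherwise.\<close>
  define \<sigma> where "\<sigma> S c = (if c \<in> S then 1 else -1 :: real)" for S and c :: 'i
  define \<alpha> where "\<alpha> S c = (if c \<in> S then 0 else 1 :: real)" for S and c :: 'i
  define a where "a T = (\<Sum>S\<in>\<S>'. prod (\<sigma> S) T * prod (\<alpha> S) (\<C> - T))" for T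
  have a_le: "\<bar>a T\<bar> \<le> 2 ^ card T" if T: "T \<subseteq> \<C>" for T
  proof -
    have "\<bar>a T\<bar> \<le> (\<Sum>S\<in>\<S>'. \<bar>prod (\<sigma> S) T * prod (\<alpha> S) (\<C> - T)\<bar>)"
      unfolding a_def by (rule sum_abs)
    also have "\<dots> \<le> (\<Sum>S\<in>\<S>'. if S \<subseteq> T then 1 else 0)"
    proof (rule sum_mono)
      fix S assume "S \<in> \<S>'"
      then have "S \<subseteq> \<C>" by (auto simp: \<S>'_def)
      have "\<bar>prod (\<sigma> S) T\<bar> = 1"
        unfolding abs_prod by (intro prod.neutral) (auto simp: \<sigma>_def)
      moreover have "prod (\<alpha> S) (\<C> - T) = (if S \<subseteq> T then 1 else 0)"
      proof (cases "S \<subseteq> T")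
        case True
        then show ?thesis by (auto intro!: prod.neutral simp: \<alpha>_def)
      next
        case False
        then obtain c where "c \<in> S" "c \<in> \<C> - T" using \<open>S \<subseteq> \<C>\<close> by auto
        then have "\<exists>c\<in>\<C> - T. \<alpha> S c = 0" by (auto simp: \<alpha>_def)
        then have "prod (\<alpha> S) (\<C> - T) = 0" using fin by (intro prod_zero) auto
        then show ?thesis using False by simp
      qed
      ultimately show "\<bar>prod (\<sigma> S) T * prod (\<alpha> S) (\<C> - T)\<bar> \<le> (if S \<subseteq> T then 1 else 0)"
        by (simp add: abs_mult)
    qed
    also have "\<dots> = card (\<S>' \<inter> {S. S \<subseteq> T})"
      using fin' by (simp add: sum.If_cases)
    also have "\<dots> \<le> card (Pow T)"
      using finite_subset[OF T fin] by (intro of_nat_mono card_mono) auto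
    also have "\<dots> = 2 ^ card T" using finite_subset[OF T fin] by (simp add: card_Pow)
    finally show ?thesis by simp
  qed
  have a_eq: "(\<Sum>T\<in>Pow \<C>. a T * (\<Prod>c\<in>T. real (N c))) = of_bool ({c\<in>\<C>. N c = 1} \<in> \<S>)"
    if N: "\<forall>c\<in>\<C>. N c \<le> 1" for N :: "'i \<Rightarrow> nat"
  proof -
    let ?O = "{c\<in>\<C>. N c = 1}"
    have "(\<Sum>T\<in>Pow \<C>. a T * (\<Prod>c\<in>T. real (N c)))
        = (\<Sum>S\<in>\<S>'. \<Sum>T\<in>Pow \<C>. (\<Prod>c\<in>T. \<sigma> S c * real (N c)) * prod (\<alpha> S) (\<C> - T))"
      unfolding a_def by (subst sum.swap) (simp add: sum_distrib_left prod.distrib ac_simps)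
    also have "\<dots> = (\<Sum>S\<in>\<S>'. \<Prod>c\<in>\<C>. \<sigma> S c * real (N c) + \<alpha> S c)"
      using fin by (subst prod_add) auto
    also have "\<dots> = (\<Sum>S\<in>\<S>'. if S = ?O then 1 else 0)"
    proof (rule sum.cong)
      fix S assume "S \<in> \<S>'"
      then have S: "S \<subseteq> \<C>" by (auto simp: \<S>'_def)
      show "(\<Prod>c\<in>\<C>. \<sigma> S c * real (N c) + \<alpha> S c) = (if S = ?O then 1 else 0)"
      proof (cases "S = ?O")
        case True
        have "(\<Prod>c\<in>\<C>. \<sigma> S c * real (N c) + \<alpha> S c) = 1"
        proof (rule prod.neutral, rule ballI)
          fix c assume "c \<in> \<C>"
          then show "\<sigma> S c * real (N c) + \<alpha> S c = 1" using N True by (auto simp: \<sigma>_def \<alpha>_def)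
        qed
        then show ?thesis using True by simp
      next
        case False
        then obtain c where "c \<in> \<C>" "c \<in> S \<longleftrightarrow> N c \<noteq> 1" using S by auto
        then have "\<exists>c\<in>\<C>. \<sigma> S c * real (N c) + \<alpha> S c = 0"
          using N by (intro bexI[of _ c]) (auto simp: le_Suc_eq \<sigma>_def \<alpha>_def)
        then have "(\<Prod>c\<in>\<C>. \<sigma> S c * real (N c) + \<alpha> S c) = 0"
          using fin by (intro prod_zero) auto
        then show ?thesis using False by simp
      qed
    qed simp
    also have "\<dots> = of_bool (?O \<in> \<S>)"
      using fin' by (auto simp: \<S>'_def)
    finally show ?thesis .
  qed
  show ?thesis using a_le a_eq by (intro exI[of _ a]) simp
qed

text \<open>
  The cell of \<open>x\<close> is its class under the relation of belonging to the same members of \<open>\<G>\<close>.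
\<close>

definition cell :: "'a set \<Rightarrow> 'a set set \<Rightarrow> 'a \<Rightarrow> 'a set" where
  "cell W \<G> x = {y\<in>W. \<forall>G\<in>\<G>. y \<in> G \<longleftrightarrow> x \<in> G}"

definition cells :: "'a set \<Rightarrow> 'a set set \<Rightarrow> 'a set set" where
  "cells W \<G> = cell W \<G> ` W"

lemma finite_cells:
  assumes "finite \<G>"
  shows "finite (cells W \<G>)"
proof -
  have "cells W \<G> \<subseteq> (\<lambda>H. {y\<in>W. \<forall>G\<in>\<G>. y \<in> G \<longleftrightarrow> G \<in> H}) ` Pow \<G>"
  proof
    fix c assume "c \<in> cells W \<G>"
    then obtain x where "c = cell W \<G> x" by (auto simp: cells_def)
    then have "c = {y\<in>W. \<forall>G\<in>\<G>. y \<in> G \<longleftrightarrow> G \<in> {G\<in>\<G>. x \<in> G}}" by (auto simp: cell_def)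
    then show "c \<in> (\<lambda>H. {y\<in>W. \<forall>G\<in>\<G>. y \<in> G \<longleftrightarrow> G \<in> H}) ` Pow \<G>" by blast
  qed
  then show ?thesis using assms finite_subset by blast
qed

lemma disjoint_cells: "disjoint (cells W \<G>)"
  by (auto simp: disjoint_def cells_def cell_def)

lemma Union_cells: "\<Union>(cells W \<G>) = W"
  by (auto simp: cells_def cell_def)

lemma cell_subset_or_disjoint:
  assumes "c \<in> cells W \<G>" "G \<in> \<G>"
  shows "c \<subseteq> G \<or> c \<inter> G = {}"
  using assms by (auto simp: cells_def cell_def)

lemma cells_measurable:
  assumes "finite \<G>" "\<G> \<subseteq> sets M" "W \<in> sets M"
  shows "cells W \<G> \<subseteq> sets M"
proof -
  have "cell W \<G> x \<in> sets M" for x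
    using assms
  proof (induction \<G> rule: finite_induct)
    case empty
    then show ?case by (simp add: cell_def)
  next
    case (insert G \<G>)
    have "cell W (insert G \<G>) x = (if x \<in> G then cell W \<G> x \<inter> G else cell W \<G> x - G)"
      by (auto simp: cell_def)
    then show ?case using insert by auto
  qed
  then show ?thesis by (auto simp: cells_def)
qed

lemma card_Int_eq_sum_cells:
  assumes "finite \<G>" "finite X" "X \<subseteq> W"
  shows "card X = (\<Sum>c\<in>cells W \<G>. card (X \<inter> c))"
    and "F \<in> \<G> \<Longrightarrow> card (X \<inter> F) = (\<Sum>c\<in>{c\<in>cells W \<G>. c \<subseteq> F}. card (X \<inter> c))"
proof -
  have sum: "card (\<Union>c\<in>C. X \<inter> c) = (\<Sum>c\<in>C. card (X \<inter> c))" if "C \<subseteq> cells W \<G>" for C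
    using that assms finite_subset[OF that finite_cells[OF assms(1)]]
    by (intro card_UN_disjoint) (auto dest: disjointD[OF disjoint_cells[of W \<G>]])
  have "X = (\<Union>c\<in>cells W \<G>. X \<inter> c)" using Union_cells[of W \<G>] assms by auto
  then show "card X = (\<Sum>c\<in>cells W \<G>. card (X \<inter> c))" using sum[of "cells W \<G>"] by simp
  assume F: "F \<in> \<G>"
  have "X \<inter> F = (\<Union>c\<in>{c\<in>cells W \<G>. c \<subseteq> F}. X \<inter> c)"
  proof
    show "X \<inter> F \<subseteq> (\<Union>c\<in>{c\<in>cells W \<G>. c \<subseteq> F}. X \<inter> c)"
    proof
      fix x assume x: "x \<in> X \<inter> F"
      then obtain c where "c \<in> cells W \<G>" "x \<in> c" using Union_cells[of W \<G>] assms by auto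
      then show "x \<in> (\<Union>c\<in>{c\<in>cells W \<G>. c \<subseteq> F}. X \<inter> c)"
        using cell_subset_or_disjoint[OF _ F] x by blast
    qed
  qed auto
  then show "card (X \<inter> F) = (\<Sum>c\<in>{c\<in>cells W \<G>. c \<subseteq> F}. card (X \<inter> c))"
    using sum[of "{c\<in>cells W \<G>. c \<subseteq> F}"] by simp
qed

text \<open>
  Each of the finitely many pairs of points is separated by some \<open>G n\<close>.
\<close>

lemma eventually_cells_separate:
  fixes G :: "nat \<Rightarrow> 'a set"
  assumes "finite X" and sep: "\<And>x y. x \<noteq> y \<Longrightarrow> \<exists>n. x \<in> G n \<and> y \<notin> G n"
  shows "\<forall>\<^sub>F k in sequentially. \<forall>c\<in>cells W (\<F> \<union> G ` {..<k}). card (X \<inter> c) \<le> 1"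
proof -
  have "\<forall>\<^sub>F k in sequentially. x \<noteq> y \<longrightarrow> (\<exists>n<k. x \<in> G n \<and> y \<notin> G n)" for x y
  proof (cases "x = y")
    case False
    then obtain n where "x \<in> G n" "y \<notin> G n" using sep by blast
    then show ?thesis by (intro eventually_sequentiallyI[of "Suc n"]) (meson Suc_le_eq)
  qed simp
  then have "\<forall>\<^sub>F k in sequentially. \<forall>x\<in>X. \<forall>y\<in>X. x \<noteq> y \<longrightarrow> (\<exists>n<k. x \<in> G n \<and> y \<notin> G n)"
    using \<open>finite X\<close> by (intro eventually_ball_finite ballI) auto
  then show ?thesis
  proof (eventually_elim, intro ballI)
    fix k c assume k: "\<forall>x\<in>X. \<forall>y\<in>X. x \<noteq> y \<longrightarrow> (\<exists>n<k. x \<in> G n \<and> y \<notin> G n)"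
      and c: "c \<in> cells W (\<F> \<union> G ` {..<k})"
    have "x = y" if "x \<in> X \<inter> c" "y \<in> X \<inter> c" for x y
    proof (rule ccontr)
      assume "x \<noteq> y"
      moreover have "x \<in> X" "y \<in> X" using that by auto
      ultimately obtain n where "n < k" "x \<in> G n" "y \<notin> G n" using k by blast
      then show False using cell_subset_or_disjoint[OF c, of "G n"] that by auto
    qed
    then show "card (X \<inter> c) \<le> 1" using \<open>finite X\<close> by (simp add: card_le_Suc0_iff_eq)
  qed
qed

lemma prod_one_plus_twice:
  fixes x :: "'i \<Rightarrow> 'b::comm_semiring_1"
  assumes "finite \<C>"
  shows "(\<Prod>c\<in>\<C>. 1 + 2 * x c) = (\<Sum>T\<in>Pow \<C>. 2 ^ card T * (\<Prod>c\<in>T. x c))"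
proof -
  have "(\<Prod>c\<in>\<C>. 2 * x c + 1) = (\<Sum>T\<in>Pow \<C>. (\<Prod>c\<in>T. 2 * x c) * (\<Prod>c\<in>\<C> - T. 1))"
    using assms by (rule prod_add)
  also have "\<dots> = (\<Sum>T\<in>Pow \<C>. 2 ^ card T * (\<Prod>c\<in>T. x c))"
    by (simp add: prod.distrib)
  finally show ?thesis by (simp add: add.commute)
qed

lemma one_plus_twice_le_three_power: "1 + 2 * real n \<le> 3 ^ n"
  by (induction n) auto


section \<open>Comparing random finite sets through their moments\<close>

definition random_finite_set :: "'w measure \<Rightarrow> 'a::topological_space set \<Rightarrow> ('w \<Rightarrow> 'a set) \<Rightarrow> bool" where
  "random_finite_set M W Z \<longleftrightarrow> prob_space M \<and> (\<forall>\<omega>\<in>space M. finite (Z \<omega>) \<and> Z \<omega> \<subseteq> W) \<and>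
     (\<forall>D\<in>sets borel. (\<lambda>\<omega>. card (Z \<omega> \<inter> D)) \<in> M \<rightarrow>\<^sub>M count_space UNIV)"

text \<open>
  Families of disjoint sets none of which meets both \<open>A\<close> and its complement. Product moments over such
  a family factorise when the points in \<open>A\<close> are independent of those outside.
\<close>

definition unsplit_family :: "'a::topological_space set \<Rightarrow> 'a set \<Rightarrow> 'a set set \<Rightarrow> bool" where
  "unsplit_family W A T \<longleftrightarrow> finite T \<and> T \<subseteq> sets borel \<and> disjoint T \<and> \<Union>T \<subseteq> W \<and>
     (\<forall>D\<in>T. D \<subseteq> A \<or> D \<inter> A = {})"

definition moments_bounded ::
  "'w measure \<Rightarrow> 'a::euclidean_space set \<Rightarrow> 'a set \<Rightarrow> ('w \<Rightarrow> 'a set) \<Rightarrow> (nat \<Rightarrow> real) \<Rightarrow> bool" where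
  "moments_bounded M W A Z R \<longleftrightarrow>
     (\<forall>T. unsplit_family W A T \<longrightarrow>
        (\<integral>\<^sup>+\<omega>. (\<Prod>D\<in>T. of_nat (card (Z \<omega> \<inter> D))) \<partial>M) \<le> ennreal (R (card T) * (\<Prod>D\<in>T. measure lborel D)))"

lemma sum_subsets_partition_le_suminf:
  fixes W :: "'a::euclidean_space set"
  assumes P: "finite P" "P \<subseteq> sets borel" "disjoint P" "\<Union>P = W" and W: "emeasure lborel W < \<infinity>"
    and f: "\<And>n. 0 \<le> f n" and sm: "summable (\<lambda>n. f n * measure lborel W ^ n / fact n)"
  shows "(\<Sum>T\<in>Pow P. f (card T) * (\<Prod>D\<in>T. measure lborel D)) \<le> (\<Sum>n. f n * measure lborel W ^ n / fact n)"
proof -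
  have fin: "emeasure lborel D \<noteq> \<infinity>" if "D \<in> P" for D
  proof -
    have "W \<in> sets borel" using P by (metis sets.finite_Union)
    then have "emeasure lborel D \<le> emeasure lborel W" using P that by (intro emeasure_mono) auto
    then show ?thesis using W by (auto simp: top_unique)
  qed
  have "measure lborel (\<Union>D\<in>P. D) = (\<Sum>D\<in>P. measure lborel D)"
    using P fin by (intro measure_finite_Union) (auto simp: disjoint_family_on_def dest: disjointD)
  then have v: "(\<Sum>D\<in>P. measure lborel D) = measure lborel W" using P by simp
  have "(\<Sum>T\<in>Pow P. f (card T) * (\<Prod>D\<in>T. measure lborel D)) \<le> (\<Sum>n\<le>card P. f n * measure lborel W ^ n / fact n)"
    unfolding v[symmetric] using P f by (intro sum_subsets_prod_le_power_sum) auto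
  also have "\<dots> \<le> (\<Sum>n. f n * measure lborel W ^ n / fact n)"
    using f by (intro sum_le_suminf sm) auto
  finally show ?thesis .
qed

lemma borel_measurable_prod_card:
  assumes "random_finite_set M W Z" "T \<subseteq> sets borel"
  shows "(\<lambda>\<omega>. \<Prod>D\<in>T. real (card (Z \<omega> \<inter> D))) \<in> borel_measurable M"
    and "(\<lambda>\<omega>. \<Prod>D\<in>T. of_nat (card (Z \<omega> \<inter> D)) :: ennreal) \<in> borel_measurable M"
proof -
  have card: "(\<lambda>\<omega>. card (Z \<omega> \<inter> D)) \<in> M \<rightarrow>\<^sub>M count_space UNIV" if "D \<in> T" for D
    using assms that unfolding random_finite_set_def by blast
  show "(\<lambda>\<omega>. \<Prod>D\<in>T. real (card (Z \<omega> \<inter> D))) \<in> borel_measurable M"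
    by (intro borel_measurable_prod measurable_compose[OF card]) auto
  show "(\<lambda>\<omega>. \<Prod>D\<in>T. of_nat (card (Z \<omega> \<inter> D)) :: ennreal) \<in> borel_measurable M"
    by (intro borel_measurable_prod_ennreal measurable_compose[OF card]) auto
qed

lemma borel_measurable_three_power_card:
  assumes Z: "random_finite_set M W Z" and W: "W \<in> sets borel"
  shows "(\<lambda>\<omega>. 3 ^ card (Z \<omega>) :: real) \<in> borel_measurable M"
proof -
  have "(\<lambda>\<omega>. 3 ^ card (Z \<omega> \<inter> W) :: real) \<in> borel_measurable M"
    using Z W unfolding random_finite_set_def
    by (auto intro!: measurable_compose[where g = "\<lambda>n. 3 ^ n" and M = "count_space UNIV"])
  moreover have "Z \<omega> \<inter> W = Z \<omega>" if "\<omega> \<in> space M" for \<omega>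
    using Z that by (auto simp: random_finite_set_def)
  ultimately show ?thesis by (simp cong: measurable_cong)
qed

text \<open>
  Over a partition into cells, \<open>\<Prod>(1 + 2 N c)\<close> expands into product moments, so its expectation is
  bounded independently of the partition. Once the cells separate the points, the product equals
  \<open>3^|Z|\<close>; conclude by Fatou's lemma.
\<close>

lemma three_power_card_integrable:
  fixes Z :: "'w \<Rightarrow> 'a::euclidean_space set"
  assumes Z: "random_finite_set M W Z" and R: "moments_bounded M W A Z R"
    and W: "W \<in> sets borel" "emeasure lborel W < \<infinity>" and A: "A \<in> sets borel"
    and R0: "\<And>n. 0 \<le> R n" and sm: "summable (\<lambda>n. 2 ^ n * R n * measure lborel W ^ n / fact n)"
  shows "integrable M (\<lambda>\<omega>. 3 ^ card (Z \<omega>) :: real)"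
proof -
  define B where "B = (\<Sum>n. 2 ^ n * R n * measure lborel W ^ n / fact n)"
  obtain G :: "nat \<Rightarrow> 'a set" where G: "\<And>n. G n \<in> sets borel" "\<And>x y. x \<noteq> y \<Longrightarrow> \<exists>n. x \<in> G n \<and> y \<notin> G n"
    using countable_separating_sets by metis
  define C where "C k = cells W ({A} \<union> G ` {..<k})" for k
  have C: "finite (C k)" "C k \<subseteq> sets borel" "disjoint (C k)" "\<Union>(C k) = W" for k
  proof -
    have \<G>: "finite ({A} \<union> G ` {..<k})" "{A} \<union> G ` {..<k} \<subseteq> sets borel" using G A by auto
    show "finite (C k)" "C k \<subseteq> sets borel" "disjoint (C k)" "\<Union>(C k) = W"
      unfolding C_def
      by (intro finite_cells disjoint_cells Union_cells cells_measurable \<G> W(1))+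
  qed
  have C_unsplit: "c \<subseteq> A \<or> c \<inter> A = {}" if "c \<in> C k" for c k
    using cell_subset_or_disjoint[OF that[unfolded C_def], of A] by simp
  define u where "u k \<omega> = (\<Prod>c\<in>C k. 1 + 2 * of_nat (card (Z \<omega> \<inter> c)) :: ennreal)" for k \<omega>
  have u_eq: "u k \<omega> = (\<Sum>T\<in>Pow (C k). 2 ^ card T * (\<Prod>c\<in>T. of_nat (card (Z \<omega> \<inter> c))))" for k \<omega>
    unfolding u_def using C by (intro prod_one_plus_twice)
  have u_meas: "u k \<in> borel_measurable M" for k
    unfolding u_eq using C(2)[of k]
    by (intro borel_measurable_sum borel_measurable_times_ennreal borel_measurable_prod_card[OF Z]) auto
  have u_le: "(\<integral>\<^sup>+\<omega>. u k \<omega> \<partial>M) \<le> ennreal B" for k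
  proof -
    have "(\<integral>\<^sup>+\<omega>. u k \<omega> \<partial>M) = (\<Sum>T\<in>Pow (C k). 2 ^ card T * (\<integral>\<^sup>+\<omega>. (\<Prod>c\<in>T. of_nat (card (Z \<omega> \<inter> c))) \<partial>M))"
      unfolding u_eq using C(2)[of k]
      by (subst nn_integral_sum)
         (auto intro!: sum.cong nn_integral_cmult borel_measurable_times_ennreal borel_measurable_prod_card[OF Z])
    also have "\<dots> \<le> (\<Sum>T\<in>Pow (C k). ennreal (2 ^ card T * R (card T) * (\<Prod>c\<in>T. measure lborel c)))"
    proof (rule sum_mono)
      fix T assume "T \<in> Pow (C k)"
      then have T: "T \<subseteq> C k" by simp
      have "unsplit_family W A T"
        using C[of k] C_unsplit[of _ k] finite_subset[OF T] pairwise_subset[OF C(3) T] T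
        unfolding unsplit_family_def by blast
      then have "(\<integral>\<^sup>+\<omega>. (\<Prod>c\<in>T. of_nat (card (Z \<omega> \<inter> c))) \<partial>M) \<le> ennreal (R (card T) * (\<Prod>c\<in>T. measure lborel c))"
        using R by (simp add: moments_bounded_def)
      then have "2 ^ card T * (\<integral>\<^sup>+\<omega>. (\<Prod>c\<in>T. of_nat (card (Z \<omega> \<inter> c))) \<partial>M)
          \<le> ennreal (2 ^ card T) * ennreal (R (card T) * (\<Prod>c\<in>T. measure lborel c))"
        by (simp add: ennreal_power[symmetric] mult_left_mono)
      then show "2 ^ card T * (\<integral>\<^sup>+\<omega>. (\<Prod>c\<in>T. of_nat (card (Z \<omega> \<inter> c))) \<partial>M)
          \<le> ennreal (2 ^ card T * R (card T) * (\<Prod>c\<in>T. measure lborel c))"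
        using R0 by (simp add: ennreal_mult[symmetric] prod_nonneg mult.assoc)
    qed
    also have "\<dots> = ennreal (\<Sum>T\<in>Pow (C k). 2 ^ card T * R (card T) * (\<Prod>c\<in>T. measure lborel c))"
      using R0 by (intro sum_ennreal) (auto intro!: mult_nonneg_nonneg prod_nonneg)
    also have "\<dots> \<le> ennreal B"
      unfolding B_def using R0 C[of k] W sm
      by (intro ennreal_leI sum_subsets_partition_le_suminf[where f = "\<lambda>n. 2 ^ n * R n"]) auto
    finally show ?thesis .
  qed
  have lim: "liminf (\<lambda>k. u k \<omega>) = ennreal (3 ^ card (Z \<omega>))" if "\<omega> \<in> space M" for \<omega>
  proof -
    have fin: "finite (Z \<omega>)" "Z \<omega> \<subseteq> W" using Z that by (auto simp: random_finite_set_def)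
    have "\<forall>\<^sub>F k in sequentially. \<forall>c\<in>C k. card (Z \<omega> \<inter> c) \<le> 1"
      unfolding C_def by (rule eventually_cells_separate[OF fin(1) G(2)])
    then have "\<forall>\<^sub>F k in sequentially. u k \<omega> = ennreal (3 ^ card (Z \<omega>))"
    proof eventually_elim
      case (elim k)
      have "u k \<omega> = (\<Prod>c\<in>C k. 3 ^ card (Z \<omega> \<inter> c))"
        unfolding u_def
      proof (rule prod.cong)
        fix c assume "c \<in> C k"
        then have "card (Z \<omega> \<inter> c) = 0 \<or> card (Z \<omega> \<inter> c) = 1" using elim by (auto simp: le_Suc_eq)
        then show "1 + 2 * of_nat (card (Z \<omega> \<inter> c)) = (3 :: ennreal) ^ card (Z \<omega> \<inter> c)" by auto
      qed simp
      also have "\<dots> = 3 ^ (\<Sum>c\<in>C k. card (Z \<omega> \<inter> c))" by (simp add: power_sum)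
      also have "(\<Sum>c\<in>C k. card (Z \<omega> \<inter> c)) = card (Z \<omega>)"
        unfolding C_def by (rule card_Int_eq_sum_cells(1)[symmetric]) (use fin in auto)
      finally show ?case by (simp add: ennreal_power[symmetric])
    qed
    then have "(\<lambda>k. u k \<omega>) \<longlonglongrightarrow> ennreal (3 ^ card (Z \<omega>))"
      by (rule tendsto_eventually)
    then show ?thesis by (intro lim_imp_Liminf) simp_all
  qed
  have "(\<integral>\<^sup>+\<omega>. ennreal (3 ^ card (Z \<omega>)) \<partial>M) = (\<integral>\<^sup>+\<omega>. liminf (\<lambda>k. u k \<omega>) \<partial>M)"
    using lim by (intro nn_integral_cong) simp
  also have "\<dots> \<le> liminf (\<lambda>k. \<integral>\<^sup>+\<omega>. u k \<omega> \<partial>M)"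
    using u_meas by (rule nn_integral_liminf)
  also have "\<dots> \<le> liminf (\<lambda>k. ennreal B)"
    using u_le by (intro Liminf_mono) simp
  also have "\<dots> = ennreal B" by (simp add: Liminf_const)
  finally have "(\<integral>\<^sup>+\<omega>. ennreal (3 ^ card (Z \<omega>)) \<partial>M) < \<infinity>"
    by (simp add: order_le_less_trans)
  then show ?thesis
    using borel_measurable_three_power_card[OF Z W(1)]
    by (intro integrableI_nonneg) auto
qed

text \<open>
  Along a sequence of partitions that refine \<open>\<F>\<close> and eventually separate points, let \<open>f k\<close> be the
  indicator polynomial of the patterns that belong to the event. Then \<open>f k (Z)\<close> converges to the
  indicator of the event and is dominated by \<open>3^|Z|\<close>. For fixed \<open>k\<close> the expectations of \<open>f k\<close> under
  the two laws are combinations of product moments with coefficients at most \<open>2^|T|\<close>, and their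
  difference is bounded uniformly in \<open>k\<close>. The same polynomials serve both laws.
\<close>

theorem prob_difference_le_moment_differences:
  fixes Z1 :: "'w \<Rightarrow> 'a::euclidean_space set" and Z2 :: "'v \<Rightarrow> 'a set"
  assumes Z1: "random_finite_set M1 W Z1" "moments_bounded M1 W A Z1 R"
    and Z2: "random_finite_set M2 W Z2" "moments_bounded M2 W A Z2 R"
    and W: "W \<in> sets borel" "emeasure lborel W < \<infinity>" and A: "A \<in> sets borel"
    and R0: "\<And>n. 0 \<le> R n" and smR: "summable (\<lambda>n. 2 ^ n * R n * measure lborel W ^ n / fact n)"
    and d0: "\<And>n. 0 \<le> \<delta> n" and smd: "summable (\<lambda>n. 2 ^ n * \<delta> n * measure lborel W ^ n / fact n)"
    and diff: "\<And>T. unsplit_family W A T \<Longrightarrow>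
      \<bar>(\<integral>\<omega>. (\<Prod>D\<in>T. real (card (Z1 \<omega> \<inter> D))) \<partial>M1) - (\<integral>\<omega>. (\<Prod>D\<in>T. real (card (Z2 \<omega> \<inter> D))) \<partial>M2)\<bar>
        \<le> \<delta> (card T) * (\<Prod>D\<in>T. measure lborel D)"
    and \<F>: "finite \<F>" "\<F> \<subseteq> sets borel"
    and determined: "\<And>X Y. finite X \<Longrightarrow> finite Y \<Longrightarrow> X \<subseteq> W \<Longrightarrow> Y \<subseteq> W \<Longrightarrow>
      (\<And>F. F \<in> \<F> \<Longrightarrow> card (X \<inter> F) = card (Y \<inter> F)) \<Longrightarrow> X \<in> E \<Longrightarrow> Y \<in> E"
    and E: "{\<omega>\<in>space M1. Z1 \<omega> \<in> E} \<in> sets M1" "{\<omega>\<in>space M2. Z2 \<omega> \<in> E} \<in> sets M2"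
  shows "\<bar>measure M1 {\<omega>\<in>space M1. Z1 \<omega> \<in> E} - measure M2 {\<omega>\<in>space M2. Z2 \<omega> \<in> E}\<bar>
    \<le> (\<Sum>n. 2 ^ n * \<delta> n * measure lborel W ^ n / fact n)"
proof -
  obtain G :: "nat \<Rightarrow> 'a set" where G: "\<And>n. G n \<in> sets borel" "\<And>x y. x \<noteq> y \<Longrightarrow> \<exists>n. x \<in> G n \<and> y \<notin> G n"
    using countable_separating_sets by metis
  define \<G> where "\<G> k = insert A \<F> \<union> G ` {..<k}" for k
  have \<G>: "finite (\<G> k)" "\<G> k \<subseteq> sets borel" "insert A \<F> \<subseteq> \<G> k" for k using \<F> G A by (auto simp: \<G>_def)
  define C where "C k = cells W (\<G> k)" for k
  have C: "finite (C k)" "C k \<subseteq> sets borel" "disjoint (C k)" "\<Union>(C k) = W" for k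
    unfolding C_def
    by (intro finite_cells disjoint_cells Union_cells cells_measurable \<G> W(1))+
  have C_unsplit: "c \<subseteq> A \<or> c \<inter> A = {}" if "c \<in> C k" for c k
    using cell_subset_or_disjoint[OF that[unfolded C_def], of A] \<G>(3)[of k] by simp
  define good where "good k X \<longleftrightarrow> (\<forall>c\<in>C k. card (X \<inter> c) \<le> 1)" for k X
  define occ where "occ k X = {c\<in>C k. card (X \<inter> c) = 1}" for k X
  define \<S> where "\<S> k = {occ k X |X. finite X \<and> X \<subseteq> W \<and> good k X \<and> X \<in> E}" for k
  have occ_iff: "occ k Y \<in> \<S> k \<longleftrightarrow> Y \<in> E" if Y: "finite Y" "Y \<subseteq> W" "good k Y" for k Y
  proof
    assume "occ k Y \<in> \<S> k"
    then obtain X where X: "finite X" "X \<subseteq> W" "good k X" "X \<in> E" "occ k X = occ k Y"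
      by (auto simp: \<S>_def)
    have "card (X \<inter> c) = card (Y \<inter> c)" if "c \<in> C k" for c
    proof -
      have "card (X \<inter> c) = 1 \<longleftrightarrow> card (Y \<inter> c) = 1" using X(5) that by (auto simp: occ_def)
      moreover have "card (X \<inter> c) \<le> 1" "card (Y \<inter> c) \<le> 1" using X(3) Y(3) that by (auto simp: good_def)
      ultimately show ?thesis by linarith
    qed
    then have "card (X \<inter> F) = card (Y \<inter> F)" if "F \<in> \<F>" for F
      using that X Y \<G>[of k] card_Int_eq_sum_cells(2)[of "\<G> k" X W F] card_Int_eq_sum_cells(2)[of "\<G> k" Y W F]
      by (auto simp: C_def intro!: sum.cong)
    then show "Y \<in> E" using determined[of X Y] X Y by blast
  next
    assume "Y \<in> E"
    then show "occ k Y \<in> \<S> k" using Y by (auto simp: \<S>_def)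
  qed
  \<comment> \<open>The coefficients are chosen once, before the two laws enter.\<close>
  define interp where "interp k a \<longleftrightarrow> (\<forall>T. T \<subseteq> C k \<longrightarrow> \<bar>a T\<bar> \<le> 2 ^ card T) \<and>
      (\<forall>N :: 'a set \<Rightarrow> nat. (\<forall>c\<in>C k. N c \<le> 1) \<longrightarrow>
        (\<Sum>T\<in>Pow (C k). a T * (\<Prod>c\<in>T. real (N c))) = of_bool ({c\<in>C k. N c = 1} \<in> \<S> k))" for k a
  have "\<exists>a. interp k a" for k
    unfolding interp_def by (rule indicator_polynomial[OF C(1)])
  then have interp: "interp k (SOME a. interp k a)" for k by (rule someI_ex)
  define a where "a k = (SOME a. interp k a)" for k
  have interp_a: "interp k (a k)" for k unfolding a_def by (rule interp)
  have a: "\<bar>a k T\<bar> \<le> 2 ^ card T" if "T \<subseteq> C k" for k T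
    using interp_a[unfolded interp_def, THEN conjunct1, rule_format, OF that] .
  have a_eq: "(\<Sum>T\<in>Pow (C k). a k T * (\<Prod>c\<in>T. real (N c))) = of_bool ({c\<in>C k. N c = 1} \<in> \<S> k)"
    if "\<forall>c\<in>C k. N c \<le> 1" for k and N :: "'a set \<Rightarrow> nat"
    using interp_a[unfolded interp_def, THEN conjunct2, THEN spec, THEN mp, OF that] .
  define f where "f k X = (\<Sum>T\<in>Pow (C k). a k T * (\<Prod>c\<in>T. real (card (X \<inter> c))))" for k X
  have prod_le: "(\<Prod>c\<in>C k. 1 + 2 * real (card (X \<inter> c))) \<le> 3 ^ card X" if "finite X" "X \<subseteq> W" for k X
  proof -
    have "(\<Prod>c\<in>C k. 1 + 2 * real (card (X \<inter> c))) \<le> (\<Prod>c\<in>C k. 3 ^ card (X \<inter> c))"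
      by (intro prod_mono) (auto simp: one_plus_twice_le_three_power)
    also have "\<dots> = 3 ^ (\<Sum>c\<in>C k. card (X \<inter> c))" by (simp add: power_sum)
    also have "(\<Sum>c\<in>C k. card (X \<inter> c)) = card X"
      unfolding C_def by (rule card_Int_eq_sum_cells(1)[symmetric]) (use \<G> that in auto)
    finally show ?thesis .
  qed
  have f_le: "\<bar>f k X\<bar> \<le> 3 ^ card X" if "finite X" "X \<subseteq> W" for k X
  proof -
    have "\<bar>f k X\<bar> \<le> (\<Sum>T\<in>Pow (C k). \<bar>a k T * (\<Prod>c\<in>T. real (card (X \<inter> c)))\<bar>)"
      unfolding f_def by (rule sum_abs)
    also have "\<dots> \<le> (\<Sum>T\<in>Pow (C k). 2 ^ card T * (\<Prod>c\<in>T. real (card (X \<inter> c))))"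
      using a[of _ k] by (intro sum_mono) (auto simp: abs_mult abs_prod intro!: mult_right_mono prod_nonneg)
    also have "\<dots> = (\<Prod>c\<in>C k. 1 + 2 * real (card (X \<inter> c)))"
      using C by (intro prod_one_plus_twice[symmetric])
    finally show ?thesis using prod_le[OF that, of k] by simp
  qed
  have lim: "(\<lambda>k. \<integral>\<omega>. f k (Z \<omega>) \<partial>M) \<longlonglongrightarrow> measure M {\<omega>\<in>space M. Z \<omega> \<in> E}"
    "\<And>T. unsplit_family W A T \<Longrightarrow>
       integrable M (\<lambda>\<omega>. \<Prod>D\<in>T. real (card (Z \<omega> \<inter> D)))"
    if Z: "random_finite_set M W Z" "moments_bounded M W A Z R" and EZ: "{\<omega>\<in>space M. Z \<omega> \<in> E} \<in> sets M"
    for M :: "'u measure" and Z :: "'u \<Rightarrow> 'a set"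
  proof -
    have fin: "finite (Z \<omega>)" "Z \<omega> \<subseteq> W" if "\<omega> \<in> space M" for \<omega>
      using Z that by (auto simp: random_finite_set_def)
    have int3: "integrable M (\<lambda>\<omega>. 3 ^ card (Z \<omega>) :: real)"
      by (rule three_power_card_integrable[OF Z W A R0 smR])
    have meas: "(\<lambda>\<omega>. f k (Z \<omega>)) \<in> borel_measurable M" for k
      unfolding f_def using C(2)[of k]
      by (intro borel_measurable_sum borel_measurable_times borel_measurable_const
          borel_measurable_prod_card(1)[OF Z(1)]) auto
    have "(\<lambda>k. \<integral>\<omega>. f k (Z \<omega>) \<partial>M) \<longlonglongrightarrow> (\<integral>\<omega>. indicator {\<omega>\<in>space M. Z \<omega> \<in> E} \<omega> \<partial>M)"
    proof (rule integral_dominated_convergence[OF _ _ int3])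
      show "AE \<omega> in M. (\<lambda>k. f k (Z \<omega>)) \<longlonglongrightarrow> indicator {\<omega>\<in>space M. Z \<omega> \<in> E} \<omega>"
      proof (rule AE_I2, rule tendsto_eventually)
        fix \<omega> assume \<omega>: "\<omega> \<in> space M"
        have "\<forall>\<^sub>F k in sequentially. \<forall>c\<in>C k. card (Z \<omega> \<inter> c) \<le> 1"
          unfolding C_def \<G>_def by (rule eventually_cells_separate[OF fin(1)[OF \<omega>] G(2)])
        then show "\<forall>\<^sub>F k in sequentially. f k (Z \<omega>) = indicator {\<omega>\<in>space M. Z \<omega> \<in> E} \<omega>"
        proof eventually_elim
          case (elim k)
          have "f k (Z \<omega>) = of_bool (occ k (Z \<omega>) \<in> \<S> k)"
            unfolding f_def occ_def using a_eq[of k "\<lambda>c. card (Z \<omega> \<inter> c)"] elim by blast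
          also have "\<dots> = of_bool (Z \<omega> \<in> E)"
            using occ_iff[of "Z \<omega>" k] fin[OF \<omega>] elim by (simp add: good_def)
          finally show ?case using \<omega> by (simp add: indicator_def)
        qed
      qed
      show "AE \<omega> in M. norm (f k (Z \<omega>)) \<le> 3 ^ card (Z \<omega>)" for k
        using f_le fin by (intro AE_I2) simp
      show "indicator {\<omega>\<in>space M. Z \<omega> \<in> E} \<in> borel_measurable M"
        using EZ by (rule borel_measurable_indicator)
    qed (rule meas)
    also have "(\<integral>\<omega>. indicator {\<omega>\<in>space M. Z \<omega> \<in> E} \<omega> \<partial>M) = measure M {\<omega>\<in>space M. Z \<omega> \<in> E}"
      using EZ by (simp add: Int_absorb2 Collect_restrict)
    finally show "(\<lambda>k. \<integral>\<omega>. f k (Z \<omega>) \<partial>M) \<longlonglongrightarrow> measure M {\<omega>\<in>space M. Z \<omega> \<in> E}" .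
    fix T :: "'a set set" assume T: "unsplit_family W A T"
    have "(\<integral>\<^sup>+\<omega>. ennreal (\<Prod>D\<in>T. real (card (Z \<omega> \<inter> D))) \<partial>M) = (\<integral>\<^sup>+\<omega>. (\<Prod>D\<in>T. of_nat (card (Z \<omega> \<inter> D))) \<partial>M)"
      by (intro nn_integral_cong) (simp add: prod_ennreal[symmetric] ennreal_of_nat_eq_real_of_nat)
    also have "\<dots> < \<infinity>"
      using Z(2)[unfolded moments_bounded_def, rule_format, OF T] by (rule order_le_less_trans) simp
    finally show "integrable M (\<lambda>\<omega>. \<Prod>D\<in>T. real (card (Z \<omega> \<inter> D)))"
      using borel_measurable_prod_card(1)[OF Z(1), of T] T
      by (intro integrableI_nonneg) (auto intro!: AE_I2 prod_nonneg simp: unsplit_family_def)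
  qed
  have sub: "unsplit_family W A T" if "T \<in> Pow (C k)" for k T
    using that C[of k] C_unsplit[of _ k] finite_subset[of T "C k"] pairwise_subset[OF C(3)[of k], of T]
    unfolding unsplit_family_def by blast
  have bound: "\<bar>(\<integral>\<omega>. f k (Z1 \<omega>) \<partial>M1) - (\<integral>\<omega>. f k (Z2 \<omega>) \<partial>M2)\<bar> \<le> (\<Sum>n. 2 ^ n * \<delta> n * measure lborel W ^ n / fact n)" for k
  proof -
    let ?m1 = "\<lambda>T. \<integral>\<omega>. (\<Prod>D\<in>T. real (card (Z1 \<omega> \<inter> D))) \<partial>M1"
    let ?m2 = "\<lambda>T. \<integral>\<omega>. (\<Prod>D\<in>T. real (card (Z2 \<omega> \<inter> D))) \<partial>M2"
    have "(\<integral>\<omega>. f k (Z1 \<omega>) \<partial>M1) = (\<Sum>T\<in>Pow (C k). a k T * ?m1 T)"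
      unfolding f_def using lim(2)[OF Z1 E(1) sub]
      by (subst Bochner_Integration.integral_sum) auto
    moreover have "(\<integral>\<omega>. f k (Z2 \<omega>) \<partial>M2) = (\<Sum>T\<in>Pow (C k). a k T * ?m2 T)"
      unfolding f_def using lim(2)[OF Z2 E(2) sub]
      by (subst Bochner_Integration.integral_sum) auto
    ultimately have "\<bar>(\<integral>\<omega>. f k (Z1 \<omega>) \<partial>M1) - (\<integral>\<omega>. f k (Z2 \<omega>) \<partial>M2)\<bar> = \<bar>\<Sum>T\<in>Pow (C k). a k T * (?m1 T - ?m2 T)\<bar>"
      by (simp add: sum_subtractf right_diff_distrib)
    also have "\<dots> \<le> (\<Sum>T\<in>Pow (C k). \<bar>a k T * (?m1 T - ?m2 T)\<bar>)" by (rule sum_abs)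
    also have "\<dots> \<le> (\<Sum>T\<in>Pow (C k). 2 ^ card T * \<delta> (card T) * (\<Prod>D\<in>T. measure lborel D))"
    proof (rule sum_mono)
      fix T assume T: "T \<in> Pow (C k)"
      have "\<bar>a k T\<bar> * \<bar>?m1 T - ?m2 T\<bar> \<le> 2 ^ card T * (\<delta> (card T) * (\<Prod>D\<in>T. measure lborel D))"
        using a[of T k] T diff[OF sub[OF T]] by (intro mult_mono) auto
      then show "\<bar>a k T * (?m1 T - ?m2 T)\<bar> \<le> 2 ^ card T * \<delta> (card T) * (\<Prod>D\<in>T. measure lborel D)"
        by (simp add: abs_mult mult.assoc)
    qed
    also have "\<dots> \<le> (\<Sum>n. 2 ^ n * \<delta> n * measure lborel W ^ n / fact n)"
      using d0 C[of k] W smd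
      by (intro sum_subsets_partition_le_suminf[where f = "\<lambda>n. 2 ^ n * \<delta> n"]) auto
    finally show ?thesis .
  qed
  have "(\<lambda>k. \<bar>(\<integral>\<omega>. f k (Z1 \<omega>) \<partial>M1) - (\<integral>\<omega>. f k (Z2 \<omega>) \<partial>M2)\<bar>) \<longlonglongrightarrow>
      \<bar>measure M1 {\<omega>\<in>space M1. Z1 \<omega> \<in> E} - measure M2 {\<omega>\<in>space M2. Z2 \<omega> \<in> E}\<bar>"
    by (intro tendsto_intros lim(1) Z1 Z2 E)
  then show ?thesis
    by (rule LIMSEQ_le_const2) (use bound in auto)
qed


section \<open>Moments of a determinantal process in a bounded window\<close>

lemma product_sigma_finite_lborel: "product_sigma_finite (\<lambda>_. lborel)"
  by (simp add: product_sigma_finite_def lborel.sigma_finite_measure_axioms)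

lemma distr_PiM_lborel_shift:
  fixes p q :: nat
  shows "distr (\<Pi>\<^sub>M i\<in>{p..<p + q}. lborel) (\<Pi>\<^sub>M i\<in>{..<q}. lborel) (\<lambda>y. \<lambda>j\<in>{..<q}. y (p + j))
    = (\<Pi>\<^sub>M i\<in>{..<q}. (lborel :: 'a::euclidean_space measure))" (is "distr ?J ?Q ?s = ?Q")
proof -
  interpret product_sigma_finite "\<lambda>_ :: nat. (lborel :: 'a measure)" by (rule product_sigma_finite_lborel)
  have s: "?s \<in> ?J \<rightarrow>\<^sub>M ?Q"
    by (intro measurable_restrict measurable_component_singleton) auto
  show ?thesis
  proof (rule PiM_eqI)
    fix A :: "nat \<Rightarrow> 'a set" assume A: "\<And>i. i \<in> {..<q} \<Longrightarrow> A i \<in> sets lborel"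
    have "?s -` Pi\<^sub>E {..<q} A \<inter> space ?J = (\<Pi>\<^sub>E i\<in>{p..<p + q}. A (i - p))"
    proof (intro Set.set_eqI iffI)
      fix y assume y: "y \<in> ?s -` Pi\<^sub>E {..<q} A \<inter> space ?J"
      show "y \<in> (\<Pi>\<^sub>E i\<in>{p..<p + q}. A (i - p))"
      proof (rule PiE_I)
        fix i assume "i \<in> {p..<p + q}"
        then have i: "i - p < q" "p + (i - p) = i" by auto
        have "?s y (i - p) \<in> A (i - p)" using y i by blast
        then show "y i \<in> A (i - p)" using i by simp
      qed (use y in \<open>auto simp: space_PiM\<close>)
    next
      fix y assume y: "y \<in> (\<Pi>\<^sub>E i\<in>{p..<p + q}. A (i - p))"
      have "y (p + i) \<in> A i" if "i < q" for i using PiE_mem[OF y, of "p + i"] that by simp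
      then show "y \<in> ?s -` Pi\<^sub>E {..<q} A \<inter> space ?J"
        using y by (auto simp: space_PiM PiE_iff)
    qed
    then have "emeasure (distr ?J ?Q ?s) (Pi\<^sub>E {..<q} A) = emeasure ?J (\<Pi>\<^sub>E i\<in>{p..<p + q}. A (i - p))"
      using A s by (subst emeasure_distr) (auto intro!: sets_PiM_I_finite)
    also have "\<dots> = (\<Prod>i\<in>{p..<p + q}. emeasure lborel (A (i - p)))"
      using A by (intro emeasure_PiM) auto
    also have "\<dots> = (\<Prod>j\<in>{..<q}. emeasure lborel (A j))"
      by (rule prod.reindex_bij_witness[of _ "\<lambda>j. p + j" "\<lambda>i. i - p"]) auto
    finally show "emeasure (distr ?J ?Q ?s) (Pi\<^sub>E {..<q} A) = (\<Prod>j\<in>{..<q}. emeasure lborel (A j))" .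
  qed simp_all
qed

text \<open>
  Fubini's theorem for \<open>p + q\<close> coordinates, the last \<open>q\<close> of them renumbered from \<open>0\<close>.
\<close>

lemma nn_integral_PiM_split:
  fixes f g :: "(nat \<Rightarrow> 'a::euclidean_space) \<Rightarrow> ennreal"
  assumes f[measurable]: "f \<in> borel_measurable (\<Pi>\<^sub>M i\<in>{..<p}. lborel)"
    and g[measurable]: "g \<in> borel_measurable (\<Pi>\<^sub>M i\<in>{..<q}. lborel)"
  shows "(\<integral>\<^sup>+x. f x \<partial>(\<Pi>\<^sub>M i\<in>{..<p}. lborel)) * (\<integral>\<^sup>+y. g y \<partial>(\<Pi>\<^sub>M i\<in>{..<q}. lborel))
    = (\<integral>\<^sup>+z. f (restrict z {..<p}) * g (\<lambda>j\<in>{..<q}. z (p + j)) \<partial>(\<Pi>\<^sub>M i\<in>{..<p + q}. lborel))"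
    and "(\<lambda>z. f (restrict z {..<p}) * g (\<lambda>j\<in>{..<q}. z (p + j))) \<in> borel_measurable (\<Pi>\<^sub>M i\<in>{..<p + q}. lborel)"
proof -
  interpret product_sigma_finite "\<lambda>_ :: nat. (lborel :: 'a measure)" by (rule product_sigma_finite_lborel)
  let ?P = "\<Pi>\<^sub>M i\<in>{..<p}. (lborel :: 'a measure)" and ?Q = "\<Pi>\<^sub>M i\<in>{..<q}. (lborel :: 'a measure)"
  let ?J = "\<Pi>\<^sub>M i\<in>{p..<p + q}. (lborel :: 'a measure)"
  let ?s = "\<lambda>y :: nat \<Rightarrow> 'a. \<lambda>j\<in>{..<q}. y (p + j)"
  have s: "?s \<in> ?J \<rightarrow>\<^sub>M ?Q"
    by (intro measurable_restrict measurable_component_singleton) auto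
  have r1: "(\<lambda>z. restrict z {..<p}) \<in> (\<Pi>\<^sub>M i\<in>{..<p + q}. (lborel :: 'a measure)) \<rightarrow>\<^sub>M ?P"
    by (intro measurable_restrict_subset) auto
  have r2: "?s \<in> (\<Pi>\<^sub>M i\<in>{..<p + q}. lborel) \<rightarrow>\<^sub>M ?Q"
    by (intro measurable_restrict measurable_component_singleton) auto
  show meas: "(\<lambda>z. f (restrict z {..<p}) * g (?s z)) \<in> borel_measurable (\<Pi>\<^sub>M i\<in>{..<p + q}. lborel)"
    by (intro borel_measurable_times_ennreal measurable_compose[OF r1 f] measurable_compose[OF r2 g])
  have un: "{..<p} \<union> {p..<p + q} = {..<p + q}" by auto
  have "(\<integral>\<^sup>+z. f (restrict z {..<p}) * g (?s z) \<partial>(\<Pi>\<^sub>M i\<in>{..<p + q}. lborel))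
    = (\<integral>\<^sup>+x. \<integral>\<^sup>+y. f (restrict (merge {..<p} {p..<p + q} (x, y)) {..<p}) * g (?s (merge {..<p} {p..<p + q} (x, y))) \<partial>?J \<partial>?P)"
    unfolding un[symmetric] by (rule product_nn_integral_fold) (use meas in \<open>simp_all add: un ivl_disj_int\<close>)
  also have "\<dots> = (\<integral>\<^sup>+x. \<integral>\<^sup>+y. f x * g (?s y) \<partial>?J \<partial>?P)"
  proof (intro nn_integral_cong)
    fix x y :: "nat \<Rightarrow> 'a" assume x: "x \<in> space ?P" and y: "y \<in> space ?J"
    have "restrict (merge {..<p} {p..<p + q} (x, y)) {..<p} = x"
      using x by (auto simp: fun_eq_iff merge_def space_PiM PiE_iff extensional_def)
    moreover have "?s (merge {..<p} {p..<p + q} (x, y)) = ?s y"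
      by (auto simp: fun_eq_iff merge_def)
    ultimately show "f (restrict (merge {..<p} {p..<p + q} (x, y)) {..<p}) * g (?s (merge {..<p} {p..<p + q} (x, y))) = f x * g (?s y)"
      by simp
  qed
  also have "\<dots> = (\<integral>\<^sup>+x. f x * (\<integral>\<^sup>+y. g (?s y) \<partial>?J) \<partial>?P)"
    using measurable_compose[OF s g] by (intro nn_integral_cong nn_integral_cmult)
  also have "(\<integral>\<^sup>+y. g (?s y) \<partial>?J) = (\<integral>\<^sup>+y. g y \<partial>distr ?J ?Q ?s)"
    by (subst nn_integral_distr[OF s]) (use g in simp_all)
  also have "\<dots> = (\<integral>\<^sup>+y. g y \<partial>?Q)"
    by (simp only: distr_PiM_lborel_shift)
  also have "(\<integral>\<^sup>+x. f x * (\<integral>\<^sup>+y. g y \<partial>?Q) \<partial>?P) = (\<integral>\<^sup>+x. f x \<partial>?P) * (\<integral>\<^sup>+y. g y \<partial>?Q)"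
    using f by (rule nn_integral_multc)
  finally show "(\<integral>\<^sup>+x. f x \<partial>?P) * (\<integral>\<^sup>+y. g y \<partial>?Q)
    = (\<integral>\<^sup>+z. f (restrict z {..<p}) * g (?s z) \<partial>(\<Pi>\<^sub>M i\<in>{..<p + q}. lborel))" ..
qed

text \<open>
  The points \<open>Z\<close> of a determinantal process in a window \<open>W\<close> of finite volume, as a random finite set
  whose joint intensities \<open>\<rho>\<close> are the determinants of a kernel bounded by \<open>b\<close>.
\<close>

locale bounded_determinantal_window =
  fixes M :: "'w measure" and W :: "'a::euclidean_space set" and Z :: "'w \<Rightarrow> 'a set"
    and \<rho> :: "nat \<Rightarrow> (nat \<Rightarrow> 'a) \<Rightarrow> real" and K :: "'a \<Rightarrow> 'a \<Rightarrow> complex" and b :: real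
  assumes Z: "random_finite_set M W Z"
    and W: "W \<in> sets borel" "emeasure lborel W < \<infinity>"
    and \<rho>_measurable: "\<And>n. \<rho> n \<in> borel_measurable (\<Pi>\<^sub>M i\<in>{..<n}. lborel)"
    and \<rho>_nonneg: "\<And>n x. x \<in> {..<n} \<rightarrow>\<^sub>E UNIV \<Longrightarrow> 0 \<le> \<rho> n x"
    and \<rho>_det: "\<And>n x. x \<in> {..<n} \<rightarrow>\<^sub>E UNIV \<Longrightarrow>
      complex_of_real (\<rho> n x) = fun_det n (\<lambda>i j. K (x i) (x j))"
    and moment_eq: "\<And>n D. (\<And>i. i < n \<Longrightarrow> D i \<in> sets borel) \<Longrightarrow> (\<And>i. i < n \<Longrightarrow> D i \<subseteq> W) \<Longrightarrow>
      disjoint_family_on D {..<n} \<Longrightarrow> (\<integral>\<^sup>+\<omega>. (\<Prod>i<n. of_nat (card (Z \<omega> \<inter> D i))) \<partial>M) =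
        (\<integral>\<^sup>+x\<in>Pi\<^sub>E {..<n} D. ennreal (\<rho> n x) \<partial>(\<Pi>\<^sub>M i\<in>{..<n}. lborel))"
    and b: "1 \<le> b" "\<And>x y. cmod (K x y) \<le> b"
begin

definition moment :: "'a set set \<Rightarrow> ennreal" where
  "moment T = (\<integral>\<^sup>+\<omega>. (\<Prod>D\<in>T. of_nat (card (Z \<omega> \<inter> D))) \<partial>M)"

lemma \<rho>_le:
  assumes "x \<in> {..<n} \<rightarrow>\<^sub>E UNIV"
  shows "\<rho> n x \<le> (b * sqrt n) ^ n"
proof -
  have "\<rho> n x = cmod (complex_of_real (\<rho> n x))" using \<rho>_nonneg[OF assms] by simp
  also have "\<dots> \<le> (b * sqrt n) ^ n"
    unfolding \<rho>_det[OF assms] using b by (intro hadamard_bounded_entries) auto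
  finally show ?thesis .
qed

lemma \<rho>_split:
  assumes z: "z \<in> {..<p + q} \<rightarrow>\<^sub>E UNIV"
    and eps: "\<And>i j. i < p \<Longrightarrow> j < q \<Longrightarrow> cmod (K (z i) (z (p + j))) \<le> \<epsilon>" "0 \<le> \<epsilon>"
  shows "\<bar>\<rho> (p + q) z - \<rho> p (restrict z {..<p}) * \<rho> q (\<lambda>j\<in>{..<q}. z (p + j))\<bar>
    \<le> \<epsilon> * real (p + q) * (b * sqrt (real (p + q))) ^ (p + q)"
proof -
  let ?x = "restrict z {..<p}" and ?y = "\<lambda>j\<in>{..<q}. z (p + j)"
  let ?a = "\<lambda>i j. K (z i) (z j)"
  have x: "fun_det p (\<lambda>i j. K (?x i) (?x j)) = fun_det p ?a"
    by (rule arg_cong[where f = Determinant.det], rule eq_matI) auto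
  have y: "fun_det q (\<lambda>i j. K (?y i) (?y j)) = fun_det q (\<lambda>i j. ?a (p + i) (p + j))"
    by (rule arg_cong[where f = Determinant.det], rule eq_matI) auto
  have "complex_of_real (\<rho> (p + q) z - \<rho> p ?x * \<rho> q ?y) =
      fun_det (p + q) ?a - fun_det p ?a * fun_det q (\<lambda>i j. ?a (p + i) (p + j))"
    using \<rho>_det[OF z] \<rho>_det[of ?x p] \<rho>_det[of ?y q] unfolding x y by simp
  moreover have "cmod \<dots> \<le> \<epsilon> * real (p + q) * (b * sqrt (real (p + q))) ^ (p + q)"
  proof (rule det_block_difference)
    fix i j assume "i < p" "p \<le> j" "j < p + q"
    then show "cmod (?a i j) \<le> \<epsilon>" using eps(1)[of i "j - p"] by simp
  qed (use b eps in auto)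
  ultimately show ?thesis by (metis norm_of_real)
qed

lemma moment_enumerated:
  assumes T: "T \<subseteq> sets borel" "disjoint T" "\<Union>T \<subseteq> W" and D: "bij_betw D {..<n} T"
  shows "moment T = (\<integral>\<^sup>+x\<in>Pi\<^sub>E {..<n} D. ennreal (\<rho> n x) \<partial>(\<Pi>\<^sub>M i\<in>{..<n}. lborel))"
proof -
  have mem: "D i \<in> T" if "i < n" for i using D that by (auto simp: bij_betw_def)
  have "disjoint_family_on D {..<n}"
  proof (unfold disjoint_family_on_def, intro ballI impI)
    fix i j assume "i \<in> {..<n}" "j \<in> {..<n}" "i \<noteq> j"
    then show "D i \<inter> D j = {}"
      using D by (intro disjointD[OF T(2)] mem) (auto simp: bij_betw_def inj_on_def)
  qed
  moreover have "moment T = (\<integral>\<^sup>+\<omega>. (\<Prod>i<n. of_nat (card (Z \<omega> \<inter> D i))) \<partial>M)"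
    unfolding moment_def by (intro nn_integral_cong prod.reindex_bij_betw[OF D, symmetric])
  ultimately show ?thesis using mem T by (subst moment_eq[symmetric]) auto
qed

lemma emeasure_PiE_lborel:
  fixes D :: "nat \<Rightarrow> 'a set"
  assumes T: "T \<subseteq> sets borel" "\<Union>T \<subseteq> W" and D: "bij_betw D {..<n} T"
  shows "Pi\<^sub>E {..<n} D \<in> sets (\<Pi>\<^sub>M i\<in>{..<n}. lborel)"
    and "emeasure (\<Pi>\<^sub>M i\<in>{..<n}. lborel) (Pi\<^sub>E {..<n} D) = ennreal (\<Prod>D\<in>T. measure lborel D)"
proof -
  interpret product_sigma_finite "\<lambda>_ :: nat. (lborel :: 'a measure)" by (rule product_sigma_finite_lborel)
  have mem: "D i \<in> T" if "i < n" for i using D that by (auto simp: bij_betw_def)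
  show "Pi\<^sub>E {..<n} D \<in> sets (\<Pi>\<^sub>M i\<in>{..<n}. lborel)"
    using mem T by (intro sets_PiM_I_finite) auto
  have fin: "emeasure lborel D = ennreal (measure lborel D)" if "D \<in> T" for D
  proof -
    have "emeasure lborel D \<le> emeasure lborel W" using W T that by (intro emeasure_mono) auto
    then show ?thesis using W by (intro emeasure_eq_ennreal_measure) (auto simp: top_unique)
  qed
  have "emeasure (\<Pi>\<^sub>M i\<in>{..<n}. lborel) (Pi\<^sub>E {..<n} D) = (\<Prod>i<n. emeasure lborel (D i))"
    using mem T by (intro emeasure_PiM) auto
  also have "\<dots> = (\<Prod>D\<in>T. emeasure lborel D)"
    by (rule prod.reindex_bij_betw[OF D])
  also have "\<dots> = ennreal (\<Prod>D\<in>T. measure lborel D)"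
    using fin by (subst prod_ennreal[symmetric]) auto
  finally show "emeasure (\<Pi>\<^sub>M i\<in>{..<n}. lborel) (Pi\<^sub>E {..<n} D) = ennreal (\<Prod>D\<in>T. measure lborel D)" .
qed

lemma moment_le:
  assumes T: "finite T" "T \<subseteq> sets borel" "disjoint T" "\<Union>T \<subseteq> W"
  shows "moment T \<le> ennreal ((b * sqrt (card T)) ^ card T * (\<Prod>D\<in>T. measure lborel D))"
proof -
  let ?n = "card T" and ?P = "\<Pi>\<^sub>M i\<in>{..<card T}. (lborel :: 'a measure)"
  let ?R = "(b * sqrt (card T)) ^ card T"
  obtain D where D: "bij_betw D {..<?n} T"
    using ex_bij_betw_nat_finite[OF T(1)] by (auto simp: atLeast0LessThan)
  have R0: "0 \<le> ?R" using b by simp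
  have "moment T = (\<integral>\<^sup>+x\<in>Pi\<^sub>E {..<?n} D. ennreal (\<rho> ?n x) \<partial>?P)"
    by (rule moment_enumerated[OF T(2-4) D])
  also have "\<dots> \<le> (\<integral>\<^sup>+x\<in>Pi\<^sub>E {..<?n} D. ennreal ?R \<partial>?P)"
    by (intro nn_integral_mono mult_right_mono ennreal_leI \<rho>_le) (auto simp: space_PiM)
  also have "\<dots> = ennreal ?R * emeasure ?P (Pi\<^sub>E {..<?n} D)"
    by (rule nn_integral_cmult_indicator[OF emeasure_PiE_lborel(1)[OF T(2,4) D]])
  also have "\<dots> = ennreal (?R * (\<Prod>D\<in>T. measure lborel D))"
    unfolding emeasure_PiE_lborel(2)[OF T(2,4) D] using R0 by (simp add: ennreal_mult prod_nonneg)
  finally show ?thesis .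
qed

text \<open>
  Both sides are integrals over the same product of cells, and \<open>\<rho>_split\<close> compares the integrands
  pointwise. There are two inequalities instead of an absolute value because moments are extended
  nonnegative reals.
\<close>

lemma moment_split:
  assumes T: "finite T" "T \<subseteq> sets borel" "disjoint T" "\<Union>T \<subseteq> W"
    and T12: "T = T1 \<union> T2" "T1 \<inter> T2 = {}"
    and eps: "\<And>D1 D2 x y. D1 \<in> T1 \<Longrightarrow> D2 \<in> T2 \<Longrightarrow> x \<in> D1 \<Longrightarrow> y \<in> D2 \<Longrightarrow> cmod (K x y) \<le> \<epsilon>" "0 \<le> \<epsilon>"
  defines "d \<equiv> ennreal (\<epsilon> * card T * (b * sqrt (card T)) ^ card T * (\<Prod>D\<in>T. measure lborel D))"
  shows "moment T \<le> moment T1 * moment T2 + d" and "moment T1 * moment T2 \<le> moment T + d"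
proof -
  define p where "p = card T1"
  define q where "q = card T2"
  have fin: "finite T1" "finite T2" using T T12 by auto
  have cT: "card T = p + q" using fin T12 by (simp add: card_Un_disjoint p_def q_def)
  obtain D1 where D1: "bij_betw D1 {..<p} T1"
    using ex_bij_betw_nat_finite[OF fin(1)] by (auto simp: atLeast0LessThan p_def)
  obtain D2 where D2: "bij_betw D2 {..<q} T2"
    using ex_bij_betw_nat_finite[OF fin(2)] by (auto simp: atLeast0LessThan q_def)
  define D where "D i = (if i < p then D1 i else D2 (i - p))" for i
  have "bij_betw D ({..<p} \<union> {p..<p + q}) (T1 \<union> T2)"
  proof (rule bij_betw_combine)
    show "bij_betw D {..<p} T1"
      using D1 by (rule bij_betw_cong[THEN iffD1, rotated]) (simp add: D_def)
    have "bij_betw (\<lambda>i. i - p) {p..<p + q} {..<q}"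
      by (rule bij_betw_byWitness[where f' = "\<lambda>j. p + j"]) auto
    from bij_betw_trans[OF this D2] show "bij_betw D {p..<p + q} T2"
      by (rule bij_betw_cong[THEN iffD1, rotated]) (simp add: D_def)
  qed (use T12 in simp)
  moreover have "{..<p} \<union> {p..<p + q} = {..<p + q}" by auto
  ultimately have D: "bij_betw D {..<p + q} T" using T12 by simp
  let ?P = "\<lambda>n. \<Pi>\<^sub>M i\<in>{..<n}. (lborel :: 'a measure)"
  let ?x = "\<lambda>z :: nat \<Rightarrow> 'a. restrict z {..<p}" and ?y = "\<lambda>z :: nat \<Rightarrow> 'a. \<lambda>j\<in>{..<q}. z (p + j)"
  define c where "c = \<epsilon> * real (p + q) * (b * sqrt (real (p + q))) ^ (p + q)"
  have c0: "0 \<le> c" using eps b by (simp add: c_def)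
  have sub: "T1 \<subseteq> sets borel" "disjoint T1" "\<Union>T1 \<subseteq> W" "T2 \<subseteq> sets borel" "disjoint T2" "\<Union>T2 \<subseteq> W"
    using T T12 by (auto intro: pairwise_subset)
  have PiE_iff': "?x z \<in> Pi\<^sub>E {..<p} D1 \<and> ?y z \<in> Pi\<^sub>E {..<q} D2 \<longleftrightarrow> z \<in> Pi\<^sub>E {..<p + q} D"
    if "z \<in> {..<p + q} \<rightarrow>\<^sub>E UNIV" for z
  proof
    assume *: "?x z \<in> Pi\<^sub>E {..<p} D1 \<and> ?y z \<in> Pi\<^sub>E {..<q} D2"
    show "z \<in> Pi\<^sub>E {..<p + q} D"
    proof (rule PiE_I)
      fix i assume i: "i \<in> {..<p + q}"
      show "z i \<in> D i"
      proof (cases "i < p")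
        case True
        have "?x z i \<in> D1 i" using * True by blast
        then show ?thesis using True by (simp add: D_def)
      next
        case False
        then have "i - p < q" "p + (i - p) = i" using i by auto
        moreover from this have "?y z (i - p) \<in> D2 (i - p)" using * by blast
        ultimately show ?thesis using False by (simp add: D_def)
      qed
    qed (use that in auto)
  next
    assume *: "z \<in> Pi\<^sub>E {..<p + q} D"
    have "z i \<in> D1 i" if "i < p" for i using PiE_mem[OF *, of i] that by (simp add: D_def)
    moreover have "z (p + j) \<in> D2 j" if "j < q" for j using PiE_mem[OF *, of "p + j"] that by (simp add: D_def)
    ultimately show "?x z \<in> Pi\<^sub>E {..<p} D1 \<and> ?y z \<in> Pi\<^sub>E {..<q} D2" by auto
  qed
  note [measurable] = \<rho>_measurable
  have ind1[measurable]: "Pi\<^sub>E {..<p} D1 \<in> sets (?P p)" by (rule emeasure_PiE_lborel(1)[OF sub(1,3) D1])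
  have ind2[measurable]: "Pi\<^sub>E {..<q} D2 \<in> sets (?P q)" by (rule emeasure_PiE_lborel(1)[OF sub(4,6) D2])
  have indT: "Pi\<^sub>E {..<p + q} D \<in> sets (?P (p + q))" by (rule emeasure_PiE_lborel(1)[OF T(2,4) D])
  define h where "h z = ennreal (\<rho> p (?x z)) * ennreal (\<rho> q (?y z)) * indicator (Pi\<^sub>E {..<p + q} D) z" for z
  define f where "f z = ennreal (\<rho> (p + q) z) * indicator (Pi\<^sub>E {..<p + q} D) z" for z
  have f_meas: "f \<in> borel_measurable (?P (p + q))" unfolding f_def using indT by measurable
  have h_eq: "(ennreal (\<rho> p (?x z)) * indicator (Pi\<^sub>E {..<p} D1) (?x z)) *
      (ennreal (\<rho> q (?y z)) * indicator (Pi\<^sub>E {..<q} D2) (?y z)) = h z" if "z \<in> space (?P (p + q))" for z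
  proof -
    have "z \<in> {..<p + q} \<rightarrow>\<^sub>E UNIV" using that by (simp add: space_PiM)
    from PiE_iff'[OF this] show ?thesis unfolding h_def by (auto simp: indicator_def)
  qed
  have "moment T1 * moment T2 = (\<integral>\<^sup>+z. (ennreal (\<rho> p (?x z)) * indicator (Pi\<^sub>E {..<p} D1) (?x z)) *
      (ennreal (\<rho> q (?y z)) * indicator (Pi\<^sub>E {..<q} D2) (?y z)) \<partial>?P (p + q))"
    unfolding moment_enumerated[OF sub(1-3) D1] moment_enumerated[OF sub(4-6) D2]
    by (rule nn_integral_PiM_split) measurable
  also have "\<dots> = (\<integral>\<^sup>+z. h z \<partial>?P (p + q))"
    by (intro nn_integral_cong h_eq)
  finally have prod_eq: "moment T1 * moment T2 = (\<integral>\<^sup>+z. h z \<partial>?P (p + q))" .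
  have "(\<lambda>z. (ennreal (\<rho> p (?x z)) * indicator (Pi\<^sub>E {..<p} D1) (?x z)) *
      (ennreal (\<rho> q (?y z)) * indicator (Pi\<^sub>E {..<q} D2) (?y z))) \<in> borel_measurable (?P (p + q))"
    by (rule nn_integral_PiM_split(2)) measurable
  then have h_meas: "h \<in> borel_measurable (?P (p + q))"
    by (rule measurable_cong[THEN iffD1, rotated]) (rule h_eq)
  have T_eq: "moment T = (\<integral>\<^sup>+z. f z \<partial>?P (p + q))"
    unfolding f_def by (rule moment_enumerated[OF T(2-4) D])
  have d_eq: "(\<integral>\<^sup>+z. ennreal c * indicator (Pi\<^sub>E {..<p + q} D) z \<partial>?P (p + q)) = d"
    unfolding nn_integral_cmult_indicator[OF indT] emeasure_PiE_lborel(2)[OF T(2,4) D]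
    using c0 by (simp add: d_def c_def cT ennreal_mult[symmetric] prod_nonneg)
  have pointwise: "f z \<le> h z + ennreal c * indicator (Pi\<^sub>E {..<p + q} D) z"
    "h z \<le> f z + ennreal c * indicator (Pi\<^sub>E {..<p + q} D) z" if "z \<in> space (?P (p + q))" for z
  proof -
    have z: "z \<in> {..<p + q} \<rightarrow>\<^sub>E UNIV" using that by (simp add: space_PiM)
    have nn: "0 \<le> \<rho> (p + q) z" "0 \<le> \<rho> p (?x z)" "0 \<le> \<rho> q (?y z)"
      using z by (auto intro!: \<rho>_nonneg)
    have "f z \<le> h z + ennreal c * indicator (Pi\<^sub>E {..<p + q} D) z \<and>
      h z \<le> f z + ennreal c * indicator (Pi\<^sub>E {..<p + q} D) z"
    proof (cases "z \<in> Pi\<^sub>E {..<p + q} D")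
      case True
      have "cmod (K (z i) (z (p + j))) \<le> \<epsilon>" if "i < p" "j < q" for i j
      proof (rule eps(1))
        show "D i \<in> T1" using D1 that by (auto simp: D_def bij_betw_def)
        show "D (p + j) \<in> T2" using D2 that by (auto simp: D_def bij_betw_def)
      qed (use that PiE_mem[OF True] in auto)
      from \<rho>_split[OF z this eps(2)]
      have "\<bar>\<rho> (p + q) z - \<rho> p (?x z) * \<rho> q (?y z)\<bar> \<le> c" by (simp add: c_def)
      then have "\<rho> (p + q) z \<le> \<rho> p (?x z) * \<rho> q (?y z) + c" "\<rho> p (?x z) * \<rho> q (?y z) \<le> \<rho> (p + q) z + c"
        by linarith+
      then show ?thesis
        using True nn c0 by (simp add: f_def h_def ennreal_mult[symmetric] ennreal_plus[symmetric] ennreal_leI del: ennreal_plus)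
    next
      case False
      then show ?thesis by (simp add: f_def h_def)
    qed
    then show "f z \<le> h z + ennreal c * indicator (Pi\<^sub>E {..<p + q} D) z"
      "h z \<le> f z + ennreal c * indicator (Pi\<^sub>E {..<p + q} D) z" by auto
  qed
  have ind_meas: "(\<lambda>z. ennreal c * indicator (Pi\<^sub>E {..<p + q} D) z) \<in> borel_measurable (?P (p + q))"
    using indT by measurable
  have "moment T \<le> (\<integral>\<^sup>+z. h z + ennreal c * indicator (Pi\<^sub>E {..<p + q} D) z \<partial>?P (p + q))"
    unfolding T_eq by (intro nn_integral_mono pointwise(1))
  also have "\<dots> = moment T1 * moment T2 + d"
    unfolding prod_eq d_eq[symmetric] by (rule nn_integral_add[OF h_meas ind_meas])
  finally show "moment T \<le> moment T1 * moment T2 + d" .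
  have "moment T1 * moment T2 \<le> (\<integral>\<^sup>+z. f z + ennreal c * indicator (Pi\<^sub>E {..<p + q} D) z \<partial>?P (p + q))"
    unfolding prod_eq by (intro nn_integral_mono pointwise(2))
  also have "\<dots> = moment T + d"
    unfolding T_eq d_eq[symmetric] by (rule nn_integral_add[OF f_meas ind_meas])
  finally show "moment T1 * moment T2 \<le> moment T + d" .
qed

end


section \<open>Decoupling by superposition\<close>

lemma measurable_nat_add:
  fixes f g :: "'w \<Rightarrow> nat"
  assumes "f \<in> M \<rightarrow>\<^sub>M count_space UNIV" "g \<in> M \<rightarrow>\<^sub>M count_space UNIV"
  shows "(\<lambda>x. f x + g x) \<in> M \<rightarrow>\<^sub>M count_space UNIV"
proof (rule measurable_compose_countable[where f = "\<lambda>i x. f x + i" and g = g])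
  show "(\<lambda>x. f x + i) \<in> M \<rightarrow>\<^sub>M count_space UNIV" for i
    by (rule measurable_compose[OF assms(1)]) simp
qed (rule assms(2))

lemma hadamard_bound_supermultiplicative:
  fixes b :: real
  assumes "0 \<le> b"
  shows "(b * sqrt p) ^ p * (b * sqrt q) ^ q \<le> (b * sqrt (real (p + q))) ^ (p + q)"
  unfolding power_add using assms
  by (intro mult_mono power_mono mult_left_mono zero_le_power mult_nonneg_nonneg real_sqrt_le_mono) auto

context bounded_determinantal_window
begin

text \<open>
  A model of independence: on the product space the restrictions to \<open>A\<close> and to its
  complement are taken from different coordinates, hence are independent with the original laws.
\<close>

definition superposed :: "'a set \<Rightarrow> 'w \<times> 'w \<Rightarrow> 'a set" where
  "superposed A = (\<lambda>(\<omega>, \<omega>'). (Z \<omega> \<inter> A) \<union> (Z \<omega>' - A))"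

lemma finite_Z: "\<omega> \<in> space M \<Longrightarrow> finite (Z \<omega>)" and Z_subset: "\<omega> \<in> space M \<Longrightarrow> Z \<omega> \<subseteq> W"
  and card_Z_measurable: "D \<in> sets borel \<Longrightarrow> (\<lambda>\<omega>. card (Z \<omega> \<inter> D)) \<in> M \<rightarrow>\<^sub>M count_space UNIV"
  and prob_M: "prob_space M"
  using Z by (auto simp: random_finite_set_def)

lemma card_superposed:
  assumes "p \<in> space (M \<Otimes>\<^sub>M M)"
  shows "card (superposed A p \<inter> D) = card (Z (fst p) \<inter> (D \<inter> A)) + card (Z (snd p) \<inter> (D - A))"
proof -
  have fin: "finite (Z (fst p))" "finite (Z (snd p))"
    using assms finite_Z by (auto simp: space_pair_measure)
  have "superposed A p \<inter> D = (Z (fst p) \<inter> (D \<inter> A)) \<union> (Z (snd p) \<inter> (D - A))"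
    by (auto simp: superposed_def split: prod.splits)
  then show ?thesis using fin by (simp add: card_Un_disjoint Int_def disjoint_iff)
qed

lemma random_finite_set_superposed:
  assumes A: "A \<in> sets borel"
  shows "random_finite_set (M \<Otimes>\<^sub>M M) W (superposed A)"
  unfolding random_finite_set_def
proof (intro conjI ballI)
  interpret M: prob_space M by (rule prob_M)
  interpret P: pair_prob_space M M ..
  show "prob_space (M \<Otimes>\<^sub>M M)" by (rule P.prob_space_axioms)
next
  fix p assume p: "p \<in> space (M \<Otimes>\<^sub>M M)"
  then have "fst p \<in> space M" "snd p \<in> space M" by (auto simp: space_pair_measure)
  then show "finite (superposed A p)" "superposed A p \<subseteq> W"
    using finite_Z[of "fst p"] finite_Z[of "snd p"] Z_subset[of "fst p"] Z_subset[of "snd p"]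
    by (auto simp: superposed_def split: prod.splits)
next
  fix D :: "'a set" assume D: "D \<in> sets borel"
  have "(\<lambda>p. card (Z (fst p) \<inter> (D \<inter> A)) + card (Z (snd p) \<inter> (D - A))) \<in> M \<Otimes>\<^sub>M M \<rightarrow>\<^sub>M count_space UNIV"
    using A D
    by (intro measurable_nat_add measurable_compose[OF measurable_fst card_Z_measurable]
        measurable_compose[OF measurable_snd card_Z_measurable]) auto
  then show "(\<lambda>p. card (superposed A p \<inter> D)) \<in> M \<Otimes>\<^sub>M M \<rightarrow>\<^sub>M count_space UNIV"
    by (rule measurable_cong[THEN iffD1, rotated]) (rule card_superposed[symmetric])
qed

lemma moment_superposed:
  assumes T: "unsplit_family W A T" and A: "A \<in> sets borel"
  defines "T1 \<equiv> {D\<in>T. D \<subseteq> A}"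
  shows "(\<integral>\<^sup>+p. (\<Prod>D\<in>T. of_nat (card (superposed A p \<inter> D))) \<partial>(M \<Otimes>\<^sub>M M)) = moment T1 * moment (T - T1)"
proof -
  interpret M: prob_space M by (rule prob_M)
  have fin: "finite T" "T1 \<subseteq> T" using T by (auto simp: unsplit_family_def T1_def)
  have TB: "T1 \<subseteq> sets borel" "T - T1 \<subseteq> sets borel" using T by (auto simp: unsplit_family_def T1_def)
  let ?f = "\<lambda>T \<omega>. \<Prod>D\<in>T. of_nat (card (Z \<omega> \<inter> D)) :: ennreal"
  have m: "?f T1 \<in> borel_measurable M" "?f (T - T1) \<in> borel_measurable M"
    using borel_measurable_prod_card(2)[OF Z] TB by auto
  have eq: "(\<Prod>D\<in>T. of_nat (card (superposed A p \<inter> D))) = ?f T1 (fst p) * ?f (T - T1) (snd p)"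
    if p: "p \<in> space (M \<Otimes>\<^sub>M M)" for p
  proof -
    have "of_nat (card (superposed A p \<inter> D)) = (of_nat (card (Z (fst p) \<inter> D)) :: ennreal)" if "D \<in> T1" for D
    proof -
      have "D \<inter> A = D" "D - A = {}" using that by (auto simp: T1_def)
      then show ?thesis
        unfolding card_superposed[OF p] by (simp only: Int_empty_right card.empty add_0_left add_0_right)
    qed
    moreover have "of_nat (card (superposed A p \<inter> D)) = (of_nat (card (Z (snd p) \<inter> D)) :: ennreal)" if "D \<in> T - T1" for D
    proof -
      have "D \<inter> A = {}" "D - A = D" using that T by (auto simp: T1_def unsplit_family_def)
      then show ?thesis
        unfolding card_superposed[OF p] by (simp only: Int_empty_right card.empty add_0_left add_0_right)
    qed
    ultimately show ?thesis
      using fin by (subst prod.subset_diff[of T1 T]) (simp_all add: mult.commute)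
  qed
  have "(\<integral>\<^sup>+p. (\<Prod>D\<in>T. of_nat (card (superposed A p \<inter> D))) \<partial>(M \<Otimes>\<^sub>M M))
      = (\<integral>\<^sup>+p. ?f T1 (fst p) * ?f (T - T1) (snd p) \<partial>(M \<Otimes>\<^sub>M M))"
    by (intro nn_integral_cong eq)
  also have "\<dots> = (\<integral>\<^sup>+\<omega>. \<integral>\<^sup>+\<omega>'. ?f T1 \<omega> * ?f (T - T1) \<omega>' \<partial>M \<partial>M)"
    by (subst M.nn_integral_fst[symmetric])
       (auto intro!: borel_measurable_times_ennreal measurable_compose[OF measurable_fst m(1)]
         measurable_compose[OF measurable_snd m(2)])
  also have "\<dots> = (\<integral>\<^sup>+\<omega>. ?f T1 \<omega> * moment (T - T1) \<partial>M)"
    unfolding moment_def by (intro nn_integral_cong nn_integral_cmult m)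
  also have "\<dots> = moment T1 * moment (T - T1)"
    unfolding moment_def[of T1] by (rule nn_integral_multc[OF m(1)])
  finally show ?thesis .
qed

lemma unsplit_family_parts:
  assumes "unsplit_family W A T" "T1 = {D\<in>T. D \<subseteq> A}"
  shows "finite T" "T \<subseteq> sets borel" "disjoint T" "\<Union>T \<subseteq> W"
    and "finite T1" "T1 \<subseteq> sets borel" "disjoint T1" "\<Union>T1 \<subseteq> W"
    and "finite (T - T1)" "T - T1 \<subseteq> sets borel" "disjoint (T - T1)" "\<Union>(T - T1) \<subseteq> W"
    and "card T = card T1 + card (T - T1)"
    and "(\<Prod>D\<in>T. measure lborel D) = (\<Prod>D\<in>T1. measure lborel D) * (\<Prod>D\<in>T - T1. measure lborel D)"
proof -
  have *: "finite T" "T \<subseteq> sets borel" "disjoint T" "\<Union>T \<subseteq> W" "T1 \<subseteq> T"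
    using assms by (auto simp: unsplit_family_def)
  then show "finite T" "T \<subseteq> sets borel" "disjoint T" "\<Union>T \<subseteq> W"
    "finite T1" "T1 \<subseteq> sets borel" "disjoint T1" "\<Union>T1 \<subseteq> W"
    "finite (T - T1)" "T - T1 \<subseteq> sets borel" "disjoint (T - T1)" "\<Union>(T - T1) \<subseteq> W"
    by (auto intro: finite_subset pairwise_subset)
  show "card T = card T1 + card (T - T1)"
    using * by (metis card_Diff_subset card_mono finite_subset le_add_diff_inverse)
  show "(\<Prod>D\<in>T. measure lborel D) = (\<Prod>D\<in>T1. measure lborel D) * (\<Prod>D\<in>T - T1. measure lborel D)"
    using * by (subst prod.subset_diff[of T1 T]) (simp_all add: mult.commute)
qed

lemma moments_bounded_Z: "moments_bounded M W A Z (\<lambda>n. (b * sqrt n) ^ n)"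
  unfolding moments_bounded_def unsplit_family_def moment_def[symmetric]
  by (intro allI impI moment_le) auto

lemma moments_bounded_superposed:
  assumes A: "A \<in> sets borel"
  shows "moments_bounded (M \<Otimes>\<^sub>M M) W A (superposed A) (\<lambda>n. (b * sqrt n) ^ n)"
  unfolding moments_bounded_def
proof (intro allI impI)
  fix T assume T: "unsplit_family W A T"
  define T1 where "T1 = {D\<in>T. D \<subseteq> A}"
  note parts = unsplit_family_parts[OF T T1_def]
  let ?R = "\<lambda>n::nat. (b * sqrt n) ^ n" and ?v = "\<lambda>T. \<Prod>D\<in>T. measure lborel D"
  have R0: "0 \<le> ?R n" for n using b by simp
  have v0: "0 \<le> ?v T" for T by (simp add: prod_nonneg)
  have "moment T1 * moment (T - T1) \<le> ennreal (?R (card T1) * ?v T1) * ennreal (?R (card (T - T1)) * ?v (T - T1))"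
    by (intro mult_mono moment_le parts) auto
  also have "\<dots> = ennreal ((?R (card T1) * ?R (card (T - T1))) * ?v T)"
    unfolding parts(14) by (subst ennreal_mult[symmetric])
      (use R0 v0 in \<open>auto intro!: mult_nonneg_nonneg simp: ac_simps\<close>)
  also have "\<dots> \<le> ennreal (?R (card T) * ?v T)"
    unfolding parts(13) using b v0
    by (intro ennreal_leI mult_right_mono hadamard_bound_supermultiplicative) auto
  finally show "(\<integral>\<^sup>+p. (\<Prod>D\<in>T. of_nat (card (superposed A p \<inter> D))) \<partial>(M \<Otimes>\<^sub>M M)) \<le> ennreal (?R (card T) * ?v T)"
    unfolding moment_superposed[OF T A] T1_def .
qed

lemma integral_prod_card_eq:
  assumes Y: "random_finite_set N W Y" and T: "T \<subseteq> sets borel"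
  shows "(\<integral>\<omega>. (\<Prod>D\<in>T. real (card (Y \<omega> \<inter> D))) \<partial>N) = enn2real (\<integral>\<^sup>+\<omega>. (\<Prod>D\<in>T. of_nat (card (Y \<omega> \<inter> D))) \<partial>N)"
proof -
  have "(\<integral>\<omega>. (\<Prod>D\<in>T. real (card (Y \<omega> \<inter> D))) \<partial>N) = enn2real (\<integral>\<^sup>+\<omega>. ennreal (\<Prod>D\<in>T. real (card (Y \<omega> \<inter> D))) \<partial>N)"
    using borel_measurable_prod_card(1)[OF Y T] by (intro integral_eq_nn_integral) (auto intro!: prod_nonneg)
  also have "(\<integral>\<^sup>+\<omega>. ennreal (\<Prod>D\<in>T. real (card (Y \<omega> \<inter> D))) \<partial>N) = (\<integral>\<^sup>+\<omega>. (\<Prod>D\<in>T. of_nat (card (Y \<omega> \<inter> D))) \<partial>N)"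
    by (intro nn_integral_cong) (simp add: prod_ennreal[symmetric] ennreal_of_nat_eq_real_of_nat)
  finally show ?thesis .
qed

text \<open>
  \<open>prob_difference_le_moment_differences\<close> for \<open>Z\<close> and the superposition, with
  \<open>R n = (b \<surd>n)^n\<close> and \<open>\<delta> n = \<epsilon> n R n\<close>. The factor \<open>n\<close> is absorbed in \<open>2^n\<close>, so that
  \<open>hadamard_series\<close> applies.
\<close>

theorem superposition_difference:
  assumes A: "A \<in> sets borel"
    and eps: "\<And>x y. x \<in> W \<inter> A \<Longrightarrow> y \<in> W - A \<Longrightarrow> cmod (K x y) \<le> \<epsilon>" "0 \<le> \<epsilon>"
    and \<F>: "finite \<F>" "\<F> \<subseteq> sets borel"
    and determined: "\<And>X Y. finite X \<Longrightarrow> finite Y \<Longrightarrow> X \<subseteq> W \<Longrightarrow> Y \<subseteq> W \<Longrightarrow>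
      (\<And>F. F \<in> \<F> \<Longrightarrow> card (X \<inter> F) = card (Y \<inter> F)) \<Longrightarrow> X \<in> E \<Longrightarrow> Y \<in> E"
    and E: "{\<omega>\<in>space M. Z \<omega> \<in> E} \<in> sets M"
      "{p\<in>space (M \<Otimes>\<^sub>M M). superposed A p \<in> E} \<in> sets (M \<Otimes>\<^sub>M M)"
  shows "\<bar>measure M {\<omega>\<in>space M. Z \<omega> \<in> E} - measure (M \<Otimes>\<^sub>M M) {p\<in>space (M \<Otimes>\<^sub>M M). superposed A p \<in> E}\<bar>
    \<le> \<epsilon> * (exp (64 * exp 1 * (measure lborel W * b)\<^sup>2) + 1)"
proof -
  let ?v = "measure lborel W"
  define R where "R n = (b * sqrt (real n)) ^ n" for n
  define \<delta> where "\<delta> n = \<epsilon> * real n * (b * sqrt (real n)) ^ n" for n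
  have b0: "0 \<le> b" using b by simp
  have R0: "0 \<le> R n" for n using b0 by (simp add: R_def)
  have \<delta>0: "0 \<le> \<delta> n" for n using b0 eps by (simp add: \<delta>_def)
  have series: "summable (\<lambda>n. (4 * ?v) ^ n / fact n * R n)"
    "(\<Sum>n. (4 * ?v) ^ n / fact n * R n) \<le> exp (64 * exp 1 * (?v * b)\<^sup>2) + 1"
    unfolding R_def using hadamard_series[of ?v b] b0 by auto
  have R_term: "2 ^ n * R n * ?v ^ n / fact n \<le> (4 * ?v) ^ n / fact n * R n" for n
  proof -
    have "2 ^ n * (R n * ?v ^ n / fact n) \<le> 4 ^ n * (R n * ?v ^ n / fact n)"
      using R0[of n] by (intro mult_right_mono power_mono) auto
    then show ?thesis by (simp add: power_mult_distrib mult_ac)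
  qed
  have \<delta>_term: "2 ^ n * \<delta> n * ?v ^ n / fact n \<le> \<epsilon> * ((4 * ?v) ^ n / fact n * R n)" for n
  proof -
    have "real n \<le> 2 ^ n" using of_nat_less_two_power[of n, where 'a = real] by simp
    then have "2 ^ n * real n * (\<epsilon> * R n * ?v ^ n / fact n) \<le> 2 ^ n * 2 ^ n * (\<epsilon> * R n * ?v ^ n / fact n)"
      using R0[of n] eps by (intro mult_right_mono mult_left_mono) auto
    also have "(2 ^ n * 2 ^ n :: real) = 4 ^ n" by (simp add: power_mult_distrib[symmetric])
    finally show ?thesis by (simp add: \<delta>_def R_def power_mult_distrib mult_ac)
  qed
  have smR: "summable (\<lambda>n. 2 ^ n * R n * ?v ^ n / fact n)"
    using R_term R0 by (intro summable_comparison_test'[OF series(1), of 0]) auto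
  have sm\<delta>: "summable (\<lambda>n. 2 ^ n * \<delta> n * ?v ^ n / fact n)"
    using \<delta>_term \<delta>0 by (intro summable_comparison_test'[OF summable_mult[OF series(1), of \<epsilon>], of 0]) auto
  have "\<bar>measure M {\<omega>\<in>space M. Z \<omega> \<in> E} - measure (M \<Otimes>\<^sub>M M) {p\<in>space (M \<Otimes>\<^sub>M M). superposed A p \<in> E}\<bar>
      \<le> (\<Sum>n. 2 ^ n * \<delta> n * ?v ^ n / fact n)"
  proof (rule prob_difference_le_moment_differences[OF Z _ random_finite_set_superposed[OF A] _ W A R0 smR \<delta>0 sm\<delta> _ \<F>])
    show "moments_bounded M W A Z R" "moments_bounded (M \<Otimes>\<^sub>M M) W A (superposed A) R"
      unfolding R_def by (rule moments_bounded_Z, rule moments_bounded_superposed[OF A])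
  next
    fix T assume T: "unsplit_family W A T"
    define T1 where "T1 = {D\<in>T. D \<subseteq> A}"
    note parts = unsplit_family_parts[OF T T1_def]
    have "cmod (K x y) \<le> \<epsilon>" if "D1 \<in> T1" "D2 \<in> T - T1" "x \<in> D1" "y \<in> D2" for D1 D2 x y
    proof (rule eps(1))
      show "x \<in> W \<inter> A" using that parts by (auto simp: T1_def)
      have "D2 \<inter> A = {}" using that(2) T by (auto simp: T1_def unsplit_family_def)
      then show "y \<in> W - A" using that parts by auto
    qed
    moreover have "T = T1 \<union> (T - T1)" by (auto simp: T1_def)
    ultimately have split: "moment T \<le> moment T1 * moment (T - T1) + ennreal (\<delta> (card T) * (\<Prod>D\<in>T. measure lborel D))"
      "moment T1 * moment (T - T1) \<le> moment T + ennreal (\<delta> (card T) * (\<Prod>D\<in>T. measure lborel D))"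
      unfolding \<delta>_def using moment_split[OF parts(1-4), of T1 "T - T1" \<epsilon>] eps(2) by blast+
    have "moment T < \<infinity>" "moment T1 < \<infinity>" "moment (T - T1) < \<infinity>"
      using moment_le[OF parts(1-4)] moment_le[OF parts(5-8)] moment_le[OF parts(9-12)]
      by (auto intro: order_le_less_trans)
    then obtain u u1 where u: "moment T = ennreal u" "0 \<le> u"
      "moment T1 * moment (T - T1) = ennreal u1" "0 \<le> u1"
      by (metis ennreal_cases ennreal_mult_eq_top_iff infinity_ennreal_def order_less_irrefl)
    have e0: "0 \<le> \<delta> (card T) * (\<Prod>D\<in>T. measure lborel D)" using \<delta>0 by (simp add: prod_nonneg)
    have "\<bar>u - u1\<bar> \<le> \<delta> (card T) * (\<Prod>D\<in>T. measure lborel D)"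
      using split e0 u by (simp add: ennreal_plus[symmetric] abs_le_iff del: ennreal_plus)
    moreover have "(\<integral>\<omega>. (\<Prod>D\<in>T. real (card (Z \<omega> \<inter> D))) \<partial>M) = u"
      using integral_prod_card_eq[OF Z parts(2)] u by (simp add: moment_def[symmetric])
    moreover have "(\<integral>p. (\<Prod>D\<in>T. real (card (superposed A p \<inter> D))) \<partial>(M \<Otimes>\<^sub>M M)) = u1"
      using integral_prod_card_eq[OF random_finite_set_superposed[OF A] parts(2)] u
      by (simp add: moment_superposed[OF T A] T1_def)
    ultimately show "\<bar>(\<integral>\<omega>. (\<Prod>D\<in>T. real (card (Z \<omega> \<inter> D))) \<partial>M) -
        (\<integral>p. (\<Prod>D\<in>T. real (card (superposed A p \<inter> D))) \<partial>(M \<Otimes>\<^sub>M M))\<bar>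
        \<le> \<delta> (card T) * (\<Prod>D\<in>T. measure lborel D)" by simp
  qed (fact determined E)+
  also have "\<dots> \<le> (\<Sum>n. \<epsilon> * ((4 * ?v) ^ n / fact n * R n))"
    by (intro suminf_le \<delta>_term sm\<delta> summable_mult series(1))
  also have "\<dots> = \<epsilon> * (\<Sum>n. (4 * ?v) ^ n / fact n * R n)"
    by (rule suminf_mult[OF series(1)])
  also have "\<dots> \<le> \<epsilon> * (exp (64 * exp 1 * (?v * b)\<^sup>2) + 1)"
    using series(2) eps(2) by (rule mult_left_mono)
  finally show ?thesis .
qed

end


section \<open>Configuration spaces and the mixing coefficient\<close>

lemma space_config_space: "space (config_space A) = configurations A"
proof -
  have "sets (restrict_space borel A) \<noteq> {}" using sets.empty_sets by blast
  then show ?thesis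
    unfolding config_space_def by (subst space_Sup_eq_UN) auto
qed

lemma measurable_config_spaceI:
  assumes "f \<in> space N \<rightarrow> configurations A"
    and "\<And>B. B \<in> sets (restrict_space borel A) \<Longrightarrow> (\<lambda>x. emeasure (f x) B) \<in> borel_measurable N"
  shows "f \<in> N \<rightarrow>\<^sub>M config_space A"
  unfolding config_space_def
proof (rule measurable_SUP2)
  show "sets (restrict_space borel A) \<noteq> {}" using sets.empty_sets by blast
  fix B assume "B \<in> sets (restrict_space borel A)"
  then show "f \<in> N \<rightarrow>\<^sub>M vimage_algebra (configurations A) (\<lambda>\<xi>. emeasure \<xi> B) borel"
    using assms by (intro measurable_vimage_algebra2) auto
qed simp

lemma measurable_emeasure_config_space:
  assumes "B \<in> sets (restrict_space borel A)"
  shows "(\<lambda>\<xi>. emeasure \<xi> B) \<in> borel_measurable (config_space A)"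
  unfolding config_space_def
  using assms by (rule measurable_SUP1) (auto intro: measurable_vimage_algebra1)

lemma sets_restrict_borel_iff:
  fixes A :: "'a::topological_space set"
  assumes "A \<in> sets borel"
  shows "B \<in> sets (restrict_space borel A) \<longleftrightarrow> B \<in> sets borel \<and> B \<subseteq> A"
  using assms by (subst sets_restrict_space_iff) auto

lemma emeasure_restrict_configuration:
  assumes "\<xi> \<in> configurations UNIV" "A \<in> sets borel" "B \<subseteq> A"
  shows "emeasure (restrict_space \<xi> A) B = emeasure \<xi> B"
proof (rule emeasure_restrict_space)
  have s: "sets \<xi> = sets borel" using assms by (simp add: configurations_def)
  then have "space \<xi> = UNIV" using sets_eq_imp_space_eq[OF s] by simp
  then show "A \<inter> space \<xi> \<in> sets \<xi>" using assms s by simp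
qed (rule assms)

lemma restrict_space_measurable_config:
  assumes X: "X \<in> M \<rightarrow>\<^sub>M config_space UNIV" and A: "A \<in> sets borel"
  shows "(\<lambda>\<omega>. restrict_space (X \<omega>) A) \<in> M \<rightarrow>\<^sub>M config_space A"
proof (rule measurable_config_spaceI)
  have conf: "X \<omega> \<in> configurations UNIV" if "\<omega> \<in> space M" for \<omega>
    using measurable_space[OF X that] by (simp add: space_config_space)
  show "(\<lambda>\<omega>. restrict_space (X \<omega>) A) \<in> space M \<rightarrow> configurations A"
  proof
    fix \<omega> assume "\<omega> \<in> space M"
    note c = conf[OF this]
    have "sets (restrict_space (X \<omega>) A) = sets (restrict_space borel A)"
      using c by (intro sets_restrict_space_cong) (simp add: configurations_def)
    moreover have "emeasure (restrict_space (X \<omega>) A) B \<in> range of_nat"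
      if "B \<in> sets (restrict_space borel A)" "bounded B" for B
      using that c sets_restrict_borel_iff[OF A, of B]
      by (simp add: emeasure_restrict_configuration[OF c A] configurations_def)
    ultimately show "restrict_space (X \<omega>) A \<in> configurations A"
      by (simp add: configurations_def)
  qed
  fix B assume "B \<in> sets (restrict_space borel A)"
  then have B: "B \<in> sets borel" "B \<subseteq> A" using sets_restrict_borel_iff[OF A] by auto
  have "(\<lambda>\<omega>. emeasure (X \<omega>) B) \<in> borel_measurable M"
    using B by (intro measurable_compose[OF X measurable_emeasure_config_space]) simp
  then show "(\<lambda>\<omega>. emeasure (restrict_space (X \<omega>) A) B) \<in> borel_measurable M"
    by (rule measurable_cong[THEN iffD1, rotated])
       (simp add: emeasure_restrict_configuration[OF conf A B(2)])
qed

definition counting_config :: "'a::euclidean_space set \<Rightarrow> 'a set \<Rightarrow> 'a measure" where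
  "counting_config A X = distr (count_space (X \<inter> A)) (restrict_space borel A) id"

lemma emeasure_counting_config:
  assumes "finite X" and A: "A \<in> sets borel" and D: "D \<in> sets borel" "D \<subseteq> A"
  shows "emeasure (counting_config A X) D = of_nat (card (X \<inter> D))"
proof -
  have "emeasure (counting_config A X) D = emeasure (count_space (X \<inter> A)) (id -` D \<inter> space (count_space (X \<inter> A)))"
    unfolding counting_config_def using A D
    by (intro emeasure_distr) (auto simp: sets_restrict_borel_iff)
  also have "id -` D \<inter> space (count_space (X \<inter> A)) = X \<inter> D" using D by auto
  finally show ?thesis using assms by (subst (asm) emeasure_count_space_finite) auto
qed

lemma counting_config_in_configurations:
  assumes "finite X" "A \<in> sets borel"
  shows "counting_config A X \<in> configurations A"
  using assms emeasure_counting_config[OF assms] sets_restrict_borel_iff[OF assms(2)]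
  by (simp add: configurations_def) (simp add: counting_config_def)

lemma counting_config_measurable:
  assumes Z: "random_finite_set M W Z" and A: "A \<in> sets borel"
  shows "(\<lambda>\<omega>. counting_config A (Z \<omega>)) \<in> M \<rightarrow>\<^sub>M config_space A"
proof (rule measurable_config_spaceI)
  have fin: "finite (Z \<omega>)" if "\<omega> \<in> space M" for \<omega> using Z that by (auto simp: random_finite_set_def)
  show "(\<lambda>\<omega>. counting_config A (Z \<omega>)) \<in> space M \<rightarrow> configurations A"
    using fin A by (auto intro: counting_config_in_configurations)
  fix B assume "B \<in> sets (restrict_space borel A)"
  then have B: "B \<in> sets borel" "B \<subseteq> A" using sets_restrict_borel_iff[OF A] by auto
  have "(\<lambda>\<omega>. of_nat (card (Z \<omega> \<inter> B)) :: ennreal) \<in> borel_measurable M"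
    using borel_measurable_prod_card(2)[OF Z, of "{B}"] B by simp
  then show "(\<lambda>\<omega>. emeasure (counting_config A (Z \<omega>)) B) \<in> borel_measurable M"
    by (rule measurable_cong[THEN iffD1, rotated]) (simp add: emeasure_counting_config[OF fin A B])
qed

text \<open>
  The events determined by the counts of finitely many Borel sets. Measurability is required
  separately, and arbitrary dependence on the counts is allowed, so that the algebra operations
  need no analysis of the shape of an event.
\<close>

definition finite_count_events ::
  "'a::euclidean_space set \<Rightarrow> 'a set \<Rightarrow> ('a measure \<times> 'a measure) set set" where
  "finite_count_events A B = {E \<in> sets (config_space A \<Otimes>\<^sub>M config_space B).
     \<exists>\<F>. finite \<F> \<and> \<F> \<subseteq> sets borel \<and>
       (\<forall>p\<in>configurations A \<times> configurations B. \<forall>q\<in>configurations A \<times> configurations B.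
         (\<forall>F\<in>\<F>. emeasure (fst p) (F \<inter> A) = emeasure (fst q) (F \<inter> A) \<and>
           emeasure (snd p) (F \<inter> B) = emeasure (snd q) (F \<inter> B)) \<longrightarrow> p \<in> E \<longrightarrow> q \<in> E)}"

lemma algebra_finite_count_events:
  "Sigma_Algebra.algebra (configurations A \<times> configurations B) (finite_count_events A B)"
  unfolding algebra_iff_Un
proof (intro conjI ballI)
  let ?N = "config_space A \<Otimes>\<^sub>M config_space B" and ?\<Omega> = "configurations A \<times> configurations B"
  have sp: "space ?N = ?\<Omega>" by (simp add: space_pair_measure space_config_space)
  show "finite_count_events A B \<subseteq> Pow ?\<Omega>"
    using sets.sets_into_space[of _ ?N] sp by (auto simp: finite_count_events_def)
  show "{} \<in> finite_count_events A B"
    by (auto simp: finite_count_events_def intro!: exI[of _ "{}"])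
  fix E assume "E \<in> finite_count_events A B"
  then obtain \<F> where E: "E \<in> sets ?N" and \<F>: "finite \<F>" "\<F> \<subseteq> sets borel"
    and det: "\<And>p q. p \<in> ?\<Omega> \<Longrightarrow> q \<in> ?\<Omega> \<Longrightarrow> (\<forall>F\<in>\<F>. emeasure (fst p) (F \<inter> A) = emeasure (fst q) (F \<inter> A) \<and>
           emeasure (snd p) (F \<inter> B) = emeasure (snd q) (F \<inter> B)) \<Longrightarrow> p \<in> E \<Longrightarrow> q \<in> E"
    unfolding finite_count_events_def by blast
  show "?\<Omega> - E \<in> finite_count_events A B"
    unfolding finite_count_events_def
  proof (intro CollectI conjI exI[of _ \<F>] \<F> ballI impI)
    show "?\<Omega> - E \<in> sets ?N" using sets.compl_sets[OF E] sp by simp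
    fix p q
    assume pq: "p \<in> ?\<Omega>" "q \<in> ?\<Omega>"
      and eq: "\<forall>F\<in>\<F>. emeasure (fst p) (F \<inter> A) = emeasure (fst q) (F \<inter> A) \<and>
           emeasure (snd p) (F \<inter> B) = emeasure (snd q) (F \<inter> B)" and "p \<in> ?\<Omega> - E"
    have "q \<notin> E"
    proof
      assume "q \<in> E"
      then have "p \<in> E" by (intro det[OF pq(2,1)]) (use eq in auto)
      then show False using \<open>p \<in> ?\<Omega> - E\<close> by simp
    qed
    then show "q \<in> ?\<Omega> - E" using pq by simp
  qed
  fix E' assume "E' \<in> finite_count_events A B"
  then obtain \<F>' where E': "E' \<in> sets ?N" and \<F>': "finite \<F>'" "\<F>' \<subseteq> sets borel"
    and det': "\<And>p q. p \<in> ?\<Omega> \<Longrightarrow> q \<in> ?\<Omega> \<Longrightarrow> (\<forall>F\<in>\<F>'. emeasure (fst p) (F \<inter> A) = emeasure (fst q) (F \<inter> A) \<and>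
           emeasure (snd p) (F \<inter> B) = emeasure (snd q) (F \<inter> B)) \<Longrightarrow> p \<in> E' \<Longrightarrow> q \<in> E'"
    unfolding finite_count_events_def by blast
  show "E \<union> E' \<in> finite_count_events A B"
    unfolding finite_count_events_def
  proof (intro CollectI conjI exI[of _ "\<F> \<union> \<F>'"] ballI impI)
    show "E \<union> E' \<in> sets ?N" using E E' by simp
    show "finite (\<F> \<union> \<F>')" "\<F> \<union> \<F>' \<subseteq> sets borel" using \<F> \<F>' by auto
    fix p q
    assume pq: "p \<in> ?\<Omega>" "q \<in> ?\<Omega>"
      and eq: "\<forall>F\<in>\<F> \<union> \<F>'. emeasure (fst p) (F \<inter> A) = emeasure (fst q) (F \<inter> A) \<and>
           emeasure (snd p) (F \<inter> B) = emeasure (snd q) (F \<inter> B)" and "p \<in> E \<union> E'"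
    from this(4) show "q \<in> E \<union> E'"
    proof
      assume "p \<in> E"
      then have "q \<in> E" by (intro det[OF pq]) (use eq in auto)
      then show ?thesis ..
    next
      assume "p \<in> E'"
      then have "q \<in> E'" by (intro det'[OF pq]) (use eq in auto)
      then show ?thesis ..
    qed
  qed
qed

text \<open>
  With respect to the generated \<open>\<sigma>\<close>-algebra all counts in either component are measurable, hence so
  is the identity into the product of the configuration spaces.
\<close>

lemma sets_config_pair_eq_sigma_sets:
  assumes A: "A \<in> sets borel" and B: "B \<in> sets borel"
  shows "sets (config_space A \<Otimes>\<^sub>M config_space B) = sigma_sets (configurations A \<times> configurations B) (finite_count_events A B)"
proof
  let ?N = "config_space A \<Otimes>\<^sub>M config_space B" and ?\<Omega> = "configurations A \<times> configurations B"
  let ?S = "sigma ?\<Omega> (finite_count_events A B)"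
  have sp: "space ?N = ?\<Omega>" by (simp add: space_pair_measure space_config_space)
  show "sigma_sets ?\<Omega> (finite_count_events A B) \<subseteq> sets ?N"
    unfolding sp[symmetric] by (rule sets.sigma_sets_subset) (auto simp: finite_count_events_def)
  have sub: "finite_count_events A B \<subseteq> Pow ?\<Omega>"
    using sets.sets_into_space[of _ ?N] sp by (auto simp: finite_count_events_def)
  have S: "space ?S = ?\<Omega>" "sets ?S = sigma_sets ?\<Omega> (finite_count_events A B)"
    using sub by (simp_all add: space_measure_of sets_measure_of)
  have "fst \<in> ?S \<rightarrow>\<^sub>M config_space A"
  proof (rule measurable_config_spaceI)
    fix D assume D: "D \<in> sets (restrict_space borel A)"
    then have DA: "D \<in> sets borel" "D \<inter> A = D" using sets_restrict_borel_iff[OF A] by auto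
    have m: "(\<lambda>p. emeasure (fst p) D) \<in> borel_measurable ?N"
      by (rule measurable_compose[OF measurable_fst measurable_emeasure_config_space[OF D]])
    show "(\<lambda>p. emeasure (fst p) D) \<in> borel_measurable ?S"
    proof (rule measurableI)
      fix Y :: "ennreal set" assume Y: "Y \<in> sets borel"
      have "(\<lambda>p. emeasure (fst p) D) -` Y \<inter> ?\<Omega> \<in> finite_count_events A B"
        unfolding finite_count_events_def
        using measurable_sets[OF m Y] DA sp by (auto intro!: exI[of _ "{D}"])
      then show "(\<lambda>p. emeasure (fst p) D) -` Y \<inter> space ?S \<in> sets ?S"
        unfolding S by blast
    qed simp
  qed (auto simp: S)
  moreover have "snd \<in> ?S \<rightarrow>\<^sub>M config_space B"
  proof (rule measurable_config_spaceI)
    fix D assume D: "D \<in> sets (restrict_space borel B)"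
    then have DB: "D \<in> sets borel" "D \<inter> B = D" using sets_restrict_borel_iff[OF B] by auto
    have m: "(\<lambda>p. emeasure (snd p) D) \<in> borel_measurable ?N"
      by (rule measurable_compose[OF measurable_snd measurable_emeasure_config_space[OF D]])
    show "(\<lambda>p. emeasure (snd p) D) \<in> borel_measurable ?S"
    proof (rule measurableI)
      fix Y :: "ennreal set" assume Y: "Y \<in> sets borel"
      have "(\<lambda>p. emeasure (snd p) D) -` Y \<inter> ?\<Omega> \<in> finite_count_events A B"
        unfolding finite_count_events_def
        using measurable_sets[OF m Y] DB sp by (auto intro!: exI[of _ "{D}"])
      then show "(\<lambda>p. emeasure (snd p) D) -` Y \<inter> space ?S \<in> sets ?S"
        unfolding S by blast
    qed simp
  qed (auto simp: S)
  ultimately have id: "(\<lambda>p. (fst p, snd p)) \<in> ?S \<rightarrow>\<^sub>M ?N" by (rule measurable_Pair)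
  show "sets ?N \<subseteq> sigma_sets ?\<Omega> (finite_count_events A B)"
  proof
    fix E assume E: "E \<in> sets ?N"
    have "(\<lambda>p. (fst p, snd p)) -` E \<inter> space ?S \<in> sets ?S" by (rule measurable_sets[OF id E])
    moreover have "(\<lambda>p. (fst p, snd p)) -` E \<inter> space ?S = E"
      using sets.sets_into_space[OF E] sp S by auto
    ultimately show "E \<in> sigma_sets ?\<Omega> (finite_count_events A B)" unfolding S by simp
  qed
qed

text \<open>
  Up to null sets, \<open>\<Xi>\<close> restricted to \<open>A\<close> or \<open>B\<close> is the counting measure of \<open>Z\<close> there. Hence the joint
  law and the product of the laws are the images of \<open>Z\<close> and of its superposition under the same map,
  and events in \<open>finite_count_events\<close> are handled by \<open>superposition_difference\<close>.
\<close>

theorem (in bounded_determinantal_window) beta_mixing_le: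
  assumes \<Xi>: "\<Xi> \<in> M \<rightarrow>\<^sub>M config_space UNIV"
    and AE_Z: "AE \<omega> in M. \<forall>D\<in>sets borel. D \<subseteq> W \<longrightarrow> emeasure (\<Xi> \<omega>) D = of_nat (card (Z \<omega> \<inter> D))"
    and A: "A \<in> sets borel" and B: "B \<in> sets borel" and AB: "W = A \<union> B" "A \<inter> B = {}"
    and eps: "\<And>x y. x \<in> A \<Longrightarrow> y \<in> B \<Longrightarrow> cmod (K x y) \<le> \<epsilon>" "0 \<le> \<epsilon>"
  shows "beta_mixing M \<Xi> A B \<le> \<epsilon> * (exp (64 * exp 1 * (measure lborel W * b)\<^sup>2) + 1)"
proof -
  let ?d = "\<epsilon> * (exp (64 * exp 1 * (measure lborel W * b)\<^sup>2) + 1)"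
  let ?N = "config_space A \<Otimes>\<^sub>M config_space B" and ?\<Omega> = "configurations A \<times> configurations B"
  interpret M: prob_space M by (rule prob_M)
  interpret P: pair_prob_space M M ..
  let ?r = "\<lambda>C \<omega>. restrict_space (\<Xi> \<omega>) C" and ?c = "\<lambda>C \<omega>. counting_config C (Z \<omega>)"
  have conf: "\<Xi> \<omega> \<in> configurations UNIV" if "\<omega> \<in> space M" for \<omega>
    using measurable_space[OF \<Xi> that] by (simp add: space_config_space)
  have r_meas: "?r C \<in> M \<rightarrow>\<^sub>M config_space C" if "C \<in> sets borel" for C
    by (rule restrict_space_measurable_config[OF \<Xi> that])
  have c_meas: "?c C \<in> M \<rightarrow>\<^sub>M config_space C" if "C \<in> sets borel" for C
    by (rule counting_config_measurable[OF Z that])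
  have r_eq: "AE \<omega> in M. ?r C \<omega> = ?c C \<omega>" if C: "C \<in> sets borel" "C \<subseteq> W" for C
    using AE_Z AE_space
  proof eventually_elim
    case (elim \<omega>)
    note c = conf[OF elim(2)]
    show ?case
    proof (rule measure_eqI)
      have "sets (?r C \<omega>) = sets (restrict_space borel C)"
        using c by (intro sets_restrict_space_cong) (simp add: configurations_def)
      then show s: "sets (?r C \<omega>) = sets (?c C \<omega>)" by (simp add: counting_config_def)
      fix D assume "D \<in> sets (?r C \<omega>)"
      then have "D \<in> sets (restrict_space borel C)" unfolding s by (simp add: counting_config_def)
      then have D: "D \<in> sets borel" "D \<subseteq> C" using sets_restrict_borel_iff[OF C(1)] by auto
      then show "emeasure (?r C \<omega>) D = emeasure (?c C \<omega>) D"
        using elim(1) C finite_Z[OF elim(2)]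
        by (simp add: emeasure_restrict_configuration[OF c C(1)] emeasure_counting_config)
    qed
  qed
  have AW: "A \<subseteq> W" "B \<subseteq> W" using AB by auto
  define \<mu> where "\<mu> = distr M ?N (\<lambda>\<omega>. (?c A \<omega>, ?c B \<omega>))"
  define \<nu> where "\<nu> = distr (M \<Otimes>\<^sub>M M) ?N (\<lambda>p. (counting_config A (superposed A p), counting_config B (superposed A p)))"
  note sup = random_finite_set_superposed[OF A]
  have mu_meas: "(\<lambda>\<omega>. (?c A \<omega>, ?c B \<omega>)) \<in> M \<rightarrow>\<^sub>M ?N"
    by (intro measurable_Pair c_meas A B)
  have nu_meas: "(\<lambda>p. (counting_config A (superposed A p), counting_config B (superposed A p))) \<in> M \<Otimes>\<^sub>M M \<rightarrow>\<^sub>M ?N"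
    by (intro measurable_Pair counting_config_measurable[OF sup] A B)
  have mu_eq: "distr M ?N (\<lambda>\<omega>. (?r A \<omega>, ?r B \<omega>)) = \<mu>"
    unfolding \<mu>_def
  proof (rule distr_cong_AE)
    show "AE \<omega> in M. (?r A \<omega>, ?r B \<omega>) = (?c A \<omega>, ?c B \<omega>)"
      using r_eq[OF A AW(1)] r_eq[OF B AW(2)] by eventually_elim simp
  qed (use mu_meas in \<open>auto intro!: measurable_Pair r_meas A B\<close>)
  have nu_eq: "distr M (config_space A) (?r A) \<Otimes>\<^sub>M distr M (config_space B) (?r B) = \<nu>"
  proof -
    have 1: "distr M (config_space A) (?r A) = distr M (config_space A) (?c A)"
      by (intro distr_cong_AE r_eq r_meas c_meas A AW refl)
    have 2: "distr M (config_space B) (?r B) = distr M (config_space B) (?c B)"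
      by (intro distr_cong_AE r_eq r_meas c_meas B AW refl)
    interpret D: prob_space "distr M (config_space B) (?c B)"
      by (rule M.prob_space_distr[OF c_meas[OF B]])
    have "distr M (config_space A) (?c A) \<Otimes>\<^sub>M distr M (config_space B) (?c B) =
        distr (M \<Otimes>\<^sub>M M) ?N (\<lambda>(x, y). (?c A x, ?c B y))"
      by (intro pair_measure_distr c_meas A B D.sigma_finite_measure_axioms)
    also have "\<dots> = \<nu>"
      unfolding \<nu>_def
    proof (rule distr_cong)
      fix p
      have "superposed A p \<inter> A = Z (fst p) \<inter> A" "superposed A p \<inter> B = Z (snd p) \<inter> B"
        using AB(2) by (auto simp: superposed_def split: prod.splits)
      then show "(case p of (x, y) \<Rightarrow> (?c A x, ?c B y)) =
          (counting_config A (superposed A p), counting_config B (superposed A p))"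
        by (simp add: counting_config_def split: prod.splits)
    qed simp_all
    finally show ?thesis unfolding 1 2 .
  qed
  have fin: "finite_measure \<mu>" "finite_measure \<nu>"
    unfolding \<mu>_def \<nu>_def using M.prob_space_distr[OF mu_meas] P.prob_space_distr[OF nu_meas]
    by (simp_all add: prob_space_def)
  have sets: "sets \<mu> = sigma_sets ?\<Omega> (finite_count_events A B)" "sets \<nu> = sigma_sets ?\<Omega> (finite_count_events A B)"
    by (simp_all add: \<mu>_def \<nu>_def sets_config_pair_eq_sigma_sets[OF A B])
  have on_algebra: "\<bar>measure \<mu> E - measure \<nu> E\<bar> \<le> ?d" if "E \<in> finite_count_events A B" for E
  proof -
    obtain \<F> where E: "E \<in> sets ?N" and \<F>: "finite \<F>" "\<F> \<subseteq> sets borel"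
      and det: "\<And>p q. p \<in> ?\<Omega> \<Longrightarrow> q \<in> ?\<Omega> \<Longrightarrow> (\<forall>F\<in>\<F>. emeasure (fst p) (F \<inter> A) = emeasure (fst q) (F \<inter> A) \<and>
           emeasure (snd p) (F \<inter> B) = emeasure (snd q) (F \<inter> B)) \<Longrightarrow> p \<in> E \<Longrightarrow> q \<in> E"
      using \<open>E \<in> finite_count_events A B\<close> unfolding finite_count_events_def by blast
    define E' where "E' = {X. (counting_config A X, counting_config B X) \<in> E}"
    have m1: "measure \<mu> E = measure M {\<omega>\<in>space M. Z \<omega> \<in> E'}"
      unfolding \<mu>_def measure_distr[OF mu_meas E]
      by (rule arg_cong[where f = "measure M"]) (auto simp: E'_def)
    have m2: "measure \<nu> E = measure (M \<Otimes>\<^sub>M M) {p\<in>space (M \<Otimes>\<^sub>M M). superposed A p \<in> E'}"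
      unfolding \<nu>_def measure_distr[OF nu_meas E]
      by (rule arg_cong[where f = "measure (M \<Otimes>\<^sub>M M)"]) (auto simp: E'_def)
    have s1: "{\<omega>\<in>space M. Z \<omega> \<in> E'} \<in> sets M"
      using measurable_sets[OF mu_meas E] by (simp add: E'_def vimage_def Int_def conj_commute)
    have s2: "{p\<in>space (M \<Otimes>\<^sub>M M). superposed A p \<in> E'} \<in> sets (M \<Otimes>\<^sub>M M)"
      using measurable_sets[OF nu_meas E] by (simp add: E'_def vimage_def Int_def conj_commute)
    show ?thesis
      unfolding m1 m2
    proof (rule superposition_difference[OF A _ eps(2) _ _ _ s1 s2])
      show "cmod (K x y) \<le> \<epsilon>" if "x \<in> W \<inter> A" "y \<in> W - A" for x y
        using that AB eps(1) by auto
      let ?\<F> = "(\<lambda>F. F \<inter> A) ` \<F> \<union> (\<lambda>F. F \<inter> B) ` \<F>"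
      show "finite ?\<F>" "?\<F> \<subseteq> sets borel" using \<F> A B by auto
      fix X Y :: "'a set" assume fin: "finite X" "finite Y" and "X \<in> E'"
        and eq: "\<And>F. F \<in> ?\<F> \<Longrightarrow> card (X \<inter> F) = card (Y \<inter> F)"
      have "(counting_config A Y, counting_config B Y) \<in> E"
      proof (rule det[of "(counting_config A X, counting_config B X)"])
        have "emeasure (counting_config C X) (F \<inter> C) = emeasure (counting_config C Y) (F \<inter> C)"
          if "F \<in> \<F>" "C \<in> {A, B}" for F C
        proof -
          have "C \<in> sets borel" "F \<inter> C \<in> sets borel" using that \<F> A B by auto
          moreover have "card (X \<inter> (F \<inter> C)) = card (Y \<inter> (F \<inter> C))" using that by (intro eq) auto
          ultimately show ?thesis using fin by (simp add: emeasure_counting_config)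
        qed
        then show "\<forall>F\<in>\<F>. emeasure (fst (counting_config A X, counting_config B X)) (F \<inter> A) =
            emeasure (fst (counting_config A Y, counting_config B Y)) (F \<inter> A) \<and>
           emeasure (snd (counting_config A X, counting_config B X)) (F \<inter> B) =
            emeasure (snd (counting_config A Y, counting_config B Y)) (F \<inter> B)" by simp
        show "(counting_config A X, counting_config B X) \<in> E" using \<open>X \<in> E'\<close> by (simp add: E'_def)
      qed (use fin A B in \<open>auto intro: counting_config_in_configurations\<close>)
      then show "Y \<in> E'" by (simp add: E'_def)
    qed
  qed
  have "\<bar>measure \<mu> E - measure \<nu> E\<bar> \<le> ?d" if "E \<in> sets \<mu>" for E
    by (rule measure_difference_le_from_algebra[OF algebra_finite_count_events fin sets on_algebra that])
  then have "variation_diff \<mu> \<nu> \<le> 2 * ?d"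
    by (intro variation_diff_le fin) (simp_all add: sets)
  then show ?thesis
    unfolding beta_mixing_def mu_eq nu_eq by simp
qed


section \<open>From determinantal point processes to EDD\<close>

text \<open>
  \<open>Z\<close> consists of the atoms of \<open>\<Xi>\<close> in \<open>W\<close>, and is set to \<open>{}\<close> on a measurable null set that contains
  all outcomes with a multiple point; this makes the counts measurable without completing \<open>M\<close>.
\<close>

lemma simple_point_process_as_random_finite_set:
  fixes \<Xi> :: "'w \<Rightarrow> 'a::euclidean_space measure"
  assumes pp: "simple_point_process M \<Xi>" and W: "W \<in> sets borel" "bounded W"
  obtains Z where "random_finite_set M W Z"
    "AE \<omega> in M. \<forall>D\<in>sets borel. D \<subseteq> W \<longrightarrow> emeasure (\<Xi> \<omega>) D = of_nat (card (Z \<omega> \<inter> D))"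
proof -
  have prob: "prob_space M" and \<Xi>: "\<Xi> \<in> M \<rightarrow>\<^sub>M config_space UNIV"
    and simple: "AE \<omega> in M. \<forall>x. emeasure (\<Xi> \<omega>) {x} \<le> 1"
    using pp by (auto simp: simple_point_process_def point_process_def)
  obtain N where N: "{\<omega>\<in>space M. \<not> (\<forall>x. emeasure (\<Xi> \<omega>) {x} \<le> 1)} \<subseteq> N" "emeasure M N = 0" "N \<in> sets M"
    using AE_E[OF simple] by blast
  define Z where "Z \<omega> = (if \<omega> \<in> N then {} else {x\<in>W. emeasure (\<Xi> \<omega>) {x} = 1})" for \<omega>
  have counts: "finite (Z \<omega>) \<and> (\<forall>D\<in>sets borel. D \<subseteq> W \<longrightarrow> emeasure (\<Xi> \<omega>) D = of_nat (card (Z \<omega> \<inter> D)))"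
    if \<omega>: "\<omega> \<in> space M" "\<omega> \<notin> N" for \<omega>
  proof -
    have c: "\<Xi> \<omega> \<in> configurations UNIV"
      using measurable_space[OF \<Xi> \<omega>(1)] by (simp add: space_config_space)
    have s: "sets (\<Xi> \<omega>) = sets borel" using c by (simp add: configurations_def)
    have int: "emeasure (\<Xi> \<omega>) D \<in> range of_nat" if "D \<in> sets borel" "D \<subseteq> W" for D
      using c that bounded_subset[OF W(2)] by (simp add: configurations_def)
    have one: "emeasure (\<Xi> \<omega>) {x} \<le> 1" for x using N(1) \<omega> by blast
    have "Z \<omega> = {x\<in>W. emeasure (\<Xi> \<omega>) {x} = 1}" using \<omega> by (simp add: Z_def)
    then show ?thesis
      using simple_integer_valued_measure_eq_card[OF s W(1) int one] by simp
  qed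
  have "random_finite_set M W Z"
    unfolding random_finite_set_def
  proof (intro conjI ballI)
    show "prob_space M" by (rule prob)
  next
    fix \<omega> assume "\<omega> \<in> space M"
    then show "finite (Z \<omega>)" using counts[of \<omega>] by (cases "\<omega> \<in> N") (auto simp: Z_def)
    show "Z \<omega> \<subseteq> W" by (auto simp: Z_def)
  next
    fix D :: "'a set" assume D: "D \<in> sets borel"
    let ?g = "\<lambda>\<omega>. if \<omega> \<in> N then 0 else emeasure (\<Xi> \<omega>) (D \<inter> W)"
    have "(\<lambda>\<omega>. emeasure (\<Xi> \<omega>) (D \<inter> W)) \<in> borel_measurable M"
      using D W by (intro measurable_compose[OF \<Xi> measurable_emeasure_config_space]) simp
    then have g: "?g \<in> borel_measurable M"
      using N(3) by (intro measurable_If_set) (auto simp: Int_absorb2 sets.sets_into_space)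
    have g_eq: "?g \<omega> = of_nat (card (Z \<omega> \<inter> D))" if "\<omega> \<in> space M" for \<omega>
    proof (cases "\<omega> \<in> N")
      case False
      have "Z \<omega> \<inter> (D \<inter> W) = Z \<omega> \<inter> D" by (auto simp: Z_def)
      moreover have "emeasure (\<Xi> \<omega>) (D \<inter> W) = of_nat (card (Z \<omega> \<inter> (D \<inter> W)))"
        using counts[OF that False, THEN conjunct2, rule_format, of "D \<inter> W"] D W by simp
      ultimately show ?thesis using False by simp
    qed (simp add: Z_def)
    show "(\<lambda>\<omega>. card (Z \<omega> \<inter> D)) \<in> M \<rightarrow>\<^sub>M count_space UNIV"
    proof (subst measurable_count_space_eq2_countable, intro conjI ballI)
      fix k :: nat
      have "(\<lambda>\<omega>. card (Z \<omega> \<inter> D)) -` {k} \<inter> space M = ?g -` {of_nat k} \<inter> space M"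
      proof (rule Set.set_eqI)
        fix \<omega>
        show "\<omega> \<in> (\<lambda>\<omega>. card (Z \<omega> \<inter> D)) -` {k} \<inter> space M \<longleftrightarrow> \<omega> \<in> ?g -` {of_nat k} \<inter> space M"
        proof (cases "\<omega> \<in> space M")
          case True
          have "?g \<omega> = of_nat k \<longleftrightarrow> card (Z \<omega> \<inter> D) = k" unfolding g_eq[OF True] by simp
          then show ?thesis using True by blast
        qed simp
      qed
      also have "\<dots> \<in> sets M" using g by (rule measurable_sets) simp
      finally show "(\<lambda>\<omega>. card (Z \<omega> \<inter> D)) -` {k} \<inter> space M \<in> sets M" .
    qed auto
  qed
  moreover have "AE \<omega> in M. \<omega> \<notin> N"
    using N by (intro AE_not_in) (simp add: null_sets_def)
  then have "AE \<omega> in M. \<forall>D\<in>sets borel. D \<subseteq> W \<longrightarrow> emeasure (\<Xi> \<omega>) D = of_nat (card (Z \<omega> \<inter> D))"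
    using AE_space by eventually_elim (use counts in blast)
  ultimately show thesis by (rule that)
qed

lemma determinantal_window:
  fixes \<Xi> :: "'w \<Rightarrow> 'a::euclidean_space measure"
  assumes det: "determinantal M \<Xi> K" and b: "1 \<le> b" "\<And>x y. cmod (K x y) \<le> b"
    and W: "W \<in> sets borel" "bounded W"
  obtains Z \<rho> where "bounded_determinantal_window M W Z \<rho> K b"
    "AE \<omega> in M. \<forall>D\<in>sets borel. D \<subseteq> W \<longrightarrow> emeasure (\<Xi> \<omega>) D = of_nat (card (Z \<omega> \<inter> D))"
proof -
  have pp: "simple_point_process M \<Xi>" using det by (simp add: determinantal_def)
  obtain \<rho> where ji: "\<And>n. joint_intensity M \<Xi> n (\<rho> n)"
    and \<rho>: "\<And>n x. x \<in> {..<n} \<rightarrow>\<^sub>E UNIV \<Longrightarrow>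
           complex_of_real (\<rho> n x) = Determinant.det (Matrix.mat n n (\<lambda>(i, j). K (x i) (x j)))"
    using det unfolding determinantal_def by blast
  obtain Z where Z: "random_finite_set M W Z"
    and AE_Z: "AE \<omega> in M. \<forall>D\<in>sets borel. D \<subseteq> W \<longrightarrow> emeasure (\<Xi> \<omega>) D = of_nat (card (Z \<omega> \<inter> D))"
    using simple_point_process_as_random_finite_set[OF pp W] by blast
  have "bounded_determinantal_window M W Z \<rho> K b"
  proof
    show "random_finite_set M W Z" by (rule Z)
    show "emeasure lborel W < \<infinity>" using W by (intro emeasure_bounded_finite)
    show "\<rho> n \<in> borel_measurable (\<Pi>\<^sub>M i\<in>{..<n}. lborel)" for n
      using ji[of n] by (simp add: joint_intensity_def)
    show "0 \<le> \<rho> n x" if "x \<in> {..<n} \<rightarrow>\<^sub>E UNIV" for n x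
      using ji[of n] that by (simp add: joint_intensity_def)
    fix n and D :: "nat \<Rightarrow> 'a set"
    assume D: "\<And>i. i < n \<Longrightarrow> D i \<in> sets borel" "\<And>i. i < n \<Longrightarrow> D i \<subseteq> W" "disjoint_family_on D {..<n}"
    have "(\<integral>\<^sup>+\<omega>. (\<Prod>i<n. of_nat (card (Z \<omega> \<inter> D i))) \<partial>M) = (\<integral>\<^sup>+\<omega>. (\<Prod>i<n. emeasure (\<Xi> \<omega>) (D i)) \<partial>M)"
    proof (rule nn_integral_cong_AE)
      show "AE \<omega> in M. (\<Prod>i<n. of_nat (card (Z \<omega> \<inter> D i))) = (\<Prod>i<n. emeasure (\<Xi> \<omega>) (D i))"
        using AE_Z by eventually_elim (use D in \<open>auto intro!: prod.cong\<close>)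
    qed
    also have "\<dots> = (\<integral>\<^sup>+x\<in>Pi\<^sub>E {..<n} D. ennreal (\<rho> n x) \<partial>(\<Pi>\<^sub>M i\<in>{..<n}. lborel))"
      using ji[of n] D unfolding joint_intensity_def by blast
    finally show "(\<integral>\<^sup>+\<omega>. (\<Prod>i<n. of_nat (card (Z \<omega> \<inter> D i))) \<partial>M) =
      (\<integral>\<^sup>+x\<in>Pi\<^sub>E {..<n} D. ennreal (\<rho> n x) \<partial>(\<Pi>\<^sub>M i\<in>{..<n}. lborel))" .
  qed (use W \<rho> b in auto)
  then show thesis using AE_Z by (rule that)
qed

text \<open>
  There is only one configuration on the empty set, and a constant is independent of everything.
\<close>

lemma beta_mixing_empty:
  fixes \<Xi> :: "'w \<Rightarrow> 'a::euclidean_space measure"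
  assumes pp: "point_process M \<Xi>" and A: "A \<in> sets borel" and B: "B \<in> sets borel"
    and empty: "A = {} \<or> B = {}"
  shows "beta_mixing M \<Xi> A B \<le> 0"
proof -
  have "prob_space M" and \<Xi>: "\<Xi> \<in> M \<rightarrow>\<^sub>M config_space UNIV"
    using pp by (auto simp: point_process_def)
  interpret M: prob_space M by fact
  interpret P: pair_prob_space M M ..
  let ?N = "config_space A \<Otimes>\<^sub>M config_space B"
  let ?r = "\<lambda>C \<omega>. restrict_space (\<Xi> \<omega>) C"
  have r_meas: "?r C \<in> M \<rightarrow>\<^sub>M config_space C" if "C \<in> sets borel" for C
    by (rule restrict_space_measurable_config[OF \<Xi> that])
  have const: "?r {} \<omega> = ?r {} \<omega>'" if "\<omega> \<in> space M" "\<omega>' \<in> space M" for \<omega> \<omega>'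
  proof (rule measure_eqI)
    have s: "sets (?r {} \<omega>) = {{}}" for \<omega> by (auto simp: sets_restrict_space)
    then show "sets (?r {} \<omega>) = sets (?r {} \<omega>')" by simp
    fix D assume "D \<in> sets (?r {} \<omega>)"
    then show "emeasure (?r {} \<omega>) D = emeasure (?r {} \<omega>') D" unfolding s by simp
  qed
  let ?g = "\<lambda>\<omega>. (?r A \<omega>, ?r B \<omega>)"
  have g: "?g \<in> M \<rightarrow>\<^sub>M ?N" by (intro measurable_Pair r_meas A B)
  have h: "(\<lambda>(x, y). (?r A x, ?r B y)) \<in> M \<Otimes>\<^sub>M M \<rightarrow>\<^sub>M ?N"
    unfolding case_prod_beta
    by (intro measurable_Pair measurable_compose[OF measurable_fst r_meas[OF A]]
        measurable_compose[OF measurable_snd r_meas[OF B]])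
  interpret D: prob_space "distr M (config_space B) (?r B)"
    by (rule M.prob_space_distr[OF r_meas[OF B]])
  have nu: "distr M (config_space A) (?r A) \<Otimes>\<^sub>M distr M (config_space B) (?r B) =
      distr (M \<Otimes>\<^sub>M M) ?N (\<lambda>(x, y). (?r A x, ?r B y))"
    by (intro pair_measure_distr r_meas A B D.sigma_finite_measure_axioms)
  have eq: "measure (distr M ?N ?g) E = measure (distr (M \<Otimes>\<^sub>M M) ?N (\<lambda>(x, y). (?r A x, ?r B y))) E"
    if E: "E \<in> sets ?N" for E
  proof -
    let ?S = "?g -` E \<inter> space M"
    have S: "?S \<in> sets M" by (rule measurable_sets[OF g E])
    let ?S2 = "(\<lambda>(x, y). (?r A x, ?r B y)) -` E \<inter> space (M \<Otimes>\<^sub>M M)"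
    from empty have "emeasure (M \<Otimes>\<^sub>M M) ?S2 = emeasure M ?S"
    proof
      assume e: "A = {}"
      have "p \<in> ?S2 \<longleftrightarrow> p \<in> space M \<times> ?S" for p
      proof (cases "fst p \<in> space M \<and> snd p \<in> space M")
        case True
        then have "?r A (fst p) = ?r A (snd p)" unfolding e by (intro const) auto
        then show ?thesis using True by (cases p) (simp add: space_pair_measure)
      qed (cases p, auto simp: space_pair_measure)
      then have "?S2 = space M \<times> ?S" by (rule Set.set_eqI)
      then show ?thesis using S by (simp only: M.emeasure_pair_measure_Times sets.top M.emeasure_space_1 mult_1)
    next
      assume e: "B = {}"
      have "p \<in> ?S2 \<longleftrightarrow> p \<in> ?S \<times> space M" for p
      proof (cases "fst p \<in> space M \<and> snd p \<in> space M")
        case True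
        then have "?r B (snd p) = ?r B (fst p)" unfolding e by (intro const) auto
        then show ?thesis using True by (cases p) (simp add: space_pair_measure)
      qed (cases p, auto simp: space_pair_measure)
      then have "?S2 = ?S \<times> space M" by (rule Set.set_eqI)
      then show ?thesis using S by (simp only: M.emeasure_pair_measure_Times sets.top M.emeasure_space_1 mult_1_right)
    qed
    then show ?thesis
      unfolding measure_distr[OF g E] measure_distr[OF h E] by (simp add: measure_def)
  qed
  have "variation_diff (distr M ?N ?g) (distr (M \<Otimes>\<^sub>M M) ?N (\<lambda>(x, y). (?r A x, ?r B y))) \<le> 2 * 0"
    using M.prob_space_distr[OF g] P.prob_space_distr[OF h]
    by (intro variation_diff_le) (simp_all add: prob_space_def eq)
  then show ?thesis unfolding beta_mixing_def nu by simp
qed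

text \<open>
  With \<open>u = exp (C3 s / 2)\<close> one has \<open>s \<le> 2 u / C3\<close>, so the exponent \<open>L u - C2 u^2 + s\<close> is at most the
  maximum of a quadratic polynomial in \<open>u\<close> with leading coefficient \<open>- C2\<close>.
\<close>

lemma mixing_bound_exponent:
  fixes C2 C3 L s :: real
  assumes "C2 > 0" "C3 > 0" "0 \<le> L" "0 \<le> s"
  shows "exp (- (C2 * exp (C3 * s))) * (exp (L * exp (C3 * s / 2)) + 1)
    \<le> 2 * exp ((L + 2 / C3)\<^sup>2 / (4 * C2)) * exp (- s)"
proof -
  define u where "u = exp (C3 * s / 2)"
  have u2: "exp (C3 * s) = u\<^sup>2" by (simp add: u_def power2_eq_square exp_add[symmetric])
  have "1 \<le> u" using assms by (simp add: u_def)
  have "C3 * s / 2 \<le> u" unfolding u_def using exp_ge_add_one_self[of "C3 * s / 2"] by linarith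
  then have s: "s \<le> 2 / C3 * u" using assms by (simp add: field_simps)
  have "(L + 2 / C3) * u - C2 * u\<^sup>2 \<le> (L + 2 / C3)\<^sup>2 / (4 * C2)"
  proof -
    have "0 \<le> (2 * C2 * u - (L + 2 / C3))\<^sup>2 / (4 * C2)" using assms by simp
    also have "\<dots> = C2 * u\<^sup>2 - (L + 2 / C3) * u + (L + 2 / C3)\<^sup>2 / (4 * C2)"
      using assms by (simp add: power2_diff power2_sum field_simps power2_eq_square)
    finally show ?thesis by simp
  qed
  then have exponent: "L * u - C2 * u\<^sup>2 \<le> (L + 2 / C3)\<^sup>2 / (4 * C2) + - s"
    using s by (simp add: algebra_simps)
  have "exp (- (C2 * u\<^sup>2)) * (exp (L * u) + 1) \<le> exp (- (C2 * u\<^sup>2)) * (2 * exp (L * u))"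
    using assms \<open>1 \<le> u\<close> by (intro mult_left_mono) auto
  also have "\<dots> = 2 * exp (L * u - C2 * u\<^sup>2)" by (simp add: exp_diff exp_minus field_simps)
  also have "\<dots> \<le> 2 * exp ((L + 2 / C3)\<^sup>2 / (4 * C2) + - s)" using exponent by simp
  finally show ?thesis unfolding exp_add u2 u_def[symmetric] by simp
qed

lemma measure_lborel_le_diameter_bound:
  fixes A :: "'a::euclidean_space set"
  assumes "A \<in> sets borel" "\<And>x y. x \<in> A \<Longrightarrow> y \<in> A \<Longrightarrow> norm (x - y) \<le> m" "0 \<le> m"
  shows "measure lborel A \<le> unit_ball_vol (real DIM('a)) * m ^ DIM('a)"
proof (cases "A = {}")
  case False
  then obtain x where "x \<in> A" by auto
  then have "A \<subseteq> cball x m" using assms(2) by (auto simp: dist_norm)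
  then have "measure lborel A \<le> measure lborel (cball x m)"
    using assms(1) emeasure_lborel_cball_finite[of x m] by (intro measure_mono_fmeasurable) (auto simp: fmeasurable_def)
  also have "\<dots> = unit_ball_vol (real DIM('a)) * m ^ DIM('a)"
    using assms(3) by (simp add: content_cball)
  finally show ?thesis .
qed (use assms in simp)

text \<open>
  The volume of \<open>A \<union> B\<close> is at most twice that of a ball of radius \<open>m\<close>, hence at most a constant times
  \<open>exp (C3 s / 4)\<close>; its square enters \<open>beta_mixing_le\<close>.
\<close>

lemma beta_mixing_le_exp:
  fixes \<Xi> :: "'w \<Rightarrow> 'a::euclidean_space measure"
  assumes det: "determinantal M \<Xi> K" and b: "1 \<le> b" "\<And>x y. cmod (K x y) \<le> b"
    and C: "C1 > 0" "C2 > 0" "C3 > 0"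
    and A: "A \<in> sets borel" and B: "B \<in> sets borel"
    and m: "\<And>x y. x \<in> A \<Longrightarrow> y \<in> A \<Longrightarrow> norm (x - y) \<le> m" "\<And>x y. x \<in> B \<Longrightarrow> y \<in> B \<Longrightarrow> norm (x - y) \<le> m"
      "0 \<le> m" "m \<le> exp (C3 * s / (4 * DIM('a)))"
    and s: "\<And>x y. x \<in> A \<Longrightarrow> y \<in> B \<Longrightarrow> s \<le> norm (x - y)" "0 < s"
    and K: "\<And>x y. x \<in> A \<Longrightarrow> y \<in> B \<Longrightarrow> cmod (K x y) \<le> C1 * exp (- (C2 * exp (C3 * norm (x - y))))"
  shows "beta_mixing M \<Xi> A B \<le> 2 * C1 *
    exp ((256 * exp 1 * (unit_ball_vol (real DIM('a)) * b)\<^sup>2 + 2 / C3)\<^sup>2 / (4 * C2)) * exp (- s)"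
proof -
  let ?\<kappa> = "unit_ball_vol (real DIM('a))" and ?u = "exp (C3 * s / 2)"
  let ?\<epsilon> = "C1 * exp (- (C2 * exp (C3 * s)))" and ?v = "measure lborel (A \<union> B)"
  have "bounded A" "bounded B"
    unfolding bounded_two_points dist_norm using m(1,2) by blast+
  then have bounded: "bounded (A \<union> B)" by simp
  have AB: "A \<inter> B = {}" using s by force
  have \<Xi>: "\<Xi> \<in> M \<rightarrow>\<^sub>M config_space UNIV"
    using det by (simp add: determinantal_def simple_point_process_def point_process_def)
  obtain Z \<rho> where Z: "bounded_determinantal_window M (A \<union> B) Z \<rho> K b"
    "AE \<omega> in M. \<forall>D\<in>sets borel. D \<subseteq> A \<union> B \<longrightarrow> emeasure (\<Xi> \<omega>) D = of_nat (card (Z \<omega> \<inter> D))"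
    using determinantal_window[OF det b _ bounded] A B by blast
  have eps: "cmod (K x y) \<le> ?\<epsilon>" if "x \<in> A" "y \<in> B" for x y
  proof -
    have "C1 * exp (- (C2 * exp (C3 * norm (x - y)))) \<le> ?\<epsilon>"
      using C s(1)[OF that] by (intro mult_left_mono) auto
    then show ?thesis using K[OF that] by simp
  qed
  have "beta_mixing M \<Xi> A B \<le> ?\<epsilon> * (exp (64 * exp 1 * (?v * b)\<^sup>2) + 1)"
    using C by (intro bounded_determinantal_window.beta_mixing_le[OF Z(1) \<Xi> Z(2) A B refl AB eps]) auto
  also have "64 * exp 1 * (?v * b)\<^sup>2 \<le> (256 * exp 1 * (?\<kappa> * b)\<^sup>2) * ?u"
  proof -
    have "?v \<le> measure lborel A + measure lborel B" using A B by (intro measure_Un_le) auto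
    also have "\<dots> \<le> 2 * ?\<kappa> * m ^ DIM('a)"
      using measure_lborel_le_diameter_bound[OF A m(1,3)] measure_lborel_le_diameter_bound[OF B m(2,3)] by linarith
    also have "\<dots> \<le> 2 * ?\<kappa> * exp (C3 * s / (4 * DIM('a))) ^ DIM('a)"
      using m(3,4) by (intro mult_left_mono power_mono) auto
    also have "exp (C3 * s / (4 * DIM('a))) ^ DIM('a) = exp (C3 * s / 4)"
      by (simp add: exp_of_nat_mult[symmetric])
    finally have "?v * b \<le> 2 * ?\<kappa> * exp (C3 * s / 4) * b" using b by (intro mult_right_mono) auto
    then have "(?v * b)\<^sup>2 \<le> (2 * ?\<kappa> * exp (C3 * s / 4) * b)\<^sup>2"
      using b by (intro power_mono) auto
    also have "\<dots> = 4 * (?\<kappa> * b)\<^sup>2 * (exp (C3 * s / 4))\<^sup>2" by (simp add: power_mult_distrib)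
    also have "(exp (C3 * s / 4))\<^sup>2 = ?u" by (simp add: power2_eq_square exp_add[symmetric])
    finally show ?thesis by (simp add: mult_ac)
  qed
  also have "?\<epsilon> * (exp ((256 * exp 1 * (?\<kappa> * b)\<^sup>2) * ?u) + 1) =
      C1 * (exp (- (C2 * exp (C3 * s))) * (exp ((256 * exp 1 * (?\<kappa> * b)\<^sup>2) * ?u) + 1))" by simp
  also have "\<dots> \<le> C1 * (2 * exp ((256 * exp 1 * (?\<kappa> * b)\<^sup>2 + 2 / C3)\<^sup>2 / (4 * C2)) * exp (- s))"
    using C s(2) by (intro mult_left_mono mixing_bound_exponent) auto
  finally show ?thesis using C by simp
qed

theorem lemma3p2:
  fixes M :: "'w measure"
    and \<Xi> :: "'w \<Rightarrow> 'a::euclidean_space measure"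
    and K :: "'a \<Rightarrow> 'a \<Rightarrow> complex"
    and C1 C2 C3 C4 :: real
  assumes "determinantal M \<Xi> K"
    and "(SUP (x, y). ennreal (cmod (K x y))) < \<infinity>"
    and "C1 > 0" "C2 > 0" "C3 > 0" "C4 > 0"
    and "\<And>x y. norm (x - y) \<ge> C4 \<Longrightarrow> cmod (K x y) \<le> C1 * exp (- (C2 * exp (C3 * norm (x - y))))"
  shows "EDD M \<Xi>"
proof -
  note C = assms(3-6)
  have pp: "point_process M \<Xi>"
    using assms(1) by (simp add: determinantal_def simple_point_process_def)
  define b where "b = max 1 (enn2real (SUP (x, y). ennreal (cmod (K x y))))"
  have b: "1 \<le> b" "\<And>x y. cmod (K x y) \<le> b"
  proof -
    fix x y
    have "ennreal (cmod (K x y)) \<le> (SUP (x, y). ennreal (cmod (K x y)))"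
      by (rule SUP_upper2[of "(x, y)"]) auto
    also have "\<dots> = ennreal (enn2real (SUP (x, y). ennreal (cmod (K x y))))"
      using assms(2) by (simp add: less_top)
    finally show "cmod (K x y) \<le> b" by (simp add: b_def le_max_iff_disj)
  qed (simp add: b_def)
  define \<theta>1 where "\<theta>1 = 2 * C1 * exp ((256 * exp 1 * (unit_ball_vol (real DIM('a)) * b)\<^sup>2 + 2 / C3)\<^sup>2 / (4 * C2))"
  \<comment> \<open>With this \<open>\<theta>3\<close> a diameter \<open>m\<close> with \<open>\<theta>3 ln m \<le> s\<close> satisfies \<open>m^d \<le> exp (C3 s / 4)\<close>,
    and the choice of \<open>\<theta>4\<close> enforces \<open>s \<ge> C4\<close>, so that the decay of \<open>K\<close> is available.\<close>
  define \<theta>3 where "\<theta>3 = 4 * DIM('a) / C3"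
  define \<theta>4 where "\<theta>4 = exp (C4 / \<theta>3)"
  have pos: "\<theta>1 > 0" "\<theta>3 > 0" "\<theta>4 > 0" using C by (simp_all add: \<theta>1_def \<theta>3_def \<theta>4_def)
  have bound: "ereal (beta_mixing M \<Xi> A B) \<le>
      ereal \<theta>1 * max (ereal_powr (ediam A) 0) 1 * max (ereal_powr (ediam B) 0) 1 * ereal_exp (- (ereal 1 * edist A B))"
    if A: "A \<in> sets borel" and B: "B \<in> sets borel"
      and sep: "edist A B \<ge> ereal \<theta>3 * ereal_ln (max (max (ediam A) (ediam B)) (ereal \<theta>4))" for A B
  proof (cases "A = {} \<or> B = {}")
    case True
    then have "edist A B = \<infinity>" by (auto simp: edist_def top_ereal_def)
    then have zero: "ereal_exp (- (ereal 1 * edist A B)) = 0"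
      by (simp add: ereal_exp_def zero_ereal_def)
    show ?thesis unfolding zero mult_zero_right using beta_mixing_empty[OF pp A B True] by simp
  next
    case False
    then obtain x0 y0 where xy: "x0 \<in> A" "y0 \<in> B" by auto
    have lower: "edist A B \<le> ereal (norm (x - y))" if "x \<in> A" "y \<in> B" for x y
      unfolding edist_def using that by (intro INF_lower2[of "(x, y)"]) auto
    have "0 \<le> edist A B" unfolding edist_def by (intro INF_greatest) auto
    then obtain s where s: "edist A B = ereal s" "0 \<le> s"
      using lower[OF xy] by (cases "edist A B") auto
    let ?m = "max (max (ediam A) (ediam B)) (ereal \<theta>4)"
    \<comment> \<open>Nonempty sets have finite distance, so the separation condition forces both to be bounded.\<close>
    have "?m \<noteq> \<infinity>"
    proof
      assume "?m = \<infinity>"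
      then show False using sep s pos by (simp add: ereal_ln_def)
    qed
    moreover have "ereal \<theta>4 \<le> ?m" by simp
    ultimately obtain m where m: "?m = ereal m" "\<theta>4 \<le> m" by (cases ?m) auto
    have ln_le: "\<theta>3 * ln m \<le> s" using sep unfolding m(1) s(1) by (simp add: ereal_ln_def)
    have m0: "0 < m" using m pos by linarith
    have diam: "norm (x - y) \<le> m" if "S \<in> {A, B}" "x \<in> S" "y \<in> S" for S x y
    proof -
      have "ereal (norm (x - y)) \<le> ediam S"
        using that(2,3) by (auto simp: ediam_def intro!: SUP_upper2[of "(x, y)"])
      also have "\<dots> \<le> ereal m" unfolding m(1)[symmetric] using that(1) by (auto simp: le_max_iff_disj)
      finally show ?thesis by simp
    qed
    have "C4 = \<theta>3 * ln \<theta>4" using pos by (simp add: \<theta>4_def)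
    also have "\<dots> \<le> \<theta>3 * ln m" using pos m by (intro mult_left_mono) auto
    finally have C4: "C4 \<le> s" using ln_le by simp
    have "m = exp (ln m)" using m0 by simp
    also have "\<dots> \<le> exp (C3 * s / (4 * DIM('a)))"
      using ln_le C by (simp add: \<theta>3_def field_simps)
    finally have m_le: "m \<le> exp (C3 * s / (4 * DIM('a)))" .
    have dist: "s \<le> norm (x - y)" if "x \<in> A" "y \<in> B" for x y
      using lower[OF that] s by simp
    have "beta_mixing M \<Xi> A B \<le> \<theta>1 * exp (- s)"
      unfolding \<theta>1_def
    proof (rule beta_mixing_le_exp[OF assms(1) b C(1-3) A B diam[of A] diam[of B] _ m_le dist])
      show "cmod (K x y) \<le> C1 * exp (- (C2 * exp (C3 * norm (x - y))))" if "x \<in> A" "y \<in> B" for x y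
        using dist[OF that] C4 by (intro assms(7)) simp
    qed (use m0 C4 C in auto)
    then show ?thesis by (simp add: s ereal_powr_def ereal_exp_def)
  qed
  show ?thesis
    unfolding EDD_def
  proof (intro conjI pp)
    show "\<exists>\<theta>0 \<theta>1 \<theta>2 \<theta>3 \<theta>4 :: real. \<theta>0 \<ge> 0 \<and> \<theta>1 > 0 \<and> \<theta>2 > 0 \<and> \<theta>3 > 0 \<and> \<theta>4 > 0 \<and>
       (\<forall>A \<in> sets borel. \<forall>B \<in> sets borel.
          edist A B \<ge> ereal \<theta>3 * ereal_ln (max (max (ediam A) (ediam B)) (ereal \<theta>4)) \<longrightarrow>
          ereal (beta_mixing M \<Xi> A B) \<le>
            ereal \<theta>1 * max (ereal_powr (ediam A) \<theta>0) 1 * max (ereal_powr (ediam B) \<theta>0) 1 *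
            ereal_exp (- (ereal \<theta>2 * edist A B)))"
    proof (rule exI[of _ 0], rule exI[of _ \<theta>1], rule exI[of _ 1], rule exI[of _ \<theta>3], rule exI[of _ \<theta>4],
        intro conjI ballI impI)
    qed (use pos in \<open>simp_all only: order_refl zero_less_one bound\<close>)
  qed
qed

end
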